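(* Let $H$ be a real separable Hilbert space, $(T_t)_{t\ge 0}$ a strongly continuous semigroup of linear operators on $H$, and let $(\mu_t)_{t\ge 0}$ be an SC-semigroup associated with $(T_t)_{t\ge0}$, where $\mu_t$ has the decomposition $$\hat\mu_t(a)=\exp\Big\{i\langle b_t,a\rangle-\tfrac12\langle R_ta,a\rangle+\int_{H^\circ}K(x,a)\,M_t(dx)\Big\},\qquad a\in H .$$ Then there is a $\sigma$-finite kernel $L_s(dx)$ from $(0,\infty)$ to $H^\circ$ satisfying $L_{r+t}=(T_tL_r)|_{H^\circ}$ for all $r,t>0$ and $$\int_0^t ds\int_{H^\circ}(1\wedge\|x\|^2)\,L_s(dx)<\infty,\qquad t\ge0,$$ such that $$\int_{H^\circ}K(x,a)\,M_t(dx)=\int_0^tds\int_{H^\circ}K(x,a)\,L_s(dx),\qquad t\ge0,\ a\in H .$$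
   Context: A family $(\mu_t)_{t\ge0}$ of Borel probability measures on $H$ is a skew convolution semigroup (SC-semigroup) associated with $(T_t)_{t\ge0}$ if $\mu_{r+t}=(T_t\mu_r)*\mu_t$ for all $r,t\ge0$, where $T_t\mu_r$ is the image (pushforward) of $\mu_r$ under $T_t$ and $*$ is convolution. $\hat\mu(a)=\int_H e^{i\langle x,a\rangle}\mu(dx)$ denotes the characteristic functional. It is known that each $\mu_t$ in an SC-semigroup is infinitely divisible, and hence its characteristic functional has the displayed decomposition with a uniquely determined triple $(b_t,R_t,M_t)$: $b_t\in H$; $R_t$ is a symmetric, positive-definite (i.e. $\langle R_ta,a\rangle\ge 0$ for all $a$), nuclear (trace class) operator on $H$; $M_t$ is a $\sigma$-finite measure (Lévy measure) on $H^\circ:=H\setminus\{0\}$ with $\int_{H^\circ}(1\wedge\|x\|^2)M_t(dx)<\infty$; and $K(x,a):=e^{i\langle x,a\rangle}-1-i\langle x,a\rangle\chi_{[0,1]}(\|x\|)$, with $\chi_{[0,1]}$ the indicator function of $[0,1]$. For a measure $L$ on $H^\circ$, $(T_tL)|_{H^\circ}$ denotes the restriction to $H^\circ$ of the image of $L$ under $T_t$. *)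

theory Defs
  imports "HOL-Probability.Probability"
begin

definition strongly_continuous_semigroup ::
    "(real \<Rightarrow> 'a::real_normed_vector \<Rightarrow> 'a) \<Rightarrow> bool" where
  "strongly_continuous_semigroup T \<longleftrightarrow>
     (\<forall>t\<ge>0. bounded_linear (T t)) \<and>
     T 0 = id \<and>
     (\<forall>r\<ge>0. \<forall>t\<ge>0. T (r + t) = T r \<circ> T t) \<and>
     (\<forall>x. continuous_on {0..} (\<lambda>t. T t x))"

text \<open>
  The constant \<open>convolution\<close> of HOL-Probability is restricted to ordered Euclidean spaces;
  this is the same definition without that restriction.
\<close>

definition measure_convolution ::
    "'a::{topological_space, plus} measure \<Rightarrow> 'a measure \<Rightarrow> 'a measure" where
  "measure_convolution M N = distr (M \<Otimes>\<^sub>M N) borel (\<lambda>(x, y). x + y)"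

definition sc_semigroup ::
    "(real \<Rightarrow> 'a::real_normed_vector \<Rightarrow> 'a) \<Rightarrow> (real \<Rightarrow> 'a measure) \<Rightarrow> bool" where
  "sc_semigroup T \<mu> \<longleftrightarrow>
     (\<forall>t\<ge>0. prob_space (\<mu> t) \<and> sets (\<mu> t) = sets borel) \<and>
     (\<forall>r\<ge>0. \<forall>t\<ge>0. \<mu> (r + t) = measure_convolution (distr (\<mu> r) borel (T t)) (\<mu> t))"

definition char_functional :: "'a::real_inner measure \<Rightarrow> 'a \<Rightarrow> complex" where
  "char_functional \<mu> a = (CLINT x|\<mu>. iexp (x \<bullet> a))"

definition symmetric_op :: "('a::real_inner \<Rightarrow> 'a) \<Rightarrow> bool" where
  "symmetric_op R \<longleftrightarrow> (\<forall>x y. R x \<bullet> y = x \<bullet> R y)"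

definition positive_op :: "('a::real_inner \<Rightarrow> 'a) \<Rightarrow> bool" where
  "positive_op R \<longleftrightarrow> (\<forall>a. 0 \<le> R a \<bullet> a)"

text \<open>
  Nuclear operators, given by an absolutely convergent series of rank-one operators; the
  functionals are represented by vectors (Riesz). On a Hilbert space these are the trace class
  operators.
\<close>

definition nuclear_op :: "('a::real_inner \<Rightarrow> 'a) \<Rightarrow> bool" where
  "nuclear_op R \<longleftrightarrow> bounded_linear R \<and>
     (\<exists>f g :: nat \<Rightarrow> 'a. summable (\<lambda>n. norm (f n) * norm (g n)) \<and>
        (\<forall>x. (\<lambda>n. (x \<bullet> f n) *\<^sub>R g n) sums R x))"

text \<open>The Borel space on \<open>H \<setminus> {0}\<close>; measures on it have underlying space \<open>- {0}\<close>.\<close>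

definition borel_punctured :: "'a::real_normed_vector measure" where
  "borel_punctured = restrict_space borel (- {0})"

definition levy_measure :: "'a::real_normed_vector measure \<Rightarrow> bool" where
  "levy_measure M \<longleftrightarrow>
     sets M = sets borel_punctured \<and> sigma_finite_measure M \<and>
     (\<integral>\<^sup>+x. ennreal (min 1 ((norm x)\<^sup>2)) \<partial>M) < \<infinity>"

definition levy_K :: "'a::real_inner \<Rightarrow> 'a \<Rightarrow> complex" where
  "levy_K x a = iexp (x \<bullet> a) - 1 - \<i> * of_real (x \<bullet> a) * indicator {0..1} (norm x)"

definition sigma_finite_kernel :: "'s measure \<Rightarrow> 'x measure \<Rightarrow> ('s \<Rightarrow> 'x measure) \<Rightarrow> bool" where
  "sigma_finite_kernel S X L \<longleftrightarrow>
     (\<forall>s\<in>space S. sets (L s) = sets X \<and> sigma_finite_measure (L s)) \<and>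
     (\<forall>B\<in>sets X. (\<lambda>s. emeasure (L s) B) \<in> borel_measurable S)"

end

theory Submission
  imports Defs
begin

text \<open>
  Comparing the Levy-Khintchine exponents of both sides of the convolution identity gives
  \<open>M (r + t) = T t (M r) + M t\<close> off the origin, so \<open>t \<mapsto> M t\<close> is increasing. Write \<open>m t\<close> for
  the integral of \<open>min 1 |x|\<^sup>2\<close> under \<open>M t\<close>. Strong continuity forces \<open>m\<close> to vanish at 0+, and
  the increments of \<open>m\<close> are quasi-decreasing, so \<open>m\<close> is locally Lipschitz on \<open>(0, \<infinity>)\<close>. Hence
  \<open>M\<close> disintegrates: \<open>M y - M x\<close> is the integral over \<open>(x, y]\<close> of a kernel \<open>\<nu> s\<close>. By Fubini,
  \<open>\<nu> (s + v) = T v (\<nu> s)\<close> for almost every \<open>v\<close>, for almost every \<open>s\<close>. Such \<open>s\<close> exist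
  arbitrarily close to 0, and \<open>L u = T (u - s) (\<nu> s)\<close> does not depend on the choice of
  \<open>s < u\<close>; this modification of \<open>\<nu>\<close> satisfies the semigroup relation everywhere.
\<close>

section \<open>Encoding points of a Polish space by reals\<close>

text \<open>Levy measures may be infinite near the origin, so increments are written as sums of
  measures, and estimates pass through the weight \<open>levy_weight\<close>, which makes each
  measure finite. The origin is a second obstacle: \<open>T t\<close> may send nonzero vectors to 0.
  The measures are therefore carried on the whole space with no mass at 0, and \<open>push\<close>
  discards what lands there.

  Comparing exponents requires that they determine the Levy measure. The exponential fixes the
  exponent only modulo 2 pi i, an ambiguity that continuity along rays removes; drift and covariance
  are eliminated by differencing.

  A kernel is determined only up to null sets. For each \<open>v\<close> and each test function the
  relation between \<open>\<nu> (s + v)\<close> and \<open>\<nu> s\<close> may fail on a null set of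
  \<open>s\<close> that depends on both. A countable determining class copes with the test
  functions, the exchange of quantifiers with the uncountably many \<open>v\<close>. The Lipschitz
  bound may degenerate at 0, so kernels are built on \<open>[\<epsilon>, t]\<close>, and the
  vanishing of the mass closes the gap as \<epsilon> tends to 0.\<close>

primrec ternary_tail :: "real \<Rightarrow> nat \<Rightarrow> real" where
  "ternary_tail r 0 = r"
| "ternary_tail r (Suc j) = 3 * ternary_tail r j - of_bool (1/3 \<le> ternary_tail r j)"

lemma measurable_ternary_tail [measurable]: "(\<lambda>r. ternary_tail r j) \<in> borel_measurable borel"
proof (induction j)
  case (Suc j)
  note Suc.IH [measurable]
  have "(\<lambda>r. of_bool (1/3 \<le> ternary_tail r j) :: real) \<in> borel_measurable borel"
    by (simp add: of_bool_def) measurable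
  then show ?case by simp
qed simp

text \<open>Digits 0 and 1 in base 3 leave a gap: a tail is at most 1/2, so a leading digit 0 keeps
  the value at or below 1/6, while a leading digit 1 lifts it to at least 1/3. The threshold 1/3
  thus reads off the digit, without the double expansions of base 2.\<close>

lemma ternary_tail_sum:
  fixes c :: "nat \<Rightarrow> bool"
  defines "r \<equiv> (\<lambda>j. \<Sum>i. of_bool (c (i + j)) * (1/3) ^ Suc i :: real)"
  shows "ternary_tail (r 0) j = r j" and "1/3 \<le> ternary_tail (r 0) j \<longleftrightarrow> c j"
proof -
  have geo: "(\<lambda>i. (1/3) ^ Suc i :: real) sums (1/2)"
    using sums_mult[OF geometric_sums[of "1/3::real"], of "1/3"] by simp
  have summ: "summable (\<lambda>i. of_bool (c (i + j)) * (1/3) ^ Suc i :: real)" for j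
    by (rule summable_comparison_test'[OF sums_summable[OF geo]]) auto
  have nn: "0 \<le> r j" for j
    unfolding r_def by (intro suminf_nonneg summ) auto
  have le: "r j \<le> 1/2" for j
    unfolding r_def sums_unique[OF geo]
    by (intro suminf_le summ sums_summable[OF geo]) (auto simp: of_bool_def)
  have step: "r j = of_bool (c j) / 3 + r (Suc j) / 3" for j
  proof -
    have "r j = (\<Sum>i. of_bool (c (Suc i + j)) * (1/3) ^ Suc (Suc i)) + of_bool (c j) / 3"
      unfolding r_def using suminf_split_head[OF summ[of j]] by simp
    also have "(\<Sum>i. of_bool (c (Suc i + j)) * (1/3) ^ Suc (Suc i)) = r (Suc j) * (1/3)"
      unfolding r_def by (subst suminf_mult2[OF summ]) (simp add: mult.assoc mult.commute)
    finally show ?thesis by simp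
  qed
  have digit: "1/3 \<le> r j \<longleftrightarrow> c j" for j
    using step[of j] nn[of "Suc j"] le[of "Suc j"] by (cases "c j") auto
  show tail: "ternary_tail (r 0) j = r j" for j
  proof (induction j)
    case (Suc j)
    have "r (Suc j) = 3 * r j - of_bool (c j)" using step[of j] by simp
    then show ?case using Suc digit[of j] by simp
  qed simp
  show "1/3 \<le> ternary_tail (r 0) j \<longleftrightarrow> c j"
    using digit tail by simp
qed

text \<open>A point is encoded by the bits telling whether it lies within \<open>(1/2) ^ k\<close>
  of the \<open>n\<close>-th point of a dense sequence. Decoding takes for each \<open>k\<close> the
  least such \<open>n\<close> and passes to the limit. A Borel left inverse suffices to carry
  measures to the real line and back.\<close>

lemma polish_real_embedding:
  obtains \<phi> :: "'a::{complete_space, second_countable_topology} \<Rightarrow> real" and \<psi> :: "real \<Rightarrow> 'a"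
  where "\<phi> \<in> borel_measurable borel" "\<psi> \<in> borel_measurable borel" "\<And>x. \<psi> (\<phi> x) = x"
proof -
  obtain D :: "'a set" where D: "countable D" "\<And>X. open X \<Longrightarrow> X \<noteq> {} \<Longrightarrow> \<exists>d \<in> D. d \<in> X"
    using countable_dense_exists by metis
  then have "D \<noteq> {}" using D(2)[of UNIV] by auto
  define d where "d = from_nat_into D"
  have dense: "\<exists>n. dist x (d n) < e" if "0 < e" for x e
  proof -
    have "ball x e \<noteq> {}" using that by simp
    then obtain y where y: "y \<in> D" "dist x y < e"
      using D(2)[of "ball x e"] by auto
    then obtain n where "d n = y"
      using from_nat_into_surj[OF D(1)] unfolding d_def by blast
    then show ?thesis using y by blast
  qed
  define c where "c x j = (case prod_decode j of (k, n) \<Rightarrow> dist x (d n) < (1/2) ^ k)" for x :: 'a and j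
  define \<phi> where "\<phi> x = (\<Sum>i. of_bool (c x i) * (1/3) ^ Suc i :: real)" for x
  define pick where "pick r k = (LEAST n. 1/3 \<le> ternary_tail r (prod_encode (k, n)))" for r k
  \<comment> \<open>The fallback \<open>d 0\<close> makes the sequence converge for every real
    \<open>r\<close>, also for those that encode no point, so \<open>\<psi>\<close> is a pointwise
    limit of Borel functions.\<close>
  define \<psi> where "\<psi> r = lim (\<lambda>k. if Cauchy (\<lambda>k. d (pick r k)) then d (pick r k) else d 0)" for r
  have [measurable]: "Measurable.pred borel (\<lambda>x. c x j)" for j
    unfolding c_def by (cases "prod_decode j") simp
  have "\<phi> \<in> borel_measurable borel"
    unfolding \<phi>_def of_bool_def by measurable
  moreover have "\<psi> \<in> borel_measurable borel"
  proof -
    have [measurable]: "(\<lambda>r. pick r k) \<in> measurable borel (count_space UNIV)" for k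
      unfolding pick_def by measurable
    have [measurable]: "Measurable.pred borel (\<lambda>r. Cauchy (\<lambda>k. d (pick r k)))"
      using sets_Collect_Cauchy[of "\<lambda>k r. d (pick r k)" borel] by (simp add: pred_def)
    have "(\<lambda>k. if Cauchy (\<lambda>k. d (pick r k)) then d (pick r k) else d 0) \<longlonglongrightarrow> \<psi> r" for r
      unfolding \<psi>_def convergent_LIMSEQ_iff[symmetric]
      by (cases "Cauchy (\<lambda>k. d (pick r k))") (auto simp: Cauchy_convergent_iff convergent_const)
    then show ?thesis
      by (rule borel_measurable_LIMSEQ_metric[rotated]) measurable
  qed
  moreover have "\<psi> (\<phi> x) = x" for x
  proof -
    have "1/3 \<le> ternary_tail (\<phi> x) (prod_encode (k, n)) \<longleftrightarrow> dist x (d n) < (1/2) ^ k" for k n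
      using ternary_tail_sum(2)[of "c x" "prod_encode (k, n)"] by (simp add: \<phi>_def c_def)
    then have close: "dist x (d (pick (\<phi> x) k)) < (1/2) ^ k" for k
      unfolding pick_def using LeastI_ex[OF dense[of "(1/2) ^ k" x]] by simp
    have "(\<lambda>k. d (pick (\<phi> x) k)) \<longlonglongrightarrow> x"
    proof (rule metric_tendsto_imp_tendsto[OF LIMSEQ_power_zero[of "1/2 :: real"]])
      show "\<forall>\<^sub>F k in sequentially. dist (d (pick (\<phi> x) k)) x \<le> dist ((1/2) ^ k) (0::real)"
        using close by (auto intro!: always_eventually less_imp_le simp: dist_commute)
    qed simp
    then show ?thesis unfolding \<psi>_def by (simp add: LIMSEQ_imp_Cauchy limI)
  qed
  ultimately show thesis by (rule that)
qed

section \<open>Characteristic functionals of finite measures\<close>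

text \<open>The value at 0 is the total mass, so both measures are normalised by the same constant
  and the uniqueness theorem for probability measures applies; mass 0 is treated separately.\<close>

lemma finite_measure_eqI_char:
  fixes M N :: "real measure"
  assumes "finite_measure M" "finite_measure N"
    and sets[measurable_cong]: "sets M = sets borel" "sets N = sets borel"
    and eq: "\<And>t. char M t = char N t"
  shows "M = N"
proof -
  interpret M: finite_measure M by fact
  interpret N: finite_measure N by fact
  have sp: "space M = UNIV" "space N = UNIV"
    using sets_eq_imp_space_eq[OF sets(1)] sets_eq_imp_space_eq[OF sets(2)] by auto
  define p where "p = measure M UNIV"
  have pN: "p = measure N UNIV"
    using eq[of 0] sp by (simp add: char_def p_def)
  show ?thesis
  proof (cases "p = 0")
    case True
    have "emeasure M A = 0" "emeasure N A = 0" for A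
      using True pN emeasure_space[of M A] emeasure_space[of N A]
      by (simp_all add: p_def M.emeasure_eq_measure[of UNIV] N.emeasure_eq_measure[of UNIV] sp)
    then show ?thesis by (intro measure_eqI) (simp_all add: sets)
  next
    case False
    then have "p > 0" unfolding p_def by (simp add: zero_less_measure_iff)
    define c where "c = ennreal (1 / p)"
    have prob: "real_distribution (density K (\<lambda>_. c))" if "sets K = sets borel" "emeasure K UNIV = ennreal p" for K
    proof -
      have "space K = UNIV" using sets_eq_imp_space_eq[OF that(1)] by simp
      then have "emeasure (density K (\<lambda>_. c)) (space (density K (\<lambda>_. c))) = 1"
        using that \<open>p > 0\<close> by (simp add: emeasure_density c_def nn_integral_cmult_indicator ennreal_mult[symmetric])
      then show ?thesis
        using that by (intro real_distribution.intro prob_spaceI real_distribution_axioms.intro) auto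
    qed
    have char: "char (density K (\<lambda>_. c)) t = (1 / p) *\<^sub>R char K t" if [measurable_cong]: "sets K = sets borel" for K t
      unfolding char_def c_def by (subst integral_density) (use \<open>p > 0\<close> in auto)
    have "density M (\<lambda>_. c) = density N (\<lambda>_. c)"
      by (intro Levy_uniqueness prob ext)
        (auto simp: char sets eq sp p_def M.emeasure_eq_measure N.emeasure_eq_measure pN[symmetric, unfolded p_def])
    then have "density (density M (\<lambda>_. c)) (\<lambda>_. ennreal p) = density (density N (\<lambda>_. c)) (\<lambda>_. ennreal p)"
      by simp
    moreover have "c * ennreal p = 1"
      using \<open>p > 0\<close> by (simp add: c_def ennreal_mult[symmetric])
    ultimately show ?thesis
      by (simp add: density_density_eq density_1)
  qed
qed

lemma integrable_iexp_inner:
  fixes P :: "'a::real_inner measure"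
  assumes "finite_measure P" "sets P = sets borel"
  shows "integrable P (\<lambda>x. iexp (x \<bullet> a))"
proof -
  interpret finite_measure P by fact
  note assms(2)[measurable_cong]
  have [measurable]: "(\<lambda>x. x \<bullet> a) \<in> borel_measurable P"
    by (intro borel_measurable_continuous_onI[THEN measurable_cong_sets[OF assms(2) refl, THEN equalityD2, THEN subsetD]] continuous_intros)
  show ?thesis
    by (rule integrable_const_bound[of _ 1]) auto
qed

text \<open>The characteristic function at \<open>t\<close> of the projection along \<open>c\<close>
  is the functional at \<open>t *\<^sub>R c\<close>, so the functional determines every
  one-dimensional projection.\<close>

lemma distr_inner_eq:
  fixes P Q :: "'a::real_inner measure"
  assumes P: "finite_measure P" "sets P = sets borel" and Q: "finite_measure Q" "sets Q = sets borel"
    and eq: "\<And>a. char_functional P a = char_functional Q a"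
  shows "distr P borel (\<lambda>x. x \<bullet> c) = distr Q borel (\<lambda>x. x \<bullet> c)"
proof -
  note [measurable_cong] = P(2) Q(2)
  have [measurable]: "(\<lambda>x. x \<bullet> c) \<in> borel_measurable borel"
    by (intro borel_measurable_continuous_onI continuous_intros)
  have "char (distr K borel (\<lambda>x. x \<bullet> c)) t = char_functional K (t *\<^sub>R c)"
    if [measurable_cong]: "sets K = sets borel" for K t
    unfolding char_def char_functional_def by (subst integral_distr) auto
  then show ?thesis
    using P Q eq by (intro finite_measure_eqI_char finite_measure.finite_measure_distr) auto
qed

text \<open>Tilting by the nonnegative weights \<open>1 + cos\<close> and \<open>1 + sin\<close> keeps the measures positive, so
  the one-dimensional uniqueness theorem applies to the tilted measures.\<close>

lemma char_functional_restrict_eq: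
  fixes P Q :: "'a::real_inner measure"
  assumes P: "finite_measure P" "sets P = sets borel" and Q: "finite_measure Q" "sets Q = sets borel"
    and eq: "\<And>a. char_functional P a = char_functional Q a"
    and B[measurable]: "B \<in> sets borel"
  shows "char_functional (density P (\<lambda>x. indicator B (x \<bullet> c))) a =
         char_functional (density Q (\<lambda>x. indicator B (x \<bullet> c))) a"
proof -
  note [measurable_cong] = P(2) Q(2)
  have [measurable]: "(\<lambda>x::'a. x \<bullet> a) \<in> borel_measurable borel" for a
    by (intro borel_measurable_continuous_onI continuous_intros)
  \<comment> \<open>A weight that is a trigonometric polynomial in \<open>x \<bullet> a\<close>
    turns the functional at \<open>b\<close> into a combination of its values at \<open>b\<close>,
    \<open>b + a\<close> and \<open>b - a\<close>. The tilted measures thus still have equal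
    functionals, and their projections along \<open>c\<close> agree on \<open>B\<close>.\<close>
  have tilt: "(LINT x|P. indicator B (x \<bullet> c) * w (x \<bullet> a)) = (LINT x|Q. indicator B (x \<bullet> c) * w (x \<bullet> a))"
    if w: "w \<in> borel_measurable borel" "\<And>y. 0 \<le> w y" "\<And>y. w y \<le> 2"
      and cf: "\<And>K b. finite_measure K \<Longrightarrow> sets K = sets borel \<Longrightarrow>
        (CLINT x|K. w (x \<bullet> a) *\<^sub>R iexp (x \<bullet> b)) = char_functional K b + u * char_functional K (b + a) + v * char_functional K (b - a)"
    for w :: "real \<Rightarrow> real" and u v
  proof -
    note w(1)[measurable]
    have fin: "finite_measure (density K (\<lambda>x. w (x \<bullet> a)))" if K: "finite_measure K" "sets K = sets borel" for K
    proof -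
      note K(2)[measurable_cong]
      interpret finite_measure K by fact
      have "emeasure (density K (\<lambda>x. w (x \<bullet> a))) (space K) = (\<integral>\<^sup>+x. w (x \<bullet> a) \<partial>K)"
        by (subst emeasure_density) (auto intro!: nn_integral_cong)
      also have "\<dots> \<le> (\<integral>\<^sup>+x. ennreal 2 \<partial>K)"
        by (intro nn_integral_mono ennreal_leI w)
      also have "\<dots> < \<infinity>" by (simp add: emeasure_eq_measure ennreal_mult_less_top)
      finally show ?thesis by (intro finite_measureI) simp
    qed
    have cfd: "char_functional (density K (\<lambda>x. w (x \<bullet> a))) b =
        char_functional K b + u * char_functional K (b + a) + v * char_functional K (b - a)"
      if K: "finite_measure K" "sets K = sets borel" for K b
    proof -
      note K(2)[measurable_cong]
      show ?thesis
        unfolding cf[OF K, symmetric] char_functional_def[of "density _ _"]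
        by (subst integral_density) (use w in auto)
    qed
    have "distr (density P (\<lambda>x. w (x \<bullet> a))) borel (\<lambda>x. x \<bullet> c) = distr (density Q (\<lambda>x. w (x \<bullet> a))) borel (\<lambda>x. x \<bullet> c)"
      using P Q by (intro distr_inner_eq fin) (auto simp: cfd eq)
    then have "(LINT y|distr (density P (\<lambda>x. w (x \<bullet> a))) borel (\<lambda>x. x \<bullet> c). indicator B y :: real) =
        (LINT y|distr (density Q (\<lambda>x. w (x \<bullet> a))) borel (\<lambda>x. x \<bullet> c). indicator B y)"
      by simp
    moreover have "(LINT y|distr (density K (\<lambda>x. w (x \<bullet> a))) borel (\<lambda>x. x \<bullet> c). indicator B y :: real) =
        (LINT x|K. indicator B (x \<bullet> c) * w (x \<bullet> a))" if [measurable_cong]: "sets K = sets borel" for K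
      by (subst integral_distr, measurable, subst integral_density) (use w(2) in \<open>auto simp: mult.commute\<close>)
    ultimately show ?thesis using P Q by simp
  qed
  have bnd: "integrable K (\<lambda>x. indicator B (x \<bullet> c) * w (x \<bullet> a))"
    if K: "finite_measure K" "sets K = sets borel" and [measurable]: "w \<in> borel_measurable borel"
      and "\<And>y. \<bar>w y\<bar> \<le> 2" for K and w :: "real \<Rightarrow> real"
  proof -
    note K(2)[measurable_cong]
    interpret finite_measure K by fact
    show ?thesis
      by (rule integrable_const_bound[of _ 2]) (auto simp: indicator_def that)
  qed
  note iI = integrable_iexp_inner
  have trig: "0 \<le> 1 + cos y" "1 + cos y \<le> 2" "0 \<le> 1 + sin y" "1 + sin y \<le> 2" for y :: real
    using cos_le_one[of y] cos_ge_minus_one[of y] sin_le_one[of y] sin_ge_minus_one[of y] by linarith+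
  have c1: "(LINT x|P. indicator B (x \<bullet> c) * 1) = (LINT x|Q. indicator B (x \<bullet> c) * (1::real))"
    by (rule tilt[of "\<lambda>_. 1" 0 0]) (auto simp: char_functional_def)
  have c2: "(LINT x|P. indicator B (x \<bullet> c) * (1 + cos (x \<bullet> a))) = (LINT x|Q. indicator B (x \<bullet> c) * (1 + cos (x \<bullet> a)))"
  proof (rule tilt[of "\<lambda>y. 1 + cos y" "1/2" "1/2"])
    fix K :: "'a measure" and b assume K: "finite_measure K" "sets K = sets borel"
    have "(1 + cos (x \<bullet> a)) *\<^sub>R iexp (x \<bullet> b) = iexp (x \<bullet> b) + 1/2 * iexp (x \<bullet> (b + a)) + 1/2 * iexp (x \<bullet> (b - a))" for x
      by (simp add: complex_eq_iff Re_exp Im_exp inner_add_right inner_diff_right cos_add cos_diff sin_add sin_diff field_simps)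
    then show "(CLINT x|K. (1 + cos (x \<bullet> a)) *\<^sub>R iexp (x \<bullet> b)) =
        char_functional K b + 1/2 * char_functional K (b + a) + 1/2 * char_functional K (b - a)"
      unfolding char_functional_def by (simp add: iI[OF K])
  qed (auto simp: trig)
  have c3: "(LINT x|P. indicator B (x \<bullet> c) * (1 + sin (x \<bullet> a))) = (LINT x|Q. indicator B (x \<bullet> c) * (1 + sin (x \<bullet> a)))"
  proof (rule tilt[of "\<lambda>y. 1 + sin y" "-\<i>/2" "\<i>/2"])
    fix K :: "'a measure" and b assume K: "finite_measure K" "sets K = sets borel"
    have "(1 + sin (x \<bullet> a)) *\<^sub>R iexp (x \<bullet> b) = iexp (x \<bullet> b) + -\<i>/2 * iexp (x \<bullet> (b + a)) + \<i>/2 * iexp (x \<bullet> (b - a))" for x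
      by (simp add: complex_eq_iff Re_exp Im_exp inner_add_right inner_diff_right cos_add cos_diff sin_add sin_diff field_simps)
    then show "(CLINT x|K. (1 + sin (x \<bullet> a)) *\<^sub>R iexp (x \<bullet> b)) =
        char_functional K b + -\<i>/2 * char_functional K (b + a) + \<i>/2 * char_functional K (b - a)"
      unfolding char_functional_def by (simp add: iI[OF K])
  qed (auto simp: trig)
  \<comment> \<open>Subtracting the untilted integral removes the added 1 and leaves the real and
    imaginary parts of the restricted functional.\<close>
  have key: "char_functional (density K (\<lambda>x. indicator B (x \<bullet> c))) a =
      Complex ((LINT x|K. indicator B (x \<bullet> c) * (1 + cos (x \<bullet> a))) - (LINT x|K. indicator B (x \<bullet> c) * 1))
        ((LINT x|K. indicator B (x \<bullet> c) * (1 + sin (x \<bullet> a))) - (LINT x|K. indicator B (x \<bullet> c) * 1))"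
    if K: "finite_measure K" "sets K = sets borel" for K
  proof -
    note K(2)[measurable_cong]
    have i: "integrable K (\<lambda>x. indicator B (x \<bullet> c) *\<^sub>R iexp (x \<bullet> a))"
      by (rule Bochner_Integration.integrable_bound[OF integrable_iexp_inner[OF K, of a]]) (auto simp: indicator_def)
    have b: "\<bar>1 + cos y\<bar> \<le> 2" "\<bar>1 + sin y\<bar> \<le> 2" for y :: real
      using trig[of y] by auto
    have "(\<lambda>x. indicator B (x \<bullet> c) :: ennreal) = (\<lambda>x. ennreal (indicator B (x \<bullet> c)))"
      by (auto simp: indicator_def)
    then have "char_functional (density K (\<lambda>x. indicator B (x \<bullet> c))) a = (CLINT x|K. indicator B (x \<bullet> c) *\<^sub>R iexp (x \<bullet> a))"
      unfolding char_functional_def by (simp only:) (subst integral_density, auto)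
    also have "\<dots> = Complex (LINT x|K. indicator B (x \<bullet> c) * cos (x \<bullet> a)) (LINT x|K. indicator B (x \<bullet> c) * sin (x \<bullet> a))"
      using i by (simp add: complex_eq_iff Re_exp Im_exp flip: integral_Re integral_Im)
    finally have "char_functional (density K (\<lambda>x. indicator B (x \<bullet> c))) a =
      Complex (LINT x|K. indicator B (x \<bullet> c) * cos (x \<bullet> a)) (LINT x|K. indicator B (x \<bullet> c) * sin (x \<bullet> a))" .
    moreover have "(LINT x|K. indicator B (x \<bullet> c) * (1 + w (x \<bullet> a))) - (LINT x|K. indicator B (x \<bullet> c) * 1) =
        (LINT x|K. indicator B (x \<bullet> c) * w (x \<bullet> a))"
      if [measurable]: "w \<in> borel_measurable borel" and w: "\<And>y. \<bar>1 + w y\<bar> \<le> 2" for w :: "real \<Rightarrow> real"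
    proof -
      have "integrable K (\<lambda>x. indicator B (x \<bullet> c) * (1 + w (x \<bullet> a)))"
        by (rule bnd[OF K]) (use w in auto)
      moreover have "integrable K (\<lambda>x. indicator B (x \<bullet> c) * (1 :: real))"
        by (rule bnd[OF K]) auto
      ultimately show ?thesis
        by (subst Bochner_Integration.integral_diff[symmetric]) (auto simp: algebra_simps)
    qed
    ultimately show ?thesis using b by simp
  qed
  show ?thesis
    unfolding key[OF P] key[OF Q] c1 c2 c3 ..
qed

section \<open>Uniqueness of finite measures via half-spaces\<close>

abbreviation halfspaces :: "('a::real_inner \<times> real) list \<Rightarrow> 'a set" where
  "halfspaces l \<equiv> {x. \<forall>(c, r)\<in>set l. x \<bullet> c \<le> r}"

lemma closed_halfspaces: "closed (halfspaces l :: 'a::real_inner set)"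
proof -
  have "(halfspaces l :: 'a set) = (\<Inter>z\<in>set l. {x. x \<bullet> fst z \<le> snd z})"
    by (auto simp: case_prod_unfold)
  then show ?thesis
    by (auto intro!: closed_INT closed_Collect_le continuous_intros)
qed

text \<open>Closed balls are intersections of half-spaces with normals in a countable dense set, and
  by separability every open set is a countable union of closed balls.\<close>

lemma borel_eq_halfspaces:
  "borel = sigma UNIV (range (\<lambda>l. (halfspaces l :: 'a::{real_inner, second_countable_topology} set)))"
  (is "_ = sigma UNIV ?E")
proof (rule borel_eq_sigmaI1)
  obtain D :: "'a set" where D: "countable D" "\<And>X. open X \<Longrightarrow> X \<noteq> {} \<Longrightarrow> \<exists>d \<in> D. d \<in> X"
    using countable_dense_exists by metis
  have half: "{x :: 'a. x \<bullet> c \<le> r} \<in> sets (sigma UNIV ?E)" for c r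
    by (intro in_measure_of) (auto intro!: range_eqI[of _ _ "[(c, r)]"])
  have cball: "cball y r \<in> sets (sigma UNIV ?E)" if "0 \<le> r" for y :: 'a and r
  proof -
    have "cball y r = (\<Inter>c\<in>D. {x. x \<bullet> c \<le> r * norm c + y \<bullet> c})"
    proof safe
      fix x c assume "x \<in> cball y r"
      then show "x \<bullet> c \<le> r * norm c + y \<bullet> c"
        using norm_cauchy_schwarz[of "x - y" c] mult_right_mono[of "norm (x - y)" r "norm c"]
        by (simp add: dist_norm norm_minus_commute inner_diff_left)
    next
      fix x assume x: "x \<in> (\<Inter>c\<in>D. {x. x \<bullet> c \<le> r * norm c + y \<bullet> c})"
      \<comment> \<open>The violating normals form an open set without points of \<open>D\<close>,
        hence an empty one. So \<open>x - y\<close> itself is no violation, which bounds its norm by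
        \<open>r\<close>.\<close>
      have "open {c. (x - y) \<bullet> c > r * norm c}"
        by (intro open_Collect_less continuous_intros)
      then have "{c. (x - y) \<bullet> c > r * norm c} = {}"
        using D(2) x by (force simp: inner_diff_left)
      then have "\<not> (x - y) \<bullet> (x - y) > r * norm (x - y)" by blast
      then show "x \<in> cball y r"
        using \<open>0 \<le> r\<close>
        by (cases "x = y") (auto simp: dist_norm norm_minus_commute power2_norm_eq_inner[symmetric] power2_eq_square not_less)
    qed
    also have "\<dots> \<in> sets (sigma UNIV ?E)"
    proof (cases "D = {}")
      case False
      then show ?thesis using D(1) half by (intro sets.countable_INT') auto
    next
      case True
      then show ?thesis using sets.top[of "sigma UNIV ?E"] by (simp add: space_measure_of_conv)
    qed
    finally show ?thesis .
  qed
  fix U :: "'a set" assume "U \<in> {S. open S}"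
  then have "open U" by simp
  have "U = (\<Union>(y, q)\<in>{(y, q). y \<in> D \<and> q \<in> \<rat> \<inter> {0..} \<and> cball y q \<subseteq> U}. cball y q)"
  proof safe
    fix x assume "x \<in> U"
    then obtain e where e: "e > 0" "ball x e \<subseteq> U" using \<open>open U\<close> open_contains_ball by blast
    obtain q where q: "q \<in> \<rat>" "0 < q" "q < e / 2" using Rats_dense_in_real[of 0 "e/2"] e by auto
    obtain y where y: "y \<in> D" "dist x y < q" using D(2)[of "ball x q"] q by force
    have "cball y q \<subseteq> U"
    proof
      fix z assume "z \<in> cball y q"
      then have "dist x z < e" using dist_triangle[of x z y] y q by (simp add: dist_commute)
      then show "z \<in> U" using e by auto
    qed
    then show "x \<in> (\<Union>(y, q)\<in>{(y, q). y \<in> D \<and> q \<in> \<rat> \<inter> {0..} \<and> cball y q \<subseteq> U}. cball y q)"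
      using y q by (force simp: dist_commute)
  qed auto
  also have "\<dots> \<in> sets (sigma UNIV ?E)"
    using cball
    by (intro sets.countable_UN') (auto intro!: countable_subset[OF _ countable_SIGMA[OF D(1), of "\<lambda>_. \<rat> \<inter> {0..}"]] countable_rat)
  finally show "U \<in> sets (sigma UNIV ?E)" .
next
  fix l :: "('a \<times> real) list"
  show "halfspaces l \<in> sets borel" by (intro borel_closed closed_halfspaces)
qed (simp add: borel_def)

text \<open>Induction on the list peels off one half-space at a time: restricting both measures to
  it keeps the functionals equal, and the empty list leaves the total masses, that is, the
  functionals at 0. The measures change along the way, so the induction ranges over all
  pairs.\<close>

theorem char_functional_unique:
  fixes P Q :: "'a::{real_inner, second_countable_topology} measure"
  assumes P: "finite_measure P" "sets P = sets borel" and Q: "finite_measure Q" "sets Q = sets borel"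
    and eq: "\<And>a. char_functional P a = char_functional Q a"
  shows "P = Q"
proof (rule measure_eqI_generator_eq[where \<Omega> = UNIV and A = "\<lambda>_. UNIV" and E = "range halfspaces"])
  have E: "emeasure P (halfspaces l) = emeasure Q (halfspaces l)" for l
    using P Q eq
  proof (induction l arbitrary: P Q)
    case Nil
    have "emeasure K UNIV = ennreal (Re (char_functional K 0))" if "finite_measure K" "sets K = sets borel" for K :: "'a measure"
      using finite_measure.emeasure_eq_measure[OF that(1)] sets_eq_imp_space_eq[OF that(2)]
      by (simp add: char_functional_def)
    then show ?case using Nil by simp
  next
    case (Cons z l)
    obtain c r where z: "z = (c, r)" by force
    have [measurable]: "(\<lambda>x::'a. x \<bullet> c) \<in> borel_measurable borel" for c
      by (intro borel_measurable_continuous_onI continuous_intros)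
    define res where "res K = density K (\<lambda>x. indicator {..r} (x \<bullet> c))" for K :: "'a measure"
    have split: "emeasure (res K) (halfspaces l) = emeasure K (halfspaces (z # l))"
      and fin: "finite_measure (res K)" if K: "finite_measure K" "sets K = sets borel" for K
    proof -
      note K(2)[measurable_cong]
      interpret finite_measure K by fact
      have sp: "space K = UNIV" using sets_eq_imp_space_eq[OF K(2)] by simp
      have [measurable]: "halfspaces l \<in> sets borel" for l :: "('a \<times> real) list"
        by (intro borel_closed closed_halfspaces)
      have "emeasure (res K) (halfspaces l) = (\<integral>\<^sup>+x. indicator (halfspaces (z # l)) x \<partial>K)"
        unfolding res_def by (subst emeasure_density) (auto intro!: nn_integral_cong simp: z split: split_indicator simp del: nn_integral_indicator)
      also have "\<dots> = emeasure K (halfspaces (z # l))"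
        by (rule nn_integral_indicator) measurable
      finally show "emeasure (res K) (halfspaces l) = emeasure K (halfspaces (z # l))" .
      have "emeasure (res K) UNIV = (\<integral>\<^sup>+x. indicator {..r} (x \<bullet> c) \<partial>K)"
        unfolding res_def by (subst emeasure_density) auto
      also have "\<dots> \<le> (\<integral>\<^sup>+x. 1 \<partial>K)"
        by (rule nn_integral_mono) (auto split: split_indicator)
      also have "\<dots> < \<infinity>" by (simp add: emeasure_eq_measure)
      finally show "finite_measure (res K)" by (intro finite_measureI) (simp add: res_def sp)
    qed
    have "emeasure (res P) (halfspaces l) = emeasure (res Q) (halfspaces l)"
      using Cons.prems
      by (intro Cons.IH fin) (auto simp: res_def intro!: char_functional_restrict_eq)
    then show ?case using split Cons.prems by simp
  qed
  show "\<And>X. X \<in> range halfspaces \<Longrightarrow> emeasure P X = emeasure Q X"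
    using E by auto
  \<comment> \<open>Appending lists makes the generator stable under intersection, which the family
    of single half-spaces is not.\<close>
  have "(halfspaces l :: 'a set) \<inter> halfspaces l' = halfspaces (l @ l')" for l l'
    by auto
  then show "Int_stable (range (\<lambda>l. (halfspaces l :: 'a set)))"
    unfolding Int_stable_def by (auto simp del: set_append)
  have "sets (borel :: 'a measure) = sigma_sets UNIV (range halfspaces)"
    by (subst borel_eq_halfspaces) simp
  then show "sets P = sigma_sets UNIV (range halfspaces)"
    "sets Q = sigma_sets UNIV (range halfspaces)"
    using P Q by auto
  show "range (\<lambda>_. UNIV) \<subseteq> range (\<lambda>l. (halfspaces l :: 'a set))"
    by (auto intro!: range_eqI[of _ _ "[]"])
  show "emeasure P UNIV \<noteq> \<infinity>" for i :: nat
    using finite_measure.emeasure_finite[OF P(1)] sets_eq_imp_space_eq[OF P(2)] by simp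
qed auto

section \<open>Kernels from increasing families of measures\<close>

text \<open>Increments are recorded as sums because a difference of infinite measures need not make
  sense.\<close>

definition add_measure :: "'a measure \<Rightarrow> 'a measure \<Rightarrow> 'a measure" where
  "add_measure M N = measure_of (space M) (sets M) (\<lambda>A. emeasure M A + emeasure N A)"

lemma sets_add_measure [simp, measurable_cong]: "sets (add_measure M N) = sets M"
  by (simp add: add_measure_def)

lemma space_add_measure [simp]: "space (add_measure M N) = space M"
  by (simp add: add_measure_def)

lemma emeasure_add_measure:
  assumes sets: "sets N = sets M" and A: "A \<in> sets M"
  shows "emeasure (add_measure M N) A = emeasure M A + emeasure N A"
proof (rule emeasure_measure_of[OF add_measure_def])
  show "countably_additive (sets (add_measure M N)) (\<lambda>A. emeasure M A + emeasure N A)"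
    using suminf_emeasure[of _ M] suminf_emeasure[of _ N] sets
    by (auto intro!: countably_additiveI simp: suminf_add[symmetric])
qed (use A sets.space_closed in \<open>auto simp: positive_def\<close>)

lemma nn_integral_add_measure:
  assumes sets: "sets N = sets M" and f: "f \<in> borel_measurable M"
  shows "(integral\<^sup>N (add_measure M N) f) = (integral\<^sup>N M f) + (integral\<^sup>N N f)"
  using f
proof induction
  case (cong f g)
  then show ?case
    using sets_eq_imp_space_eq[OF sets] by (simp cong: nn_integral_cong_simp)
next
  case (set A)
  then show ?case using sets by (simp add: emeasure_add_measure)
next
  case (mult u c)
  then have "u \<in> borel_measurable N" using measurable_cong_sets[OF sets refl] by blast
  then show ?case using mult by (simp add: nn_integral_cmult distrib_left)
next
  case (add u v)
  then have "u \<in> borel_measurable N" "v \<in> borel_measurable N" using measurable_cong_sets[OF sets refl] by blast+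
  then show ?case using add by (simp add: nn_integral_add ac_simps)
next
  case (seq U)
  have "U i \<in> borel_measurable N" for i
    using seq(1) measurable_cong_sets[OF sets refl] by blast
  moreover have mono: "incseq (\<lambda>i. integral\<^sup>N K (U i))" for K
    using seq by (auto simp: incseq_def le_fun_def intro!: nn_integral_mono)
  ultimately show ?case
    using seq unfolding SUP_apply image_comp
    by (subst (1 2 3) nn_integral_monotone_convergence_SUP)
      (auto simp: ennreal_SUP_add[OF mono mono] comp_def)
qed

lemma UN_Ioc_nat: "(\<Union>i. {- real i <.. real i}) = UNIV"
proof (intro equalityI subsetI UNIV_I)
  fix x :: real
  obtain n where "\<bar>x\<bar> < real n" using reals_Archimedean2 by blast
  then show "x \<in> (\<Union>i. {- real i <.. real i})" by (intro UN_I[of n]) auto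
qed

section \<open>Measures and densities on the real line tested on half-open intervals\<close>

lemma borel_measure_eqI_Ioc:
  fixes M N :: "real measure"
  assumes sets: "sets M = sets borel" "sets N = sets borel"
    and eq: "\<And>x y. x \<le> y \<Longrightarrow> emeasure M {x<..y} = emeasure N {x<..y}"
    and fin: "\<And>x y. x \<le> y \<Longrightarrow> emeasure M {x<..y} \<noteq> \<infinity>"
  shows "M = N"
proof (rule measure_eqI_generator_eq[where \<Omega> = UNIV and A = "\<lambda>i. {- real i <.. real i}" and E = "range (\<lambda>(a, b). {a <.. b::real})"])
  have *: "sets borel = sigma_sets UNIV (range (\<lambda>(a, b). {a <.. b::real}))"
    by (subst borel_sigma_sets_Ioc) (rule sets_measure_of, simp)
  show "sets M = sigma_sets UNIV (range (\<lambda>(a, b). {a <.. b::real}))"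
    "sets N = sigma_sets UNIV (range (\<lambda>(a, b). {a <.. b::real}))"
    using sets * by auto
  show "emeasure M X = emeasure N X" if "X \<in> range (\<lambda>(a, b). {a <.. b::real})" for X
  proof -
    have "emeasure M {a<..b} = emeasure N {a<..b}" for a b
      using eq[of a b] by (cases "a \<le> b") auto
    then show ?thesis using that by auto
  qed
  show "Int_stable (range (\<lambda>(a, b). {a <.. b::real}))"
    by (auto simp: Int_stable_def Int_greaterThanAtMost)
  show "(\<Union>i. {- real i <.. real i}) = UNIV" by (rule UN_Ioc_nat)
  show "emeasure M {- real i <.. real i} \<noteq> \<infinity>" for i using fin[of "- real i" "real i"] by simp
qed auto

lemma AE_eqI_Ioc:
  fixes d e :: "real \<Rightarrow> ennreal"
  assumes [measurable]: "d \<in> borel_measurable borel" "e \<in> borel_measurable borel"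
    and eq: "\<And>x y. x \<le> y \<Longrightarrow> (\<integral>\<^sup>+t\<in>{x<..y}. d t \<partial>lborel) = (\<integral>\<^sup>+t\<in>{x<..y}. e t \<partial>lborel)"
    and fin: "\<And>x y. x \<le> y \<Longrightarrow> (\<integral>\<^sup>+t\<in>{x<..y}. d t \<partial>lborel) \<noteq> \<infinity>"
  shows "AE t in lborel. d t = e t"
proof (rule sigma_finite_measure.density_unique[OF sigma_finite_lborel])
  show "density lborel d = density lborel e"
    using assms by (intro borel_measure_eqI_Ioc) (auto simp: emeasure_density)
qed auto

text \<open>Multiplying by the indicator of the window reduces to the global criterion; every test
  interval is clipped to the window.\<close>

lemma AE_eqI_Ioc_within:
  fixes d e :: "real \<Rightarrow> ennreal"
  assumes [measurable]: "d \<in> borel_measurable borel" "e \<in> borel_measurable borel"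
    and eq: "\<And>x y. a \<le> x \<Longrightarrow> x \<le> y \<Longrightarrow> y \<le> b \<Longrightarrow>
      (\<integral>\<^sup>+t\<in>{x<..y}. d t \<partial>lborel) = (\<integral>\<^sup>+t\<in>{x<..y}. e t \<partial>lborel) \<and> (\<integral>\<^sup>+t\<in>{x<..y}. d t \<partial>lborel) \<noteq> \<infinity>"
  shows "AE t in lborel. t \<in> {a<..b} \<longrightarrow> d t = e t"
proof -
  have "AE t in lborel. indicator {a<..b} t * d t = indicator {a<..b} t * e t"
  proof (rule AE_eqI_Ioc)
    fix x y :: real
    define x' where "x' = max x a"
    define y' where "y' = min y b"
    have *: "(\<integral>\<^sup>+t\<in>{x<..y}. (indicator {a<..b} t * h t) \<partial>lborel) = (\<integral>\<^sup>+t\<in>{x'<..y'}. h t \<partial>lborel)" for h :: "real \<Rightarrow> ennreal"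
      by (intro nn_integral_cong) (auto simp: x'_def y'_def split: split_indicator)
    have "(\<integral>\<^sup>+t\<in>{x'<..y'}. d t \<partial>lborel) = (\<integral>\<^sup>+t\<in>{x'<..y'}. e t \<partial>lborel) \<and> (\<integral>\<^sup>+t\<in>{x'<..y'}. d t \<partial>lborel) \<noteq> \<infinity>"
      using eq[of x' y'] by (cases "x' \<le> y'") (auto simp: x'_def y'_def)
    then show "(\<integral>\<^sup>+t\<in>{x<..y}. (indicator {a<..b} t * d t) \<partial>lborel) = (\<integral>\<^sup>+t\<in>{x<..y}. (indicator {a<..b} t * e t) \<partial>lborel)"
      "(\<integral>\<^sup>+t\<in>{x<..y}. (indicator {a<..b} t * d t) \<partial>lborel) \<noteq> \<infinity>"
      unfolding * by auto
  qed simp_all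
  then show ?thesis by eventually_elim (auto split: split_indicator_asm)
qed

lemma AE_lborel_in_interval:
  assumes "AE t in lborel. P t" "a < (b :: real)"
  obtains t where "a < t" "t < b" "P t"
proof -
  have "\<not> (AE t in lborel. t \<notin> {a<..<b})"
  proof
    assume "AE t in lborel. t \<notin> {a<..<b}"
    then have "emeasure lborel {a<..<b} = 0"
      by (subst (asm) AE_iff_measurable[of "{a<..<b}"]) auto
    then show False using assms(2) by simp
  qed
  then have "\<exists>t. t \<in> {a<..<b} \<and> P t"
    using assms(1) by (metis (mono_tags, lifting) eventually_mono)
  then show thesis using that by auto
qed

lemma continuous_at_right_lipschitz:
  fixes F :: "real \<Rightarrow> real"
  assumes mono: "\<And>x y. x \<le> y \<Longrightarrow> F x \<le> F y" and lip: "\<And>x y. x \<le> y \<Longrightarrow> F y - F x \<le> y - x"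
  shows "continuous (at_right a) F"
  unfolding continuous_within
proof (rule tendsto_sandwich[of "\<lambda>_. F a" _ _ "\<lambda>x. F a + (x - a)"])
  show "((\<lambda>x. F a + (x - a)) \<longlongrightarrow> F a) (at_right a)"
    by (auto intro!: tendsto_eq_intros)
qed (use lip[of a] mono[of a] in \<open>auto simp: eventually_at_right_less algebra_simps intro!: eventually_at_rightI[of a "a + 1"]\<close>)

text \<open>Both \<open>F\<close> and \<open>t - F t\<close> increase, and their Stieltjes measures
  add up to Lebesgue measure. Each is therefore absolutely continuous, and the two densities sum to
  1, which bounds each by 1.\<close>

lemma lipschitz_has_density:
  fixes F :: "real \<Rightarrow> real"
  assumes mono: "\<And>x y. x \<le> y \<Longrightarrow> F x \<le> F y" and lip: "\<And>x y. x \<le> y \<Longrightarrow> F y - F x \<le> y - x"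
  obtains d :: "real \<Rightarrow> real" where "d \<in> borel_measurable borel" "\<And>t. 0 \<le> d t" "\<And>t. d t \<le> 1"
    "\<And>x y. x \<le> y \<Longrightarrow> (\<integral>\<^sup>+t\<in>{x<..y}. ennreal (d t) \<partial>lborel) = ennreal (F y - F x)"
proof -
  define E where "E t = t - F t" for t
  define \<alpha> where "\<alpha> = interval_measure F"
  define \<beta> where "\<beta> = interval_measure E"
  have [simp, measurable_cong]: "sets \<alpha> = sets borel" "sets \<beta> = sets borel" by (auto simp: \<alpha>_def \<beta>_def)
  have \<alpha>: "emeasure \<alpha> {x<..y} = ennreal (F y - F x)" if "x \<le> y" for x y
    unfolding \<alpha>_def by (rule emeasure_interval_measure_Ioc[OF that mono continuous_at_right_lipschitz[OF mono lip]])
  have E: "E x \<le> E y" "E y - E x \<le> y - x" if "x \<le> y" for x y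
    using lip[OF that] mono[OF that] by (auto simp: E_def)
  have \<beta>: "emeasure \<beta> {x<..y} = ennreal (E y - E x)" if "x \<le> y" for x y
    unfolding \<beta>_def by (rule emeasure_interval_measure_Ioc[OF that E(1) continuous_at_right_lipschitz[OF E]])
  have "add_measure \<alpha> \<beta> = lborel"
  proof (rule borel_measure_eqI_Ioc)
    fix x y :: real assume xy: "x \<le> y"
    have "emeasure (add_measure \<alpha> \<beta>) {x<..y} = ennreal (F y - F x) + ennreal (E y - E x)"
      using xy by (simp add: emeasure_add_measure \<alpha> \<beta>)
    also have "\<dots> = ennreal (y - x)"
      using E(1)[OF xy] mono[OF xy] by (subst ennreal_plus[symmetric]) (auto simp: E_def)
    finally show "emeasure (add_measure \<alpha> \<beta>) {x<..y} = emeasure lborel {x<..y}"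
      "emeasure (add_measure \<alpha> \<beta>) {x<..y} \<noteq> \<infinity>"
      using xy by auto
  qed auto
  then have sum: "emeasure \<alpha> A + emeasure \<beta> A = emeasure lborel A" if "A \<in> sets borel" for A
    using that emeasure_add_measure[of \<beta> \<alpha> A] by simp
  have "absolutely_continuous lborel \<alpha>" "absolutely_continuous lborel \<beta>"
    using sum by (auto simp: absolutely_continuous_def null_sets_def) (metis add_eq_0_iff_both_eq_0)+
  then obtain d e where [measurable]: "d \<in> borel_measurable borel" "e \<in> borel_measurable borel"
    and d: "density lborel d = \<alpha>" and e: "density lborel e = \<beta>"
    using sigma_finite_measure.Radon_Nikodym[OF sigma_finite_lborel, of \<alpha>]
      sigma_finite_measure.Radon_Nikodym[OF sigma_finite_lborel, of \<beta>] by auto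
  have "AE t in lborel. d t + e t = 1"
  proof (rule AE_eqI_Ioc)
    fix x y :: real assume xy: "x \<le> y"
    have "(\<integral>\<^sup>+t\<in>{x<..y}. (d t + e t) \<partial>lborel) = emeasure \<alpha> {x<..y} + emeasure \<beta> {x<..y}"
      unfolding d[symmetric] e[symmetric] by (simp add: emeasure_density distrib_right nn_integral_add)
    then show "(\<integral>\<^sup>+t\<in>{x<..y}. (d t + e t) \<partial>lborel) = (\<integral>\<^sup>+t\<in>{x<..y}. 1 \<partial>lborel)"
      "(\<integral>\<^sup>+t\<in>{x<..y}. (d t + e t) \<partial>lborel) \<noteq> \<infinity>"
      using sum xy by auto
  qed auto
  \<comment> \<open>The cut-off at 1 changes the density only on a null set and yields a real-valued
    version bounded everywhere.\<close>
  then have AE: "AE t in lborel. d t = ennreal (enn2real (min 1 (d t)))"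
  proof eventually_elim
    case (elim t)
    then have "d t \<le> 1" by (metis le_iff_add)
    then show ?case by (auto simp: min_def ennreal_enn2real_if top_unique)
  qed
  show thesis
  proof
    show "(\<lambda>t. enn2real (min 1 (d t))) \<in> borel_measurable borel" by measurable
    show "enn2real (min 1 (d t)) \<le> 1" for t
      by (metis enn2real_1 enn2real_mono ennreal_one_less_top min.cobounded1)
    fix x y :: real assume "x \<le> y"
    have "(\<integral>\<^sup>+t\<in>{x<..y}. ennreal (enn2real (min 1 (d t))) \<partial>lborel) = (\<integral>\<^sup>+t\<in>{x<..y}. d t \<partial>lborel)"
      using AE by (intro nn_integral_cong_AE) (auto elim!: eventually_mono)
    also have "\<dots> = ennreal (F y - F x)"
      using \<alpha>[OF \<open>x \<le> y\<close>] unfolding d[symmetric] by (simp add: emeasure_density)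
    finally show "(\<integral>\<^sup>+t\<in>{x<..y}. ennreal (enn2real (min 1 (d t))) \<partial>lborel) = ennreal (F y - F x)" .
  qed auto
qed

text \<open>For each fixed \<open>a\<close> the mass of \<open>{..a}\<close> is Lipschitz in
  \<open>t\<close> and has a density, but the null sets depend on \<open>a\<close>. Regularising
  over rational \<open>a\<close> gives for every \<open>t\<close> an increasing right-continuous
  function, whose Stieltjes measure is the kernel.\<close>

lemma real_disintegration:
  fixes \<rho> :: "real \<Rightarrow> real measure"
  assumes fin: "\<And>t. finite_measure (\<rho> t)" and sets: "\<And>t. sets (\<rho> t) = sets borel"
    and mono: "\<And>x y A. x \<le> y \<Longrightarrow> A \<in> sets borel \<Longrightarrow> emeasure (\<rho> x) A \<le> emeasure (\<rho> y) A"
    and lip: "\<And>x y. x \<le> y \<Longrightarrow> measure (\<rho> y) UNIV - measure (\<rho> x) UNIV \<le> y - x"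
  obtains \<nu> where "\<nu> \<in> borel \<rightarrow>\<^sub>M subprob_algebra borel"
    "\<And>x y. x \<le> y \<Longrightarrow> \<rho> y = add_measure (\<rho> x) (density lborel (indicator {x<..y}) \<bind> \<nu>)"
proof -
  interpret \<rho>: finite_measure "\<rho> t" for t by (rule fin)
  note [measurable_cong] = sets
  have sp: "space (\<rho> t) = UNIV" for t using sets_eq_imp_space_eq[OF sets] by simp
  define F where "F a t = measure (\<rho> t) {..a}" for a t
  define inc where "inc A x y = measure (\<rho> y) A - measure (\<rho> x) A" for A x y
  have inc_nn: "0 \<le> inc A x y" if "x \<le> y" "A \<in> sets borel" for A x y
    using mono[OF that] by (simp add: inc_def \<rho>.emeasure_eq_measure)
  have inc_add: "inc (A \<union> B) x y = inc A x y + inc B x y" if "A \<in> sets borel" "B \<in> sets borel" "A \<inter> B = {}" for A B x y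
    using that unfolding inc_def by (subst (1 2) \<rho>.finite_measure_Union) (auto simp: sets)
  have inc_split: "inc {..b} x y = inc {..a} x y + inc {a<..b} x y" if "a \<le> b" for a b x y
  proof -
    have "{..a} \<union> {a<..b} = {..b}" "{..a} \<inter> {a<..b} = {}" using that by auto
    then show ?thesis using inc_add[of "{..a}" "{a<..b}" x y] by simp
  qed
  have inc_le: "inc A x y \<le> y - x" if "x \<le> y" "A \<in> sets borel" for A x y
  proof -
    have "inc UNIV x y = inc A x y + inc (- A) x y"
      using inc_add[of A "- A" x y] that by (simp add: Compl_partition)
    moreover have "0 \<le> inc (- A) x y" using that by (intro inc_nn) auto
    ultimately show ?thesis using lip[OF \<open>x \<le> y\<close>] by (simp add: inc_def)
  qed
  have meas_mono: "measure (\<rho> x) A \<le> measure (\<rho> y) A" "measure (\<rho> y) A - measure (\<rho> x) A \<le> y - x"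
    if "x \<le> y" "A \<in> sets borel" for A x y
    using inc_nn[OF that] inc_le[OF that] by (auto simp: inc_def)
  have "\<exists>d \<in> borel_measurable borel. (\<forall>t. 0 \<le> d t \<and> d t \<le> 1) \<and>
      (\<forall>x y. x \<le> y \<longrightarrow> (\<integral>\<^sup>+t\<in>{x<..y}. ennreal (d t) \<partial>lborel) = ennreal (inc A x y))" if "A \<in> sets borel" for A
  proof -
    have m: "measure (\<rho> x) A \<le> measure (\<rho> y) A" "measure (\<rho> y) A - measure (\<rho> x) A \<le> y - x"
      if "x \<le> y" for x y
      using meas_mono[OF that \<open>A \<in> sets borel\<close>] by auto
    obtain d where "d \<in> borel_measurable borel" "\<And>t. 0 \<le> d t" "\<And>t. d t \<le> 1"
      "\<And>x y. x \<le> y \<Longrightarrow> (\<integral>\<^sup>+t\<in>{x<..y}. ennreal (d t) \<partial>lborel) = ennreal (measure (\<rho> y) A - measure (\<rho> x) A)"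
      using lipschitz_has_density[of "\<lambda>t. measure (\<rho> t) A", OF m]
      by blast
    then show ?thesis unfolding inc_def by blast
  qed
  then obtain dA where dA: "\<And>A. A \<in> sets borel \<Longrightarrow> dA A \<in> borel_measurable borel"
    "\<And>A t. A \<in> sets borel \<Longrightarrow> 0 \<le> dA A t" "\<And>A t. A \<in> sets borel \<Longrightarrow> dA A t \<le> 1"
    "\<And>A x y. A \<in> sets borel \<Longrightarrow> x \<le> y \<Longrightarrow> (\<integral>\<^sup>+t\<in>{x<..y}. ennreal (dA A t) \<partial>lborel) = ennreal (inc A x y)"
    by metis
  define d where "d a = dA {..a}" for a :: real
  have d[measurable]: "d a \<in> borel_measurable borel" and d_nn: "0 \<le> d a t" and d_le: "d a t \<le> 1"
    and d_int: "x \<le> y \<Longrightarrow> (\<integral>\<^sup>+t\<in>{x<..y}. ennreal (d a t) \<partial>lborel) = ennreal (inc {..a} x y)" for a t x y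
    unfolding d_def by (auto intro!: dA)
  have d_mono: "AE t in lborel. d a t \<le> d b t" if "a \<le> b" for a b
  proof -
    have "AE t in lborel. ennreal (d a t) + ennreal (dA {a<..b} t) = ennreal (d b t)"
    proof (rule AE_eqI_Ioc)
      fix x y :: real assume xy: "x \<le> y"
      show "(\<integral>\<^sup>+t\<in>{x<..y}. (ennreal (d a t) + ennreal (dA {a<..b} t)) \<partial>lborel) = (\<integral>\<^sup>+t\<in>{x<..y}. ennreal (d b t) \<partial>lborel)"
        using xy dA(1)[of "{a<..b}"] inc_nn[OF xy, of "{..a}"] inc_nn[OF xy, of "{a<..b}"]
        by (simp add: distrib_right nn_integral_add d_int dA(4) inc_split[OF that] ennreal_plus)
      then show "(\<integral>\<^sup>+t\<in>{x<..y}. (ennreal (d a t) + ennreal (dA {a<..b} t)) \<partial>lborel) \<noteq> \<infinity>"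
        using xy by (simp add: d_int)
    qed (use dA(1)[of "{a<..b}"] in auto)
    then show ?thesis
    proof eventually_elim
      case (elim t)
      then have "ennreal (d a t) \<le> ennreal (d b t)" by (metis le_iff_add)
      then show ?case using d_nn by simp
    qed
  qed
  define Q where "Q x = {q \<in> \<rat>. x < q}" for x :: real
  have Q: "countable (Q x)" "Q x \<noteq> {}" for x
    unfolding Q_def using Rats_dense_in_real[of x "x + 1"] by (auto intro: countable_subset[OF _ countable_rat])
  \<comment> \<open>The infimum over larger rationals is increasing and right continuous in
    \<open>x\<close> for every \<open>t\<close>, even where the family \<open>d\<close> fails to be
    monotone. Only its differences enter the kernel, so its limit at minus infinity may be
    nonzero.\<close>
  define G where "G t x = (INF q\<in>Q x. d q t)" for t x
  have bdd: "bdd_below ((\<lambda>q. d q t) ` Q x)" for t x by (rule bdd_belowI[of _ 0]) (auto simp: d_nn)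
  have [measurable]: "(\<lambda>t. G t x) \<in> borel_measurable borel" for x
    unfolding G_def using Q by measurable
  have G_le_d: "G t x \<le> d q t" if "q \<in> Q x" for t x q
    unfolding G_def by (rule cINF_lower[OF bdd that])
  have G_mono: "G t x \<le> G t y" if "x \<le> y" for t x y
    unfolding G_def by (rule cINF_superset_mono[OF Q(2) bdd]) (use that in \<open>auto simp: Q_def\<close>)
  have G_nn: "0 \<le> G t x" for t x
    unfolding G_def by (rule cINF_greatest[OF Q(2)]) (rule d_nn)
  have G_1: "G t x \<le> 1" for t x
    using Q(2)[of x] G_le_d d_le order_trans by (metis all_not_in_conv)
  have G_cont: "continuous (at_right x) (G t)" for t x
    unfolding continuous_within
  proof (rule order_tendstoI)
    fix e assume "e < G t x"
    then show "\<forall>\<^sub>F y in at_right x. e < G t y"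
      using G_mono[of x _ t] by (intro eventually_at_rightI[of x "x + 1"]) (auto intro: less_le_trans)
  next
    fix e assume "G t x < e"
    then obtain q where q: "q \<in> Q x" "d q t < e"
      unfolding G_def by (subst (asm) cINF_less_iff[OF Q(2) bdd]) auto
    then show "\<forall>\<^sub>F y in at_right x. G t y < e"
      by (intro eventually_at_rightI[of x q]) (auto simp: Q_def intro!: le_less_trans[OF G_le_d])
  qed
  have G_int: "(\<integral>\<^sup>+t\<in>{x<..y}. ennreal (G t a) \<partial>lborel) = ennreal (inc {..a} x y)" if xy: "x \<le> y" for x y a
  \<comment> \<open>One bound holds since almost everywhere the density for \<open>a\<close> lies
    below those for all rationals \<open>q > a\<close>. For the other, a rational between
    \<open>a\<close> and \<open>b\<close> is inserted and \<open>b\<close> decreases to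
    \<open>a\<close>, using right continuity of the distribution functions of
    \<open>\<rho>\<close>.\<close>
  proof (rule antisym)
    have "AE t in lborel. \<forall>q\<in>Q a. d a t \<le> d q t"
      using Q by (subst AE_ball_countable) (auto simp: Q_def intro!: d_mono)
    then have "AE t in lborel. d a t \<le> G t a"
      unfolding G_def by eventually_elim (auto intro!: cINF_greatest Q)
    then show "ennreal (inc {..a} x y) \<le> (\<integral>\<^sup>+t\<in>{x<..y}. ennreal (G t a) \<partial>lborel)"
      unfolding d_int[OF xy, symmetric]
      by (intro nn_integral_mono_AE) (auto elim!: eventually_mono split: split_indicator intro!: ennreal_leI)
    have le: "(\<integral>\<^sup>+t\<in>{x<..y}. ennreal (G t a) \<partial>lborel) \<le> ennreal (inc {..b} x y)" if "a < b" for b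
    proof -
      obtain q where q: "q \<in> \<rat>" "a < q" "q < b" using Rats_dense_in_real[OF \<open>a < b\<close>] by auto
      have "(\<integral>\<^sup>+t\<in>{x<..y}. ennreal (G t a) \<partial>lborel) \<le> (\<integral>\<^sup>+t\<in>{x<..y}. ennreal (d q t) \<partial>lborel)"
        using q by (intro nn_integral_mono) (auto split: split_indicator intro!: ennreal_leI G_le_d simp: Q_def)
      also have "\<dots> \<le> ennreal (inc {..b} x y)"
        using inc_nn[OF xy, of "{q<..b}"] inc_split[of q b] q by (simp add: d_int[OF xy] ennreal_leI)
      finally show ?thesis .
    qed
    have "((\<lambda>b. inc {..b} x y) \<longlongrightarrow> inc {..a} x y) (at_right a)"
    proof -
      have "finite_borel_measure (\<rho> t)" for t
        by (intro finite_borel_measure.intro fin finite_borel_measure_axioms.intro sets)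
      from finite_borel_measure.cdf_is_right_cont[OF this]
      show ?thesis unfolding inc_def
        by (intro tendsto_diff) (auto simp: continuous_within cdf_def)
    qed
    then have "((\<lambda>b. ennreal (inc {..b} x y)) \<longlongrightarrow> ennreal (inc {..a} x y)) (at_right a)"
      by (rule tendsto_ennrealI)
    then show "(\<integral>\<^sup>+t\<in>{x<..y}. ennreal (G t a) \<partial>lborel) \<le> ennreal (inc {..a} x y)"
      by (rule tendsto_lowerbound) (auto intro!: eventually_at_rightI[of a "a + 1"] le)
  qed
  define \<nu> where "\<nu> t = interval_measure (G t)" for t
  have \<nu>: "emeasure (\<nu> t) {a<..b} = ennreal (G t b - G t a)" if "a \<le> b" for t a b
    unfolding \<nu>_def by (rule emeasure_interval_measure_Ioc[OF that G_mono G_cont])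
  have \<nu>_UNIV: "emeasure (\<nu> t) UNIV = (SUP n. ennreal (G t (real n) - G t (- real n)))" for t
  proof -
    have "(SUP n. emeasure (\<nu> t) {- real n <.. real n}) = emeasure (\<nu> t) (\<Union>i. {- real i <.. real i})"
      by (rule SUP_emeasure_incseq) (auto simp: \<nu>_def incseq_def)
    then show ?thesis by (simp add: \<nu> UN_Ioc_nat)
  qed
  have kernel[measurable]: "\<nu> \<in> borel \<rightarrow>\<^sub>M subprob_algebra borel"
  proof (rule measurable_subprob_algebra_generated[where \<Omega> = UNIV and G = "range (\<lambda>(a, b). {a <.. b::real})"])
    show "sets borel = sigma_sets UNIV (range (\<lambda>(a, b). {a <.. b::real}))"
      by (subst borel_sigma_sets_Ioc) (rule sets_measure_of, simp)
    show "Int_stable (range (\<lambda>(a, b). {a <.. b::real}))"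
      by (auto simp: Int_stable_def Int_greaterThanAtMost)
    show "subprob_space (\<nu> t)" for t
    proof (rule subprob_spaceI)
      have "G t (real n) - G t (- real n) \<le> 1" for n
        using G_1[of t "real n"] G_nn[of t "- real n"] by linarith
      then show "emeasure (\<nu> t) (space (\<nu> t)) \<le> 1"
        using \<nu>_UNIV[of t] by (simp add: \<nu>_def SUP_le_iff)
    qed (simp add: \<nu>_def)
    show "(\<lambda>t. emeasure (\<nu> t) UNIV) \<in> borel_measurable borel"
      unfolding \<nu>_UNIV by measurable
    show "(\<lambda>t. emeasure (\<nu> t) A) \<in> borel_measurable borel" if "A \<in> range (\<lambda>(a, b). {a <.. b::real})" for A
    proof -
      have "(\<lambda>t. emeasure (\<nu> t) {a<..b}) \<in> borel_measurable borel" for a b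
        by (cases "a \<le> b") (simp_all add: \<nu>)
      then show ?thesis using that by auto
    qed
  qed (auto simp: \<nu>_def)
  show thesis
  proof (rule that[OF kernel])
    fix x y :: real assume xy: "x \<le> y"
    let ?\<kappa> = "density lborel (indicator {x<..y}) \<bind> \<nu>"
    have [simp]: "sets ?\<kappa> = sets borel"
      by (rule sets_bind) (auto simp: \<nu>_def)
    have \<kappa>: "emeasure ?\<kappa> {a<..b} = ennreal (inc {a<..b} x y)" if ab: "a \<le> b" for a b
    proof -
      have "emeasure ?\<kappa> {a<..b} = (\<integral>\<^sup>+t\<in>{x<..y}. emeasure (\<nu> t) {a<..b} \<partial>lborel)"
        by (subst emeasure_bind[of _ _ borel]) (auto simp: nn_integral_density mult.commute)
      also have "\<dots> = (\<integral>\<^sup>+t. (ennreal (G t b) * indicator {x<..y} t - ennreal (G t a) * indicator {x<..y} t) \<partial>lborel)"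
        using ab by (intro nn_integral_cong) (auto simp: \<nu> ennreal_minus G_nn split: split_indicator)
      also have "\<dots> = ennreal (inc {..b} x y) - ennreal (inc {..a} x y)"
        unfolding G_int[OF xy, symmetric]
        using ab by (intro nn_integral_diff) (auto simp: G_int[OF xy] intro!: AE_I2 ennreal_leI G_mono split: split_indicator)
      also have "\<dots> = ennreal (inc {a<..b} x y)"
        using inc_nn[OF xy, of "{..a}"] by (simp add: inc_split[OF ab] ennreal_minus)
      finally show ?thesis .
    qed
    show "\<rho> y = add_measure (\<rho> x) ?\<kappa>"
    proof (rule borel_measure_eqI_Ioc)
      fix a b :: real assume ab: "a \<le> b"
      show "emeasure (\<rho> y) {a<..b} = emeasure (add_measure (\<rho> x) ?\<kappa>) {a<..b}"
        using ab inc_nn[OF xy, of "{a<..b}"]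
        by (simp add: emeasure_add_measure sets \<kappa> \<rho>.emeasure_eq_measure ennreal_plus[symmetric] del: ennreal_plus)
          (simp add: inc_def)
    qed (auto simp: sets)
  qed
qed

text \<open>The Borel encoding preserves total masses and monotonicity, so the real case applies to
  the images; the resulting kernel is carried back by the left inverse.\<close>

lemma disintegration:
  fixes \<rho> :: "real \<Rightarrow> 'a::{complete_space, second_countable_topology} measure"
  assumes fin: "\<And>t. finite_measure (\<rho> t)" and sets: "\<And>t. sets (\<rho> t) = sets borel"
    and mono: "\<And>x y A. x \<le> y \<Longrightarrow> A \<in> sets borel \<Longrightarrow> emeasure (\<rho> x) A \<le> emeasure (\<rho> y) A"
    and lip: "\<And>x y. x \<le> y \<Longrightarrow> measure (\<rho> y) UNIV - measure (\<rho> x) UNIV \<le> y - x"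
  obtains \<nu> where "\<nu> \<in> borel \<rightarrow>\<^sub>M subprob_algebra borel"
    "\<And>x y. x \<le> y \<Longrightarrow> \<rho> y = add_measure (\<rho> x) (density lborel (indicator {x<..y}) \<bind> \<nu>)"
proof -
  note [measurable_cong] = sets
  have sp: "space (\<rho> t) = UNIV" for t using sets_eq_imp_space_eq[OF sets] by simp
  obtain \<phi> :: "'a \<Rightarrow> real" and \<psi> where [measurable]: "\<phi> \<in> borel_measurable borel" "\<psi> \<in> borel_measurable borel"
    and \<psi>\<phi>: "\<And>x. \<psi> (\<phi> x) = x"
    using polish_real_embedding by blast
  obtain \<nu>' where [measurable]: "\<nu>' \<in> borel \<rightarrow>\<^sub>M subprob_algebra borel"
    and \<nu>': "\<And>x y. x \<le> y \<Longrightarrow> distr (\<rho> y) borel \<phi> = add_measure (distr (\<rho> x) borel \<phi>) (density lborel (indicator {x<..y}) \<bind> \<nu>')"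
  proof (rule real_disintegration[of "\<lambda>t. distr (\<rho> t) borel \<phi>"])
    show "finite_measure (distr (\<rho> t) borel \<phi>)" for t
      by (intro finite_measure.finite_measure_distr fin) simp
    show "emeasure (distr (\<rho> x) borel \<phi>) A \<le> emeasure (distr (\<rho> y) borel \<phi>) A" if "x \<le> y" "A \<in> sets borel" for x y A
      using that measurable_sets_borel[of \<phi> borel A] by (auto simp: emeasure_distr sp intro!: mono)
    show "measure (distr (\<rho> y) borel \<phi>) UNIV - measure (distr (\<rho> x) borel \<phi>) UNIV \<le> y - x" if "x \<le> y" for x y
      using lip[OF that] by (simp add: measure_distr sp)
  qed auto
  define \<nu> where "\<nu> t = distr (\<nu>' t) borel \<psi>" for t
  have kernel[measurable]: "\<nu> \<in> borel \<rightarrow>\<^sub>M subprob_algebra borel"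
    unfolding \<nu>_def by (rule measurable_compose[OF _ measurable_distr[of \<psi> borel borel]]) auto
  have sets_\<nu>': "sets (\<nu>' t) = sets borel" for t
    using sets_kernel[of \<nu>' borel borel t] by simp
  show thesis
  proof (rule that[OF kernel])
    fix x y :: real assume xy: "x \<le> y"
    let ?D = "density lborel (indicator {x<..y}) :: real measure"
    have s: "sets (?D \<bind> \<nu>) = sets borel" "sets (?D \<bind> \<nu>') = sets borel"
      by (auto intro!: sets_bind simp: \<nu>_def sets_\<nu>')
    show "\<rho> y = add_measure (\<rho> x) (?D \<bind> \<nu>)"
    proof (rule measure_eqI)
      fix A assume "A \<in> sets (\<rho> y)"
      then have [measurable]: "A \<in> sets borel" by (simp add: sets)
      have [measurable]: "\<psi> -` A \<in> sets borel" using measurable_sets_borel[of \<psi> borel A] by auto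
      have *: "emeasure (\<rho> t) A = emeasure (distr (\<rho> t) borel \<phi>) (\<psi> -` A)" for t
        by (subst emeasure_distr) (auto simp: \<psi>\<phi> sp intro!: arg_cong[where f="emeasure _"])
      have sp': "space (\<nu>' t) = UNIV" for t using sets_eq_imp_space_eq[OF sets_\<nu>'] by simp
      have "emeasure (?D \<bind> \<nu>) A = (\<integral>\<^sup>+t. emeasure (\<nu> t) A \<partial>?D)"
        by (rule emeasure_bind[of _ _ borel]) auto
      also have "\<dots> = (\<integral>\<^sup>+t. emeasure (\<nu>' t) (\<psi> -` A) \<partial>?D)"
        unfolding \<nu>_def by (subst emeasure_distr) (auto simp: sets_\<nu>' sp' measurable_cong_sets[OF sets_\<nu>' refl])
      also have "\<dots> = emeasure (?D \<bind> \<nu>') (\<psi> -` A)"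
        by (rule emeasure_bind[of _ _ borel, symmetric]) auto
      finally show "emeasure (\<rho> y) A = emeasure (add_measure (\<rho> x) (?D \<bind> \<nu>)) A"
        unfolding *[of y] \<nu>'[OF xy] using s by (simp add: emeasure_add_measure sets *)
    qed (simp add: sets)
  qed
qed

section \<open>Uniform boundedness and adjoints\<close>

text \<open>Baire category: the closed sets on which all operators stay below \<open>real n\<close>
  cover the space, so one of them contains a ball. Differences of its points bound the operators
  near 0.\<close>

lemma uniform_boundedness:
  fixes f :: "'i \<Rightarrow> 'a::{real_normed_vector, complete_space} \<Rightarrow> 'b::real_normed_vector"
  assumes lin: "\<And>i. i \<in> I \<Longrightarrow> bounded_linear (f i)" and bdd: "\<And>x. bounded ((\<lambda>i. f i x) ` I)"
  obtains C where "1 \<le> C" "\<And>i x. i \<in> I \<Longrightarrow> norm (f i x) \<le> C * norm x"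
proof -
  define E where "E n = (\<Inter>i\<in>I. {x. norm (f i x) \<le> real n})" for n :: nat
  have closed: "closed (E n)" for n
    unfolding E_def
    by (auto intro!: closed_INT closed_Collect_le continuous_intros linear_continuous_on[OF lin])
  have "\<Union>(range E) = UNIV"
  proof (intro equalityI subsetI UNIV_I)
    fix x
    obtain B where B: "\<And>i. i \<in> I \<Longrightarrow> norm (f i x) \<le> B"
      using bdd[of x] by (auto simp: bounded_iff)
    obtain n where "B \<le> real n" using real_arch_simple by blast
    then have "x \<in> E n" using B by (fastforce simp: E_def)
    then show "x \<in> \<Union>(range E)" by auto
  qed
  moreover have "interior (\<Union>(range E)) = {}" if "\<And>n. interior (E n) = {}"
    using Met_TC.metric_Baire_category_alt[of "range E"] that closed complete_UNIV
    by (auto simp: interior_of_openin[symmetric] )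
  ultimately obtain n where "interior (E n) \<noteq> {}" by (metis UNIV_not_empty interior_UNIV)
  then obtain x0 e where e: "0 < e" "ball x0 e \<subseteq> E n"
    by (metis all_not_in_conv mem_interior)
  have x0: "norm (f i x0) \<le> real n" if "i \<in> I" for i
    using e that by (auto simp: E_def subset_iff)
  have small: "norm (f i y) \<le> 2 * real n" if "i \<in> I" "norm y < e" for i y
  proof -
    interpret bounded_linear "f i" by (rule lin[OF that(1)])
    have "x0 + y \<in> ball x0 e" using that by (simp add: dist_norm)
    then have "norm (f i (x0 + y)) \<le> real n" using e that by (auto simp: E_def subset_iff)
    then show ?thesis
      using x0[OF that(1)] norm_triangle_ineq4[of "f i (x0 + y)" "f i x0"] by (simp add: add)
  qed
  \<comment> \<open>Vectors of norm below \<open>e\<close> have images of norm at most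
    \<open>2 * real n\<close>; rescaling \<open>x\<close> to norm \<open>e / 2\<close> gives the
    quotient. The lower bound 1 is what \<open>levy_weight_scale\<close> asks for.\<close>
  define C where "C = max 1 (4 * real n / e)"
  show thesis
  proof
    show "1 \<le> C" by (simp add: C_def)
    fix i x assume i: "i \<in> I"
    interpret bounded_linear "f i" by (rule lin[OF i])
    show "norm (f i x) \<le> C * norm x"
    proof (cases "x = 0")
      case False
      define k where "k = e / (2 * norm x)"
      have k: "0 < k" using e False by (simp add: k_def)
      have "norm (f i (k *\<^sub>R x)) \<le> 2 * real n"
        by (rule small[OF i]) (use e False in \<open>simp add: k_def\<close>)
      then have "k * norm (f i x) \<le> 2 * real n" using k by (simp add: scaleR)
      then have "norm (f i x) \<le> 2 * real n / k" using k by (simp add: field_simps)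
      also have "\<dots> = 4 * real n / e * norm x" by (simp add: k_def)
      also have "\<dots> \<le> C * norm x" by (intro mult_right_mono) (auto simp: C_def)
      finally show ?thesis .
    qed (simp add: zero)
  qed
qed

section \<open>Riesz representation and adjoints\<close>

lemma riesz_representation:
  fixes f :: "'a::{real_inner, complete_space} \<Rightarrow> real"
  assumes "bounded_linear f"
  shows "\<exists>v. \<forall>x. f x = x \<bullet> v"
proof -
  interpret bounded_linear f by fact
  obtain K where K: "\<And>x. norm (f x) \<le> norm x * K" using bounded by blast
  \<comment> \<open>If \<open>v\<close> represents \<open>f\<close>, then \<open>J x\<close> is the
    squared distance from \<open>x\<close> to \<open>v\<close> up to a constant. So \<open>v\<close>
    is sought as the minimiser, and the parallelogram law makes minimising sequences Cauchy.\<close>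
  define J where "J x = (norm x)\<^sup>2 - 2 * f x" for x
  have "- (K\<^sup>2) \<le> J x" for x
  proof -
    have "0 \<le> (norm x - K)\<^sup>2" by simp
    then show ?thesis using K[of x] by (simp add: J_def power2_eq_square algebra_simps abs_le_iff)
  qed
  then have bdd: "bdd_below (range J)" by (intro bdd_belowI[of _ "- (K\<^sup>2)"]) auto
  define m where "m = Inf (range J)"
  have m_le: "m \<le> J x" for x unfolding m_def by (rule cINF_lower[OF bdd]) simp
  have "\<exists>x. J x < m + 1 / Suc n" for n
    using cINF_less_iff[of UNIV J "m + 1 / Suc n"] bdd by (auto simp: m_def)
  then obtain x where x: "\<And>n. J (x n) < m + 1 / Suc n" by metis
  have par: "(norm (y - z))\<^sup>2 = 2 * (J y + J z - 2 * J ((1/2) *\<^sub>R (y + z)))" for y z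
    unfolding J_def by (simp add: scaleR add power2_norm_eq_inner inner_simps inner_commute algebra_simps)
  have dist: "(norm (x i - x j))\<^sup>2 \<le> 2 * (1 / Suc i + 1 / Suc j)" for i j
    using par[of "x i" "x j"] x[of i] x[of j] m_le[of "(1/2) *\<^sub>R (x i + x j)"] by argo
  have "Cauchy x"
  proof (rule metric_CauchyI)
    fix e :: real assume "0 < e"
    then obtain n where n: "4 / e\<^sup>2 < real n" using reals_Archimedean2 by blast
    show "\<exists>M. \<forall>i\<ge>M. \<forall>j\<ge>M. dist (x i) (x j) < e"
    proof (intro exI allI impI)
      fix i j assume ij: "n \<le> i" "n \<le> j"
      have "0 < real n" using n \<open>0 < e\<close> by (smt (verit) divide_pos_pos zero_less_power)
      have "(norm (x i - x j))\<^sup>2 \<le> 2 * (1 / Suc i + 1 / Suc j)" by (rule dist)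
      also have "\<dots> \<le> 2 * (1 / real n + 1 / real n)"
        using ij \<open>0 < real n\<close> by (intro mult_left_mono add_mono divide_left_mono) auto
      also have "\<dots> < e\<^sup>2" using n \<open>0 < e\<close> \<open>0 < real n\<close> by (simp add: field_simps)
      finally show "dist (x i) (x j) < e"
        using \<open>0 < e\<close> by (simp add: dist_norm power_less_imp_less_base)
    qed
  qed
  then obtain v where v: "x \<longlonglongrightarrow> v" using Cauchy_convergent convergent_def by blast
  have "(\<lambda>n. J (x n)) \<longlonglongrightarrow> J v"
    unfolding J_def by (intro tendsto_intros v tendsto)
  moreover have "(\<lambda>n. m + 1 / real (Suc n)) \<longlonglongrightarrow> m + 0"
    by (intro tendsto_intros LIMSEQ_inverse_real_of_nat[unfolded inverse_eq_divide])
  ultimately have "J v \<le> m" using x less_imp_le by (intro LIMSEQ_le[where Y = "\<lambda>n. m + 1 / real (Suc n)"]) auto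
  have "f y = y \<bullet> v" for y
  proof (cases "y = 0")
    case False
    define s where "s = f y - y \<bullet> v"
    \<comment> \<open>This value minimises the quadratic
      \<open>t * t * (y \<bullet> y) - 2 * t * s\<close> by which \<open>J\<close> changes in
      direction \<open>y\<close>; minimality at \<open>v\<close> then forces
      \<open>s = 0\<close>.\<close>
    define t where "t = s / (y \<bullet> y)"
    have yy: "0 < y \<bullet> y" using False by simp
    have "J v \<le> J (v + t *\<^sub>R y)" using \<open>J v \<le> m\<close> m_le order_trans by blast
    then have "0 \<le> t * t * (y \<bullet> y) - 2 * t * s"
      unfolding J_def s_def by (simp add: scaleR add power2_norm_eq_inner inner_simps inner_commute algebra_simps)
    also have "\<dots> = - (s * s) / (y \<bullet> y)" using yy by (simp add: t_def field_simps)
    finally have "s * s \<le> 0" using yy by (simp add: field_simps)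
    then show ?thesis by (auto simp: s_def mult_le_0_iff)
  qed (simp add: zero)
  then show ?thesis by blast
qed

lemma adjoint_exists:
  fixes A :: "'a::{real_inner, complete_space} \<Rightarrow> 'b::real_inner"
  assumes "bounded_linear A"
  shows "\<exists>A'. linear A' \<and> (\<forall>x a. A x \<bullet> a = x \<bullet> A' a)"
proof -
  have "\<exists>v. \<forall>x. A x \<bullet> a = x \<bullet> v" for a
    by (rule riesz_representation[OF bounded_linear_compose[OF bounded_linear_inner_left assms]])
  then obtain A' where A': "\<And>x a. A x \<bullet> a = x \<bullet> A' a" by metis
  have "linear A'"
  proof
    have "x \<bullet> A' (a + c) = x \<bullet> (A' a + A' c)" for x a c
      by (simp add: A'[symmetric] inner_add_right)
    then show "A' (a + c) = A' a + A' c" for a c using vector_eq_ldot by blast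
    have "x \<bullet> A' (r *\<^sub>R a) = x \<bullet> r *\<^sub>R A' a" for x r a
      by (simp add: A'[symmetric])
    then show "A' (r *\<^sub>R a) = r *\<^sub>R A' a" for r a using vector_eq_ldot by blast
  qed
  then show ?thesis using A' by blast
qed

section \<open>Local bounds and joint continuity of the semigroup\<close>

lemma semigroup_locally_bounded:
  fixes T :: "real \<Rightarrow> 'a::{real_normed_vector, complete_space} \<Rightarrow> 'a"
  assumes "strongly_continuous_semigroup T"
  obtains C where "1 \<le> C" "\<And>s x. 0 \<le> s \<Longrightarrow> s \<le> t \<Longrightarrow> norm (T s x) \<le> C * norm x"
proof -
  have "bounded_linear (T s)" if "s \<in> {0..t}" for s
    using assms that by (simp add: strongly_continuous_semigroup_def)
  moreover have "bounded ((\<lambda>s. T s x) ` {0..t})" for x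
    using assms by (intro compact_imp_bounded compact_continuous_image)
      (auto simp: strongly_continuous_semigroup_def intro: continuous_on_subset)
  ultimately show thesis
    using uniform_boundedness[of "{0..t}" T] that by (metis atLeastAtMost_iff)
qed

text \<open>Strong continuity handles a change of time with the vector fixed, and the local operator
  bound handles a change of vector uniformly in time. Extending by \<open>max 0 s\<close> gives a
  function of all real times, whose Borel measurability Fubini relies on.\<close>

lemma semigroup_jointly_continuous:
  fixes T :: "real \<Rightarrow> 'a::{real_normed_vector, complete_space} \<Rightarrow> 'a"
  assumes T: "strongly_continuous_semigroup T"
  shows "continuous_on UNIV (\<lambda>(s, x). T (max 0 s) x)"
proof -
  have "isCont (\<lambda>(s, x). T (max 0 s) x) (s, x)" for s x
  proof -
    obtain C where C: "1 \<le> C" "\<And>u y. 0 \<le> u \<Longrightarrow> u \<le> max 0 s + 1 \<Longrightarrow> norm (T u y) \<le> C * norm y"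
      using semigroup_locally_bounded[OF T, of "max 0 s + 1"] by blast
    have lin: "bounded_linear (T u)" if "0 \<le> u" for u
      using T that by (simp add: strongly_continuous_semigroup_def)
    have "continuous_on UNIV (\<lambda>u. T (max 0 u) x)"
      using T by (intro continuous_on_compose2[of "{0..}" "\<lambda>u. T u x" UNIV "\<lambda>u. max 0 u"] continuous_intros)
        (auto simp: strongly_continuous_semigroup_def)
    then have "isCont (\<lambda>u. T (max 0 u) x) s" by (simp add: continuous_on_eq_continuous_at)
    then have lim1: "((\<lambda>p. T (max 0 (fst p)) x) \<longlongrightarrow> T (max 0 s) x) (at (s, x))"
      using isCont_tendsto_compose tendsto_fst[OF tendsto_ident_at, of "(s, x)" UNIV] by fastforce
    have lim2: "((\<lambda>p. T (max 0 (fst p)) (snd p) - T (max 0 (fst p)) x) \<longlongrightarrow> 0) (at (s, x))"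
    proof (rule Lim_null_comparison)
      show "\<forall>\<^sub>F p in at (s, x). norm (T (max 0 (fst p)) (snd p) - T (max 0 (fst p)) x) \<le> C * norm (snd p - x)"
      proof -
        have "\<forall>\<^sub>F p in at (s, x). dist (fst p) s < 1"
          using tendstoD[OF tendsto_fst[OF tendsto_ident_at, of "(s, x)" UNIV], of 1] by simp
        then show ?thesis
        proof eventually_elim
          case (elim p)
          then have "T (max 0 (fst p)) (snd p) - T (max 0 (fst p)) x = T (max 0 (fst p)) (snd p - x)"
            using linear_diff[OF bounded_linear.linear[OF lin[of "max 0 (fst p)"]]] by simp
          then show ?case using elim C(2)[of "max 0 (fst p)" "snd p - x"] by (auto simp: dist_real_def)
        qed
      qed
      have "((\<lambda>p. C * norm (snd p - x)) \<longlongrightarrow> C * norm (snd (s, x) - x)) (at (s, x))"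
        by (intro tendsto_intros)
      then show "((\<lambda>p. C * norm (snd p - x)) \<longlongrightarrow> 0) (at (s, x))" by simp
    qed
    show ?thesis
      using tendsto_add[OF lim1 lim2] by (simp add: isCont_def case_prod_unfold)
  qed
  then show ?thesis by (auto intro!: continuous_at_imp_continuous_on)
qed

section \<open>Levy measures\<close>

lemma integrable_add_measure:
  fixes f :: "'a \<Rightarrow> 'b::{banach, second_countable_topology}"
  assumes sets: "sets N = sets M" and M: "integrable M f" and N: "integrable N f"
  shows "integrable (add_measure M N) f"
proof -
  have [measurable]: "f \<in> borel_measurable M" using M by simp
  have "(\<integral>\<^sup>+x. ennreal (norm (f x)) \<partial>add_measure M N) = (\<integral>\<^sup>+x. ennreal (norm (f x)) \<partial>M) + (\<integral>\<^sup>+x. ennreal (norm (f x)) \<partial>N)"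
    by (rule nn_integral_add_measure[OF sets]) measurable
  then show ?thesis using M N by (simp add: integrable_iff_bounded measurable_cong_sets[OF sets_add_measure refl])
qed

lemma integral_add_measure_real:
  fixes u :: "'a \<Rightarrow> real"
  assumes sets: "sets N = sets M" and M: "integrable M u" and N: "integrable N u"
  shows "integral\<^sup>L (add_measure M N) u = integral\<^sup>L M u + integral\<^sup>L N u"
proof -
  have [measurable]: "u \<in> borel_measurable M" using M by simp
  have nn: "(\<integral>\<^sup>+x. ennreal (v x) \<partial>add_measure M N) = (\<integral>\<^sup>+x. ennreal (v x) \<partial>M) + (\<integral>\<^sup>+x. ennreal (v x) \<partial>N)"
    if [measurable]: "v \<in> borel_measurable M" for v :: "'a \<Rightarrow> real"
    by (rule nn_integral_add_measure[OF sets]) measurable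
  show ?thesis
    using M N integrable_add_measure[OF sets M N]
    by (auto simp: real_lebesgue_integral_def nn enn2real_plus real_integrable_def less_top)
qed

lemma integral_add_measure:
  fixes f :: "'a \<Rightarrow> complex"
  assumes sets: "sets N = sets M" and M: "integrable M f" and N: "integrable N f"
  shows "integral\<^sup>L (add_measure M N) f = integral\<^sup>L M f + integral\<^sup>L N f"
  using M N integrable_add_measure[OF sets M N] integral_add_measure_real[OF sets integrable_Re[OF M] integrable_Re[OF N]]
    integral_add_measure_real[OF sets integrable_Im[OF M] integrable_Im[OF N]]
  by (simp add: complex_eq_iff flip: integral_Re integral_Im)

definition levy_weight :: "'a::real_normed_vector \<Rightarrow> real" where
  "levy_weight x = min 1 ((norm x)\<^sup>2)"

text \<open>A Levy measure carried on the whole space with a null origin, so that images under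
  linear maps and Fourier arguments apply directly.\<close>

definition levy_borel :: "'a::real_normed_vector measure \<Rightarrow> bool" where
  "levy_borel N \<longleftrightarrow> sets N = sets borel \<and> emeasure N {0} = 0 \<and> (\<integral>\<^sup>+x. ennreal (levy_weight x) \<partial>N) < \<infinity>"

text \<open>The mass at the origin is removed after taking the image, because nonzero vectors in the
  null space of \<open>A\<close> may deposit there a mass that is even infinite.\<close>

definition push :: "('a::topological_space \<Rightarrow> 'b::{zero, t1_space}) \<Rightarrow> 'a measure \<Rightarrow> 'b measure" where
  "push A N = density (distr N borel A) (indicator (- {0}))"

lemma levy_borelD: "levy_borel N \<Longrightarrow> sets N = sets borel"
  by (simp add: levy_borel_def)

lemma measurable_levy_weight [measurable]: "levy_weight \<in> borel_measurable borel"
  unfolding levy_weight_def by measurable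

lemma levy_weight_nonneg: "0 \<le> levy_weight x"
  and levy_weight_eq_0_iff: "levy_weight x = 0 \<longleftrightarrow> x = 0" and levy_weight_0 [simp]: "levy_weight 0 = 0"
  by (auto simp: levy_weight_def min_def)

lemma levy_weight_scale:
  assumes "1 \<le> C" "norm y \<le> C * norm x"
  shows "levy_weight y \<le> C\<^sup>2 * levy_weight x"
proof -
  have "(norm y)\<^sup>2 \<le> C\<^sup>2 * (norm x)\<^sup>2"
    using assms power_mono[of "norm y" "C * norm x" 2] by (simp add: power_mult_distrib)
  moreover have "1 \<le> C\<^sup>2" using assms(1) by simp
  ultimately show ?thesis by (auto simp: levy_weight_def min_def)
qed

lemma sets_push [simp, measurable_cong]: "sets (push A N) = sets borel"
  by (simp add: push_def)

text \<open>A test function vanishing at 0 does not see the removed mass, which is the reason for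
  the recurring condition \<open>f 0 = 0\<close>.\<close>

lemma nn_integral_push:
  assumes N[measurable_cong]: "sets N = sets borel" and [measurable]: "A \<in> borel_measurable borel" "f \<in> borel_measurable borel"
    and "f 0 = 0"
  shows "(integral\<^sup>N (push A N) f) = (\<integral>\<^sup>+x. f (A x) \<partial>N)"
proof -
  have "(integral\<^sup>N (push A N) f) = (\<integral>\<^sup>+x. indicator (- {0}) (A x) * f (A x) \<partial>N)"
    unfolding push_def by (simp add: nn_integral_density nn_integral_distr)
  also have "\<dots> = (\<integral>\<^sup>+x. f (A x) \<partial>N)"
    using \<open>f 0 = 0\<close> by (intro nn_integral_cong) (metis ComplI indicator_simps(1) mult_1 mult_zero_right singletonD)
  finally show ?thesis .
qed

lemma emeasure_push_0: "emeasure (push A N) {0} = 0"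
  by (simp add: push_def emeasure_density indicator_def[of "{0}"] indicator_def[of "- {0}"] cong: nn_integral_cong_simp)
    (simp add: nn_integral_0_iff_AE)

lemma levy_borel_push:
  assumes N: "levy_borel N" and A: "linear A" "1 \<le> C" "\<And>x. norm (A x) \<le> C * norm x"
  shows "levy_borel (push A N)"
proof -
  note levy_borelD[OF N, measurable_cong]
  have "bounded_linear A" using A(3) by (intro bounded_linear_intro[of _ C] linear_add linear_scale A(1)) (simp add: mult.commute)
  then have [measurable]: "A \<in> borel_measurable borel"
    by (intro borel_measurable_continuous_onI linear_continuous_on)
  have "(\<integral>\<^sup>+x. ennreal (levy_weight x) \<partial>push A N) = (\<integral>\<^sup>+x. ennreal (levy_weight (A x)) \<partial>N)"
    by (rule nn_integral_push) (auto simp: levy_borelD[OF N])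
  also have "\<dots> \<le> (\<integral>\<^sup>+x. ennreal (C\<^sup>2) * ennreal (levy_weight x) \<partial>N)"
    using A by (intro nn_integral_mono) (simp add: levy_weight_scale levy_weight_nonneg flip: ennreal_mult)
  also have "\<dots> = ennreal (C\<^sup>2) * (\<integral>\<^sup>+x. ennreal (levy_weight x) \<partial>N)"
    by (rule nn_integral_cmult) measurable
  also have "\<dots> < \<infinity>" using N by (simp add: levy_borel_def ennreal_mult_less_top)
  finally show ?thesis by (simp add: levy_borel_def emeasure_push_0)
qed

lemma levy_borel_add:
  assumes "levy_borel M" "levy_borel N"
  shows "levy_borel (add_measure M N)"
proof -
  have [simp]: "sets M = sets borel" "sets N = sets borel" using assms by (auto simp: levy_borelD)
  have "(\<integral>\<^sup>+x. ennreal (levy_weight x) \<partial>add_measure M N) = (\<integral>\<^sup>+x. ennreal (levy_weight x) \<partial>M) + (\<integral>\<^sup>+x. ennreal (levy_weight x) \<partial>N)"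
    by (rule nn_integral_add_measure) (auto simp: measurable_cong_sets[of M borel borel borel])
  then show ?thesis using assms by (auto simp: levy_borel_def emeasure_add_measure)
qed

lemma levy_borel_integrable:
  fixes f :: "'a::real_normed_vector \<Rightarrow> 'b::{banach, second_countable_topology}"
  assumes N: "levy_borel N" and [measurable]: "f \<in> borel_measurable borel"
    and bnd: "\<And>x. norm (f x) \<le> B * levy_weight x"
  shows "integrable N f"
proof (rule Bochner_Integration.integrable_bound)
  note levy_borelD[OF N, measurable_cong]
  have "integrable N levy_weight"
    using N by (intro integrableI_nonneg) (auto simp: levy_borel_def levy_weight_nonneg)
  then show "integrable N (\<lambda>x. B * levy_weight x)" by simp
  show "f \<in> borel_measurable N" by measurable
  show "AE x in N. norm (f x) \<le> norm (B * levy_weight x)"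
    using bnd by (auto intro: order_trans[OF _ abs_ge_self])
qed

lemma measurable_inner_left [measurable]: "(\<lambda>x::'a::real_inner. x \<bullet> a) \<in> borel_measurable borel"
  by (intro borel_measurable_continuous_onI continuous_intros)

lemma measurable_levy_K [measurable]: "(\<lambda>x. levy_K x a) \<in> borel_measurable borel"
  unfolding levy_K_def by measurable

text \<open>Inside the unit ball the second-order Taylor remainder applies; outside it the
  compensator is absent and a difference of two unimodular numbers remains. One constant covers both
  cases.\<close>

lemma norm_levy_K_le: "cmod (levy_K x a) \<le> (2 + (norm a)\<^sup>2) * levy_weight x"
proof (cases "norm x \<le> 1")
  case True
  have "cmod (levy_K x a) \<le> (x \<bullet> a)\<^sup>2 / 2"
    using iexp_approx1[of "x \<bullet> a" 1] True
    by (simp add: levy_K_def numeral_2_eq_2 diff_diff_eq)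
  also have "\<dots> \<le> (norm x * norm a)\<^sup>2 / 2"
    using Cauchy_Schwarz_ineq2[of x a] by (intro divide_right_mono) (auto simp: abs_le_square_iff[symmetric])
  also have "\<dots> \<le> (2 + (norm a)\<^sup>2) * (norm x)\<^sup>2"
    by (simp add: power_mult_distrib algebra_simps)
  also have "(norm x)\<^sup>2 = levy_weight x"
    using True power_mono[of "norm x" 1 2] by (simp add: levy_weight_def)
  finally show ?thesis .
next
  case False
  then have "levy_weight x = 1" using one_le_power[of "norm x" 2] by (auto simp: levy_weight_def)
  moreover have "cmod (levy_K x a) \<le> 2"
    using False norm_triangle_ineq4[of "iexp (x \<bullet> a)" 1] by (simp add: levy_K_def)
  ultimately show ?thesis by (simp add: add_increasing2)
qed

lemma integrable_levy_K: "levy_borel N \<Longrightarrow> integrable N (\<lambda>x. levy_K x a)"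
  by (rule levy_borel_integrable[OF _ _ norm_levy_K_le]) measurable

section \<open>Uniqueness of the Levy measure\<close>

abbreviation tilt :: "'a::real_inner \<Rightarrow> 'a \<Rightarrow> real" where
  "tilt z x \<equiv> 2 * (1 - cos (x \<bullet> z))"

text \<open>The constant and the compensator are affine in \<open>a\<close> and cancel, so the
  truncation disappears. The factor \<open>tilt z x\<close> is the squared modulus of
  \<open>iexp (x \<bullet> z) - 1\<close>.\<close>

lemma levy_K_second_difference:
  "2 * levy_K x a - levy_K x (a + z) - levy_K x (a - z) = tilt z x * iexp (x \<bullet> a)"
  by (simp add: levy_K_def complex_eq_iff Re_exp Im_exp inner_add_right inner_diff_right
      cos_add cos_diff sin_add sin_diff algebra_simps)

text \<open>Serves to fix the branch of the logarithm along the segment from 0 to \<open>a\<close>.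
  The bound on \<open>levy_K\<close> is uniform on this segment, so dominated convergence
  applies.\<close>

lemma continuous_exponent_on_ray:
  assumes N: "levy_borel N"
  shows "continuous_on {0..1} (\<lambda>u. CLINT x|N. levy_K x (u *\<^sub>R a))"
proof (rule continuous_on_sequentiallyI)
  note levy_borelD[OF N, measurable_cong]
  fix u and c :: real assume u: "\<forall>n. u n \<in> {0..1}" and lim: "u \<longlonglongrightarrow> c"
  show "(\<lambda>n. CLINT x|N. levy_K x (u n *\<^sub>R a)) \<longlonglongrightarrow> (CLINT x|N. levy_K x (c *\<^sub>R a))"
  proof (rule integral_dominated_convergence[where w = "\<lambda>x. (2 + (norm a)\<^sup>2) * levy_weight x"])
    show "integrable N (\<lambda>x. (2 + (norm a)\<^sup>2) * levy_weight x)"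
      by (rule levy_borel_integrable[OF N, of _ "2 + (norm a)\<^sup>2"]) (auto simp: levy_weight_nonneg)
    show "AE x in N. (\<lambda>n. levy_K x (u n *\<^sub>R a)) \<longlonglongrightarrow> levy_K x (c *\<^sub>R a)"
      unfolding levy_K_def by (intro AE_I2 tendsto_intros lim)
    show "AE x in N. cmod (levy_K x (u n *\<^sub>R a)) \<le> (2 + (norm a)\<^sup>2) * levy_weight x" for n
    proof (rule AE_I2)
      fix x
      have "norm (u n *\<^sub>R a) \<le> norm a" using u by (simp add: mult_left_le_one_le)
      then have "(norm (u n *\<^sub>R a))\<^sup>2 \<le> (norm a)\<^sup>2" by (intro power_mono) auto
      then show "cmod (levy_K x (u n *\<^sub>R a)) \<le> (2 + (norm a)\<^sup>2) * levy_weight x"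
        by (intro order_trans[OF norm_levy_K_le] mult_right_mono) (auto simp: levy_weight_nonneg)
    qed
  qed measurable
qed

text \<open>The values lie in the discrete set of multiples of 2 pi i, so on a connected interval
  the function keeps its initial value.\<close>

lemma continuous_exp_eq_1_imp_0:
  fixes D :: "real \<Rightarrow> complex"
  assumes cont: "continuous_on {0..1} D" and "D 0 = 0" and exp: "\<And>u. u \<in> {0..1} \<Longrightarrow> exp (D u) = 1"
  shows "D 1 = 0"
proof -
  have "D constant_on {0..1}"
  proof (rule continuous_discrete_range_constant[OF _ cont])
    fix x assume x: "x \<in> {0..1::real}"
    show "\<exists>e>0. \<forall>y. y \<in> {0..1} \<and> D y \<noteq> D x \<longrightarrow> e \<le> norm (D y - D x)"
    proof (intro exI[of _ "2 * pi"] conjI allI impI)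
      fix y assume y: "y \<in> {0..1} \<and> D y \<noteq> D x"
      then have "exp (D y - D x) = 1" using exp x by (simp add: exp_diff)
      then obtain n :: int where n: "Re (D y - D x) = 0" "Im (D y - D x) = of_int (2 * n) * pi"
        using exp_eq_1 by blast
      then have "n \<noteq> 0" using y by (auto simp: complex_eq_iff)
      then have "1 \<le> \<bar>real_of_int n\<bar>" by linarith
      then have "2 * pi \<le> \<bar>Im (D y - D x)\<bar>" unfolding n by (simp add: abs_mult)
      then show "2 * pi \<le> norm (D y - D x)" using abs_Im_le_cmod order_trans by blast
    qed simp
  qed simp
  then show ?thesis using \<open>D 0 = 0\<close> by (fastforce simp: constant_on_def)
qed

text \<open>On \<open>B\<close> the weight \<open>(tilt z x)\<^sup>2\<close> is positive and can be
  divided out again.\<close>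

lemma levy_borel_tilted_eq:
  fixes z :: "'a::{real_inner, second_countable_topology}"
  assumes N1: "levy_borel N1" and N2: "levy_borel N2"
    and dens: "density N1 (\<lambda>x. ennreal ((tilt z x)\<^sup>2)) = density N2 (\<lambda>x. ennreal ((tilt z x)\<^sup>2))"
    and B: "B \<in> sets borel" "\<And>x. x \<in> B \<Longrightarrow> cos (x \<bullet> z) \<noteq> 1"
  shows "emeasure N1 B = emeasure N2 B"
proof -
  note [measurable] = B(1)
  have eq: "emeasure N B = (\<integral>\<^sup>+x. indicator B x * ennreal (1 / (tilt z x)\<^sup>2)
      \<partial>density N (\<lambda>x. ennreal ((tilt z x)\<^sup>2)))" if N: "levy_borel N" for N
  proof -
    note levy_borelD[OF N, measurable_cong]
    have "emeasure N B = (\<integral>\<^sup>+x. indicator B x \<partial>N)" by simp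
    also have "\<dots> = (\<integral>\<^sup>+x. ennreal ((tilt z x)\<^sup>2) * (indicator B x * ennreal (1 / (tilt z x)\<^sup>2)) \<partial>N)"
    proof (rule nn_integral_cong)
      fix x
      show "indicator B x = ennreal ((tilt z x)\<^sup>2) * (indicator B x * ennreal (1 / (tilt z x)\<^sup>2))"
      proof (cases "x \<in> B")
        case True
        then have "(tilt z x)\<^sup>2 \<noteq> 0" using B(2) by auto
        then show ?thesis using True by (simp flip: ennreal_mult)
      qed simp
    qed
    also have "\<dots> = (\<integral>\<^sup>+x. indicator B x * ennreal (1 / (tilt z x)\<^sup>2)
      \<partial>density N (\<lambda>x. ennreal ((tilt z x)\<^sup>2)))"
      by (rule nn_integral_density[symmetric]) measurable
    finally show ?thesis .
  qed
  show ?thesis unfolding eq[OF N1] eq[OF N2] dens ..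
qed

text \<open>Fourth-order differences of the exponent annihilate its linear and its quadratic part; what
  remains is the characteristic functional of the finite measure with density
  \<open>(tilt z x)\<^sup>2\<close> with respect to the Levy measure.\<close>

lemma levy_measure_unique:
  fixes N1 N2 :: "'a::{real_inner, second_countable_topology} measure" and l1 l2 q1 q2 :: "'a \<Rightarrow> real"
  assumes N1: "levy_borel N1" and N2: "levy_borel N2" and l: "linear l1" "linear l2"
    and q: "\<And>u a. q1 (u *\<^sub>R a) = u\<^sup>2 * q1 a" "\<And>u a. q2 (u *\<^sub>R a) = u\<^sup>2 * q2 a"
    and q_par: "\<And>a z. q1 (a + z) + q1 (a - z) = 2 * q1 a + 2 * q1 z" "\<And>a z. q2 (a + z) + q2 (a - z) = 2 * q2 a + 2 * q2 z"
    and eq: "\<And>a. exp (\<i> * complex_of_real (l1 a) - complex_of_real (q1 a) / 2 + (CLINT x|N1. levy_K x a)) =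
      exp (\<i> * complex_of_real (l2 a) - complex_of_real (q2 a) / 2 + (CLINT x|N2. levy_K x a))"
  shows "N1 = N2"
proof -
  define E where "E l q N a = \<i> * complex_of_real (l a) - complex_of_real (q a) / 2 + (CLINT x|N. levy_K x a)" for l q :: "'a \<Rightarrow> real" and N a
  have "E l1 q1 N1 a = E l2 q2 N2 a" for a
  proof -
    have "(\<lambda>u. E l1 q1 N1 (u *\<^sub>R a) - E l2 q2 N2 (u *\<^sub>R a)) 1 = 0"
    proof (rule continuous_exp_eq_1_imp_0)
      show "continuous_on {0..1} (\<lambda>u. E l1 q1 N1 (u *\<^sub>R a) - E l2 q2 N2 (u *\<^sub>R a))"
        unfolding E_def q linear_scale[OF l(1)] linear_scale[OF l(2)]
        by (auto intro!: continuous_intros continuous_exponent_on_ray N1 N2)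
      show "E l1 q1 N1 (0 *\<^sub>R a) - E l2 q2 N2 (0 *\<^sub>R a) = 0"
        unfolding E_def q linear_scale[OF l(1)] linear_scale[OF l(2)] by (simp add: levy_K_def)
      show "exp (E l1 q1 N1 (u *\<^sub>R a) - E l2 q2 N2 (u *\<^sub>R a)) = 1" for u
        using eq[of "u *\<^sub>R a"] by (simp add: E_def exp_diff)
    qed
    then show ?thesis by simp
  qed
  then have E_eq: "E l1 q1 N1 = E l2 q2 N2" by auto
  \<comment> \<open>The second difference in direction \<open>z\<close> is applied twice. After the
    first, the parallelogram law leaves of the quadratic part only the constant \<open>q z\<close>,
    which the second removes; the surviving integrand carries the square of
    \<open>tilt z x\<close>.\<close>
  have fourth: "finite_measure (density N (\<lambda>x. ennreal ((tilt z x)\<^sup>2))) \<and>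
      char_functional (density N (\<lambda>x. ennreal ((tilt z x)\<^sup>2))) a =
      2 * (2 * E l q N a - E l q N (a + z) - E l q N (a - z))
      - (2 * E l q N (a + z) - E l q N (a + z + z) - E l q N (a + z - z))
      - (2 * E l q N (a - z) - E l q N (a - z + z) - E l q N (a - z - z))"
    if N: "levy_borel N" and l: "linear l" and par: "\<And>a z. q (a + z) + q (a - z) = 2 * q a + 2 * q z"
    for l q N a z
  proof -
    note levy_borelD[OF N, measurable_cong]
    note iK = integrable_levy_K[OF N]
    have second: "2 * E l q N a - E l q N (a + z) - E l q N (a - z) = q z + (CLINT x|N. tilt z x * iexp (x \<bullet> a))"
      for a
    proof -
      have "2 * (CLINT x|N. levy_K x a) - (CLINT x|N. levy_K x (a + z)) - (CLINT x|N. levy_K x (a - z))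
          = (CLINT x|N. 2 * levy_K x a - levy_K x (a + z) - levy_K x (a - z))"
        by (simp add: iK)
      then have dK: "2 * (CLINT x|N. levy_K x a) - (CLINT x|N. levy_K x (a + z)) - (CLINT x|N. levy_K x (a - z))
          = (CLINT x|N. tilt z x * iexp (x \<bullet> a))"
        unfolding levy_K_second_difference .
      have dq: "2 * complex_of_real (q a) - q (a + z) - q (a - z) = - 2 * q z"
        using par[of a z] by (simp add: complex_eq_iff)
      have dl: "2 * complex_of_real (l a) - l (a + z) - l (a - z) = 0"
        by (simp add: linear_add[OF l] linear_diff[OF l])
      have regroup: "2 * (\<i> * A - Q / 2 + K) - (\<i> * A1 - Q1 / 2 + K1) - (\<i> * A2 - Q2 / 2 + K2)
          = \<i> * (2 * A - A1 - A2) - (2 * Q - Q1 - Q2) / 2 + (2 * K - K1 - K2)" for A A1 A2 Q Q1 Q2 K K1 K2 :: complex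
        by (simp add: field_simps)
      show ?thesis unfolding E_def regroup dK dq dl by simp
    qed
    have iw: "integrable N (\<lambda>x. tilt z x * iexp (x \<bullet> a))" for a
      unfolding levy_K_second_difference[symmetric] by (intro Bochner_Integration.integrable_diff integrable_mult_right iK)
    have sq: "2 * (tilt z x * iexp (x \<bullet> a)) - tilt z x * iexp (x \<bullet> (a + z)) - tilt z x * iexp (x \<bullet> (a - z))
        = (tilt z x)\<^sup>2 *\<^sub>R iexp (x \<bullet> a)" for x a
    proof -
      have "2 * iexp (x \<bullet> a) - iexp (x \<bullet> (a + z)) - iexp (x \<bullet> (a - z)) = tilt z x * iexp (x \<bullet> a)"
        using levy_K_second_difference[of x a z] by (simp add: levy_K_def inner_simps algebra_simps)
      then have "complex_of_real (tilt z x) * (2 * iexp (x \<bullet> a) - iexp (x \<bullet> (a + z)) - iexp (x \<bullet> (a - z)))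
          = complex_of_real (tilt z x) * (tilt z x * iexp (x \<bullet> a))"
        by simp
      then show ?thesis by (simp add: scaleR_conv_of_real power2_eq_square algebra_simps)
    qed
    have int2: "integrable N (\<lambda>x. (tilt z x)\<^sup>2 *\<^sub>R iexp (x \<bullet> a))" for a
      unfolding sq[symmetric] by (intro Bochner_Integration.integrable_diff integrable_mult_right iw)
    \<comment> \<open>At \<open>a = 0\<close> the exponential is 1, so integrability of the
      differenced kernel is finiteness of the weighted measure.\<close>
    have "integrable N (\<lambda>x. (tilt z x)\<^sup>2)"
      using integrable_Re[OF int2[of 0]] by simp
    then have "finite_measure (density N (\<lambda>x. ennreal ((tilt z x)\<^sup>2)))"
      by (intro finite_measureI) (simp add: emeasure_density cong: nn_integral_cong_simp add: integrable_iff_bounded less_top)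
    moreover have "char_functional (density N (\<lambda>x. ennreal ((tilt z x)\<^sup>2))) a = (CLINT x|N. (tilt z x)\<^sup>2 *\<^sub>R iexp (x \<bullet> a))"
      unfolding char_functional_def by (subst integral_density) auto
    moreover have "\<dots> = 2 * (CLINT x|N. tilt z x * iexp (x \<bullet> a)) - (CLINT x|N. tilt z x * iexp (x \<bullet> (a + z)))
        - (CLINT x|N. tilt z x * iexp (x \<bullet> (a - z)))"
      unfolding sq[symmetric]
      by (subst Bochner_Integration.integral_diff; (intro Bochner_Integration.integrable_diff integrable_mult_right iw)?)+ simp
    ultimately show ?thesis unfolding second by simp
  qed
  define w where "w = (\<lambda>z x :: 'a. ennreal ((tilt z x)\<^sup>2))"
  have dens: "density N1 (w z) = density N2 (w z)" for z
    unfolding w_def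
    using fourth[OF N1 l(1) q_par(1)] fourth[OF N2 l(2) q_par(2)]
    by (intro char_functional_unique) (auto simp: levy_borelD[OF N1] levy_borelD[OF N2] E_eq)
  obtain D :: "'a set" where D: "countable D" "\<And>X. open X \<Longrightarrow> X \<noteq> {} \<Longrightarrow> \<exists>d \<in> D. d \<in> X"
    using countable_dense_exists by metis
  then have "D \<noteq> {}" using D(2)[of UNIV] by auto
  \<comment> \<open>No single direction suffices, since \<open>tilt z\<close> vanishes on a family
    of hyperplanes when \<open>z\<close> is nonzero. Countably many directions from a dense set
    cover everything off the origin.\<close>
  define U where "U n = {x. cos (x \<bullet> from_nat_into D n) \<noteq> 1}" for n
  have [measurable]: "U n \<in> sets borel" for n unfolding U_def by measurable
  have cover: "x \<in> (\<Union>n. U n)" if "x \<noteq> 0" for x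
  proof -
    let ?X = "{z. 0 < x \<bullet> z} \<inter> {z. x \<bullet> z < 2 * pi}"
    have "open ?X" by (intro open_Int open_Collect_less continuous_intros)
    \<comment> \<open>This multiple of \<open>x\<close> has inner product pi with \<open>x\<close>,
      halfway between consecutive zeros of the weight; so the open set is nonempty and meets
      \<open>D\<close>.\<close>
    moreover have "(pi / (x \<bullet> x)) *\<^sub>R x \<in> ?X" using that by simp
    ultimately obtain d where d: "d \<in> D" "0 < x \<bullet> d" "x \<bullet> d < 2 * pi" using D(2)[of ?X] by blast
    have "cos (x \<bullet> d) \<noteq> 1"
    proof
      assume "cos (x \<bullet> d) = 1"
      then obtain n :: int where n: "x \<bullet> d = of_int n * 2 * pi" using cos_one_2pi_int by auto
      then have "0 < n" "n < 1" using d pi_gt_zero by (auto simp: zero_less_mult_iff)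
      then show False by simp
    qed
    then show ?thesis using d(1) from_nat_into_surj[OF D(1)] by (auto simp: U_def)
  qed
  show ?thesis
  proof (rule measure_eqI)
    show "sets N1 = sets N2" by (simp add: levy_borelD N1 N2)
    fix A assume "A \<in> sets N1"
    then have A[measurable]: "A \<in> sets borel" by (simp add: levy_borelD[OF N1])
    have split: "emeasure N A = (\<Sum>n. emeasure N (A \<inter> disjointed U n))" if N: "levy_borel N" for N
    proof -
      note levy_borelD[OF N, measurable_cong]
      have "(\<Sum>n. emeasure N (A \<inter> disjointed U n)) = emeasure N (\<Union>n. A \<inter> disjointed U n)"
        using disjoint_family_disjointed[of U]
        by (intro suminf_emeasure) (auto simp: levy_borelD[OF N] disjoint_family_on_def intro!: sets.Int sets.Diff simp: disjointed_def)
      also have "(\<Union>n. A \<inter> disjointed U n) = A - {0}"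
        using cover by (auto simp: UN_disjointed_eq simp flip: Int_UN_distrib) (auto simp: U_def)
      also have "emeasure N (A - {0}) = emeasure N A"
        using N by (intro emeasure_Diff_null_set) (auto simp: levy_borel_def null_sets_def)
      finally show ?thesis by simp
    qed
    have "emeasure N1 (A \<inter> disjointed U n) = emeasure N2 (A \<inter> disjointed U n)" for n
      by (rule levy_borel_tilted_eq[OF N1 N2 dens[of "from_nat_into D n", unfolded w_def]])
        (auto simp: U_def disjointed_def)
    then show "emeasure N1 A = emeasure N2 A" unfolding split[OF N1] split[OF N2] by simp
  qed
qed

section \<open>Passage between the punctured space and the whole space\<close>

definition punctured_ext :: "'a::real_normed_vector measure \<Rightarrow> 'a measure" where
  "punctured_ext M = distr M borel (\<lambda>x. x)"

lemma measurable_punctured: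
  assumes "sets M = sets borel_punctured" and "f \<in> borel_measurable borel"
  shows "f \<in> borel_measurable M"
proof -
  have "f \<in> borel_measurable borel_punctured"
    unfolding borel_punctured_def by (rule measurable_restrict_space1[OF assms(2)])
  then show ?thesis using measurable_cong_sets[OF assms(1) refl] by blast
qed

lemma sets_punctured_ext [simp, measurable_cong]: "sets (punctured_ext M) = sets borel"
  by (simp add: punctured_ext_def)

lemma nn_integral_punctured_ext:
  assumes "sets M = sets borel_punctured" "f \<in> borel_measurable borel"
  shows "(integral\<^sup>N (punctured_ext M) f) = (integral\<^sup>N M f)"
  unfolding punctured_ext_def
  by (rule nn_integral_distr) (simp_all add: measurable_punctured[OF assms(1)] assms(2))

lemma integral_punctured_ext:
  fixes f :: "'a::real_normed_vector \<Rightarrow> 'b::{banach, second_countable_topology}"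
  assumes "sets M = sets borel_punctured" "f \<in> borel_measurable borel"
  shows "(LINT x|punctured_ext M. f x) = (LINT x|M. f x)"
  unfolding punctured_ext_def
  by (rule integral_distr) (simp_all add: measurable_punctured[OF assms(1)] assms(2))

lemma levy_borel_punctured_ext:
  assumes "levy_measure M"
  shows "levy_borel (punctured_ext M)"
proof -
  have M: "sets M = sets borel_punctured" using assms by (simp add: levy_measure_def)
  have "(\<lambda>x. x) -` {0} \<inter> space M = {}"
    using sets_eq_imp_space_eq[OF M] by (auto simp: borel_punctured_def space_restrict_space)
  then have "emeasure (punctured_ext M) {0} = 0"
    unfolding punctured_ext_def by (subst emeasure_distr) (simp_all add: measurable_punctured[OF M])
  then show ?thesis
    using assms by (simp add: levy_borel_def nn_integral_punctured_ext[OF M] levy_measure_def levy_weight_def)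
qed

text \<open>\<open>levy_K\<close> vanishes at the origin, so the mass removed there contributes
  nothing.\<close>

lemma integral_push_levy_K:
  assumes N[measurable_cong]: "sets N = sets borel" and [measurable]: "A \<in> borel_measurable borel"
  shows "(CLINT x|push A N. levy_K x a) = (CLINT x|N. levy_K (A x) a)"
proof -
  have "push A N = density (distr N borel A) (\<lambda>x. ennreal (indicator (- {0}) x))"
    by (simp add: push_def ennreal_indicator)
  then have "(CLINT x|push A N. levy_K x a) = (CLINT x|distr N borel A. indicator (- {0}) x *\<^sub>R levy_K x a)"
    by (simp only:) (rule integral_density, auto)
  also have "\<dots> = (CLINT x|N. indicator (- {0}) (A x) *\<^sub>R levy_K (A x) a)"
    by (rule integral_distr) auto
  also have "\<dots> = (CLINT x|N. levy_K (A x) a)"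
    by (intro Bochner_Integration.integral_cong) (auto simp: indicator_def levy_K_def)
  finally show ?thesis .
qed

section \<open>The additive relation between the Levy measures\<close>

lemma char_functional_convolution:
  fixes P Q :: "'a::{real_inner, second_countable_topology} measure"
  assumes "prob_space P" "prob_space Q" and sets: "sets P = sets borel" "sets Q = sets borel"
  shows "char_functional (measure_convolution P Q) a = char_functional P a * char_functional Q a"
proof -
  note sets[measurable_cong]
  interpret prob1: prob_space P by fact
  interpret prob2: prob_space Q by fact
  interpret pair_prob_space P Q ..
  have "char_functional (measure_convolution P Q) a = (CLINT z|P \<Otimes>\<^sub>M Q. iexp ((case z of (x, y) \<Rightarrow> x + y) \<bullet> a))"
    unfolding char_functional_def measure_convolution_def by (rule integral_distr) measurable
  also have "\<dots> = (CLINT z|P \<Otimes>\<^sub>M Q. (case z of (x, y) \<Rightarrow> iexp (x \<bullet> a) * iexp (y \<bullet> a)))"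
    by (intro Bochner_Integration.integral_cong) (auto simp: inner_add_left exp_add[symmetric] distrib_left)
  also have "\<dots> = (CLINT x|P. CLINT y|Q. (case (x, y) of (x, y) \<Rightarrow> iexp (x \<bullet> a) * iexp (y \<bullet> a)))"
  proof (rule integral_fst'[symmetric])
    show "integrable (P \<Otimes>\<^sub>M Q) (\<lambda>(x, y). iexp (x \<bullet> a) * iexp (y \<bullet> a))"
      by (rule integrable_const_bound[of _ 1]) (auto simp: norm_mult)
  qed
  also have "\<dots> = char_functional P a * char_functional Q a"
    by (simp add: char_functional_def)
  finally show ?thesis .
qed

lemma char_functional_distr:
  assumes [measurable_cong]: "sets P = sets borel" and [measurable]: "A \<in> borel_measurable borel"
    and adj: "\<And>x a. A x \<bullet> a = x \<bullet> A' a"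
  shows "char_functional (distr P borel A) a = char_functional P (A' a)"
proof -
  have "char_functional (distr P borel A) a = (CLINT x|P. iexp (A x \<bullet> a))"
    unfolding char_functional_def by (rule integral_distr) measurable
  then show ?thesis by (simp only: adj char_functional_def)
qed

text \<open>The truncation in \<open>levy_K\<close> does not commute with \<open>A\<close>; the discrepancy is linear in \<open>a\<close>.\<close>

lemma levy_K_adjoint:
  fixes A :: "'a::{real_inner, second_countable_topology} \<Rightarrow> 'a"
  assumes N: "levy_borel N" and A: "bounded_linear A" and adj: "\<And>x a. A x \<bullet> a = x \<bullet> A' a"
  obtains c where "linear c" "\<And>a. (CLINT x|N. levy_K x (A' a)) = (CLINT x|push A N. levy_K x a) + \<i> * complex_of_real (c a)"
proof -
  note levy_borelD[OF N, measurable_cong]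
  interpret A: bounded_linear A by fact
  have [measurable]: "A \<in> borel_measurable borel"
    by (intro borel_measurable_continuous_onI linear_continuous_on A)
  obtain C0 where C0: "\<And>x. norm (A x) \<le> norm x * C0" using A.bounded by blast
  define C where "C = max 1 C0"
  have C: "1 \<le> C" "norm (A x) \<le> C * norm x" for x
    using C0[of x] mult_left_mono[of C0 C "norm x"] by (auto simp: C_def mult.commute)
  define d where "d a x = (A x \<bullet> a) * (indicator {0..1} (norm (A x)) - indicator {0..1} (norm x) :: real)" for a x
  \<comment> \<open>The discrepancy vanishes unless exactly one of \<open>x\<close> and
    \<open>A x\<close> lies in the unit ball. If only \<open>A x\<close> does, the weight of
    \<open>x\<close> is 1; if only \<open>x\<close> does, \<open>norm (A x)\<close> exceeds 1 and is
    bounded by its own square.\<close>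
  have bnd: "norm (d a x) \<le> (C\<^sup>2 * norm a) * levy_weight x" for a x
  proof -
    have CS: "\<bar>A x \<bullet> a\<bar> \<le> norm (A x) * norm a" by (rule Cauchy_Schwarz_ineq2)
    have C2: "C \<le> C\<^sup>2" "1 \<le> C\<^sup>2" using C(1) self_le_power[of C 2] by auto
    consider "norm (A x) \<le> 1 \<longleftrightarrow> norm x \<le> 1" | "norm (A x) \<le> 1" "1 < norm x" | "1 < norm (A x)" "norm x \<le> 1" by linarith
    then show ?thesis
    proof cases
      case 1
      then show ?thesis by (auto simp: d_def indicator_def levy_weight_nonneg)
    next
      case 2
      then have "levy_weight x = 1" using one_le_power[of "norm x" 2] by (auto simp: levy_weight_def)
      moreover have "norm (A x) * norm a \<le> C\<^sup>2 * norm a"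
        using 2 C2 by (intro mult_right_mono) auto
      ultimately show ?thesis using 2 CS by (auto simp: d_def)
    next
      case 3
      then have "levy_weight x = (norm x)\<^sup>2" using power_mono[of "norm x" 1 2] by (simp add: levy_weight_def)
      moreover have "norm (A x) \<le> C\<^sup>2 * (norm x)\<^sup>2"
      proof -
        have "norm (A x) \<le> norm (A x) * norm (A x)" using 3 mult_left_mono[of 1 "norm (A x)" "norm (A x)"] by simp
        also have "\<dots> \<le> (C * norm x) * (C * norm x)" using C 3 by (intro mult_mono) auto
        finally show ?thesis by (simp add: power2_eq_square algebra_simps)
      qed
      then have "norm (A x) * norm a \<le> (C\<^sup>2 * (norm x)\<^sup>2) * norm a" by (rule mult_right_mono) simp
      ultimately show ?thesis using 3 CS by (auto simp: d_def algebra_simps)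
    qed
  qed
  have int: "integrable N (d a)" for a
    by (rule levy_borel_integrable[OF N _ bnd]) (auto simp: d_def)
  define c where "c a = integral\<^sup>L N (d a)" for a
  show thesis
  proof (rule that[of c])
    show "linear c"
    proof
      have "d (a + b) = (\<lambda>x. d a x + d b x)" for a b
        by (auto simp: d_def inner_simps distrib_right)
      then show "c (a + b) = c a + c b" for a b by (simp add: c_def int)
      have "d (r *\<^sub>R a) = (\<lambda>x. r * d a x)" for r a
        by (auto simp: d_def)
      then show "c (r *\<^sub>R a) = r *\<^sub>R c a" for r a by (simp add: c_def)
    qed
    fix a
    have K: "levy_K x (A' a) = levy_K (A x) a + \<i> * complex_of_real (d a x)" for x
      by (simp add: levy_K_def d_def adj[symmetric] indicator_def algebra_simps)
    have "integrable N (\<lambda>x. levy_K (A x) a)"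
    proof -
      have "integrable N (\<lambda>x. levy_K x (A' a) - \<i> * complex_of_real (d a x))"
        by (intro Bochner_Integration.integrable_diff integrable_levy_K N integrable_mult_right integrable_of_real int)
      then show ?thesis by (simp add: K)
    qed
    then show "(CLINT x|N. levy_K x (A' a)) = (CLINT x|push A N. levy_K x a) + \<i> * complex_of_real (c a)"
      by (simp add: K c_def int integral_push_levy_K levy_borelD[OF N])
  qed
qed

text \<open>The adjoint of \<open>T t\<close> moves the action from the measure to the argument
  \<open>a\<close>. The truncation correction is absorbed by the drift and the composed covariance
  is again a quadratic form, so uniqueness of the Levy measure applies.\<close>

lemma sc_semigroup_levy_additive:
  fixes T :: "real \<Rightarrow> 'a::{real_inner, complete_space, second_countable_topology} \<Rightarrow> 'a"
  assumes T: "strongly_continuous_semigroup T" and \<mu>: "sc_semigroup T \<mu>"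
    and R: "\<And>t. t \<ge> 0 \<Longrightarrow> linear (R t)"
    and M: "\<And>t. t \<ge> 0 \<Longrightarrow> levy_measure (M t)"
    and LK: "\<And>t a. t \<ge> 0 \<Longrightarrow> char_functional (\<mu> t) a =
           exp (\<i> * of_real (b t \<bullet> a) - of_real (R t a \<bullet> a) / 2 + (CLINT x|M t. levy_K x a))"
    and r: "0 \<le> r" and t: "0 \<le> t"
  shows "punctured_ext (M (r + t)) = add_measure (push (T t) (punctured_ext (M r))) (punctured_ext (M t))"
proof -
  define N where "N t = punctured_ext (M t)" for t
  have N: "levy_borel (N t)" if "0 \<le> t" for t
    unfolding N_def by (rule levy_borel_punctured_ext[OF M[OF that]])
  have LK': "char_functional (\<mu> t) a = exp (\<i> * of_real (b t \<bullet> a) - of_real (R t a \<bullet> a) / 2 + (CLINT x|N t. levy_K x a))"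
    if "0 \<le> t" for t a
    using LK[OF that] M[OF that] by (simp add: N_def integral_punctured_ext levy_measure_def)
  have Tt: "bounded_linear (T t)" using T t by (simp add: strongly_continuous_semigroup_def)
  then have [measurable]: "T t \<in> borel_measurable borel"
    by (intro borel_measurable_continuous_onI linear_continuous_on)
  obtain A' where A': "linear A'" "\<And>x a. T t x \<bullet> a = x \<bullet> A' a" using adjoint_exists[OF Tt] by blast
  obtain c where c: "linear c" "\<And>a. (CLINT x|N r. levy_K x (A' a)) = (CLINT x|push (T t) (N r). levy_K x a) + \<i> * complex_of_real (c a)"
    using levy_K_adjoint[OF N[OF r] Tt A'(2)] by blast
  obtain C where C: "1 \<le> C" "\<And>x. norm (T t x) \<le> C * norm x"
    using semigroup_locally_bounded[OF T, of t] t by (metis order_refl)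
  have push: "levy_borel (push (T t) (N r))"
    by (rule levy_borel_push[OF N[OF r] bounded_linear.linear[OF Tt] C])
  have \<mu>': "prob_space (\<mu> t)" "sets (\<mu> t) = sets borel" if "0 \<le> t" for t
    using \<mu> that by (auto simp: sc_semigroup_def)
  have quad: "R t (u *\<^sub>R a) \<bullet> (u *\<^sub>R a) = u\<^sup>2 * (R t a \<bullet> a)"
    "R t (a + z) \<bullet> (a + z) + R t (a - z) \<bullet> (a - z) = 2 * (R t a \<bullet> a) + 2 * (R t z \<bullet> z)" if "0 \<le> t" for t u a z
    using linear_scale[OF R[OF that]] linear_add[OF R[OF that]] linear_diff[OF R[OF that]]
    by (simp_all add: inner_simps power2_eq_square)
  have "N (r + t) = add_measure (push (T t) (N r)) (N t)"
  proof (rule levy_measure_unique[where ?q1.0 = "\<lambda>a. R (r + t) a \<bullet> a" and ?q2.0 = "\<lambda>a. R r (A' a) \<bullet> A' a + R t a \<bullet> a"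
        and ?l1.0 = "\<lambda>a. b (r + t) \<bullet> a" and ?l2.0 = "\<lambda>a. b r \<bullet> A' a + c a + b t \<bullet> a"])
    show "levy_borel (N (r + t))" using N r t by simp
    show "levy_borel (add_measure (push (T t) (N r)) (N t))" by (intro levy_borel_add push N t)
    show "linear (\<lambda>a. b (r + t) \<bullet> a)" by (intro bounded_linear.linear bounded_linear_inner_right)
    have "linear (\<lambda>a. b r \<bullet> A' a)"
      using linear_compose[OF A'(1) bounded_linear.linear[OF bounded_linear_inner_right[of "b r"]]] by (simp add: comp_def)
    then show "linear (\<lambda>a. b r \<bullet> A' a + c a + b t \<bullet> a)"
      by (intro linear_compose_add c bounded_linear.linear[OF bounded_linear_inner_right])
    show "R (r + t) (u *\<^sub>R a) \<bullet> (u *\<^sub>R a) = u\<^sup>2 * (R (r + t) a \<bullet> a)" for u a using quad r t by simp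
    show "R r (A' (u *\<^sub>R a)) \<bullet> A' (u *\<^sub>R a) + R t (u *\<^sub>R a) \<bullet> (u *\<^sub>R a) = u\<^sup>2 * (R r (A' a) \<bullet> A' a + R t a \<bullet> a)" for u a
      unfolding linear_scale[OF A'(1)] quad[OF r] quad[OF t] by (simp add: distrib_left)
    show "R (r + t) (a + z) \<bullet> (a + z) + R (r + t) (a - z) \<bullet> (a - z) = 2 * (R (r + t) a \<bullet> a) + 2 * (R (r + t) z \<bullet> z)" for a z
      using quad r t by simp
    show "R r (A' (a + z)) \<bullet> A' (a + z) + R t (a + z) \<bullet> (a + z) + (R r (A' (a - z)) \<bullet> A' (a - z) + R t (a - z) \<bullet> (a - z)) =
        2 * (R r (A' a) \<bullet> A' a + R t a \<bullet> a) + 2 * (R r (A' z) \<bullet> A' z + R t z \<bullet> z)" for a z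
      using quad(2)[OF r, of "A' a" "A' z"] quad(2)[OF t, of a z]
      by (simp add: linear_add[OF A'(1)] linear_diff[OF A'(1)])
    fix a
    have K_add: "(CLINT x|add_measure (push (T t) (N r)) (N t). levy_K x a) = (CLINT x|push (T t) (N r). levy_K x a) + (CLINT x|N t. levy_K x a)"
      by (rule integral_add_measure) (simp_all add: levy_borelD[OF N[OF t]] integrable_levy_K push N[OF t])
    have "exp (\<i> * complex_of_real (b (r + t) \<bullet> a) - complex_of_real (R (r + t) a \<bullet> a) / 2 + (CLINT x|N (r + t). levy_K x a))
        = char_functional (\<mu> (r + t)) a" using LK' r t by simp
    also have "\<mu> (r + t) = measure_convolution (distr (\<mu> r) borel (T t)) (\<mu> t)"
      using \<mu> r t by (simp add: sc_semigroup_def)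
    also have "char_functional \<dots> a = char_functional (distr (\<mu> r) borel (T t)) a * char_functional (\<mu> t) a"
      using \<mu>'[OF r] \<mu>'[OF t]
      by (intro char_functional_convolution prob_space.prob_space_distr) (simp_all add: measurable_cong_sets[OF \<mu>'(2)[OF r] refl])
    also have "char_functional (distr (\<mu> r) borel (T t)) a = char_functional (\<mu> r) (A' a)"
      by (rule char_functional_distr[OF \<mu>'(2)[OF r] _ A'(2)]) measurable
    also have "char_functional (\<mu> r) (A' a) * char_functional (\<mu> t) a =
        exp (\<i> * complex_of_real (b r \<bullet> A' a + c a + b t \<bullet> a) - complex_of_real (R r (A' a) \<bullet> A' a + R t a \<bullet> a) / 2
          + (CLINT x|add_measure (push (T t) (N r)) (N t). levy_K x a))"
      unfolding LK'[OF r] LK'[OF t] c(2) K_add exp_add[symmetric]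
      by (rule arg_cong[of _ _ exp]) (simp add: add_divide_distrib distrib_left)
    finally show "exp (\<i> * complex_of_real (b (r + t) \<bullet> a) - complex_of_real (R (r + t) a \<bullet> a) / 2 + (CLINT x|N (r + t). levy_K x a)) =
        exp (\<i> * complex_of_real (b r \<bullet> A' a + c a + b t \<bullet> a) - complex_of_real (R r (A' a) \<bullet> A' a + R t a \<bullet> a) / 2
          + (CLINT x|add_measure (push (T t) (N r)) (N t). levy_K x a))" .
  qed
  then show ?thesis by (simp add: N_def)
qed

section \<open>Flows of Levy measures\<close>

text \<open>The family \<open>N\<close> is a cocycle over the semigroup; everything up to the kernel
  is derived from this identity and strong continuity.\<close>

locale levy_flow =
  fixes T :: "real \<Rightarrow> 'a::{real_inner, complete_space, second_countable_topology} \<Rightarrow> 'a" and N :: "real \<Rightarrow> 'a measure"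
  assumes T: "strongly_continuous_semigroup T"
    and levy: "\<And>t. 0 \<le> t \<Longrightarrow> levy_borel (N t)"
    and additive: "\<And>r t. 0 \<le> r \<Longrightarrow> 0 \<le> t \<Longrightarrow> N (r + t) = add_measure (push (T t) (N r)) (N t)"
begin

lemma T_linear: "0 \<le> t \<Longrightarrow> bounded_linear (T t)"
  using T by (simp add: strongly_continuous_semigroup_def)

lemma T_zero: "0 \<le> t \<Longrightarrow> T t 0 = 0"
  using linear_0[OF bounded_linear.linear[OF T_linear]] .

lemma T_plus: "0 \<le> r \<Longrightarrow> 0 \<le> t \<Longrightarrow> T (r + t) x = T r (T t x)"
  using T by (simp add: strongly_continuous_semigroup_def)

lemma T_0: "T 0 x = x"
  using T by (simp add: strongly_continuous_semigroup_def)

lemma measurable_T: "0 \<le> t \<Longrightarrow> T t \<in> borel_measurable borel"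
  by (intro borel_measurable_continuous_onI linear_continuous_on T_linear)

lemma measurable_T_pair [measurable]: "(\<lambda>(s, x). T (max 0 s) x) \<in> borel_measurable borel"
  by (intro borel_measurable_continuous_onI semigroup_jointly_continuous T)

lemma sets_N: "0 \<le> t \<Longrightarrow> sets (N t) = sets borel"
  by (rule levy_borelD[OF levy])

lemma nn_integral_N_add:
  assumes "0 \<le> r" "0 \<le> t" and f: "f \<in> borel_measurable borel" "f 0 = 0"
  shows "(integral\<^sup>N (N (r + t)) f) = (\<integral>\<^sup>+x. f (T t x) \<partial>N r) + (integral\<^sup>N (N t) f)"
proof -
  have "(integral\<^sup>N (N (r + t)) f) = (integral\<^sup>N (push (T t) (N r)) f) + (integral\<^sup>N (N t) f)"
    unfolding additive[OF assms(1,2)]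
    by (rule nn_integral_add_measure) (simp_all add: sets_N assms measurable_cong_sets[OF sets_push refl])
  also have "(integral\<^sup>N (push (T t) (N r)) f) = (\<integral>\<^sup>+x. f (T t x) \<partial>N r)"
    by (intro nn_integral_push sets_N measurable_T f assms)
  finally show ?thesis .
qed

lemma integrable_N:
  fixes f :: "'a \<Rightarrow> real"
  assumes "0 \<le> t" "f \<in> borel_measurable borel" "\<And>x. \<bar>f x\<bar> \<le> B * levy_weight x"
  shows "integrable (N t) f"
  using assms by (intro levy_borel_integrable[OF levy, of t f B]) auto

section \<open>Growth of the weighted mass in time\<close>

definition mass :: "real \<Rightarrow> real" where
  "mass t = (LINT x|N t. levy_weight x)"

lemma integrable_weight: "0 \<le> t \<Longrightarrow> integrable (N t) levy_weight"
  by (rule integrable_N[where B = 1]) (auto simp: levy_weight_nonneg)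

lemma mass_nonneg: "0 \<le> mass t"
  unfolding mass_def by (intro Bochner_Integration.integral_nonneg levy_weight_nonneg)

lemma nn_integral_weight: "0 \<le> t \<Longrightarrow> (\<integral>\<^sup>+x. ennreal (levy_weight x) \<partial>N t) = ennreal (mass t)"
  unfolding mass_def by (intro nn_integral_eq_integral integrable_weight) (simp_all add: levy_weight_nonneg)

lemma weight_T_bound:
  obtains C where "1 \<le> C" "\<And>s x. 0 \<le> s \<Longrightarrow> s \<le> t \<Longrightarrow> levy_weight (T s x) \<le> C * levy_weight x"
proof -
  obtain C where C: "1 \<le> C" "\<And>s x. 0 \<le> s \<Longrightarrow> s \<le> t \<Longrightarrow> norm (T s x) \<le> C * norm x"
    using semigroup_locally_bounded[OF T] by blast
  show thesis
    by (rule that[of "C\<^sup>2"]) (use C in \<open>auto intro: levy_weight_scale\<close>)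
qed

lemma integrable_weight_T: "0 \<le> t \<Longrightarrow> 0 \<le> r \<Longrightarrow> integrable (N r) (\<lambda>x. levy_weight (T t x))"
proof -
  assume t: "0 \<le> t" and r: "0 \<le> r"
  obtain C where "\<And>s x. 0 \<le> s \<Longrightarrow> s \<le> t \<Longrightarrow> levy_weight (T s x) \<le> C * levy_weight x"
    using weight_T_bound[of t] by blast
  then show ?thesis
    using t r by (intro integrable_N[where B = C] measurable_compose[OF measurable_T]) (auto simp: levy_weight_nonneg)
qed

lemma mass_add:
  assumes "0 \<le> r" "0 \<le> t"
  shows "mass (r + t) = (LINT x|N r. levy_weight (T t x)) + mass t"
proof -
  have "ennreal (mass (r + t)) = (\<integral>\<^sup>+x. ennreal (levy_weight (T t x)) \<partial>N r) + ennreal (mass t)"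
    using assms by (simp add: nn_integral_weight[symmetric] nn_integral_N_add)
  also have "\<dots> = ennreal ((LINT x|N r. levy_weight (T t x)) + mass t)"
    using assms by (subst nn_integral_eq_integral)
      (auto simp: levy_weight_nonneg integrable_weight_T mass_nonneg intro!: ennreal_plus[symmetric] Bochner_Integration.integral_nonneg)
  finally show ?thesis
    by (subst (asm) ennreal_inj) (auto simp: mass_nonneg levy_weight_nonneg intro!: add_nonneg_nonneg Bochner_Integration.integral_nonneg)
qed

lemma mass_mono: "0 \<le> x \<Longrightarrow> x \<le> y \<Longrightarrow> mass x \<le> mass y"
  using mass_add[of "y - x" x] by (simp add: levy_weight_nonneg)

text \<open>Lets integrals under \<open>N r\<close> with varying \<open>r \<le> 1\<close> be bounded
  by the single measure \<open>N 1\<close>, to which dominated convergence can be applied.\<close>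

lemma integral_N_mono:
  fixes f :: "'a \<Rightarrow> real"
  assumes "0 \<le> x" "x \<le> y" and f: "f \<in> borel_measurable borel" "\<And>z. 0 \<le> f z" "\<And>z. f z \<le> B * levy_weight z"
  shows "(LINT z|N x. f z) \<le> (LINT z|N y. f z)"
proof -
  have f0: "f 0 = 0" using f(2)[of 0] f(3)[of 0] by simp
  have int: "integrable (N t) f" if "0 \<le> t" for t
    by (rule integrable_N[where B = B]) (use f that in auto)
  have "(\<integral>\<^sup>+z. ennreal (f z) \<partial>N ((y - x) + x)) = (\<integral>\<^sup>+z. ennreal (f (T x z)) \<partial>N (y - x)) + (\<integral>\<^sup>+z. ennreal (f z) \<partial>N x)"
    using assms f0 by (intro nn_integral_N_add) auto
  then have "(\<integral>\<^sup>+z. ennreal (f z) \<partial>N x) \<le> (\<integral>\<^sup>+z. ennreal (f z) \<partial>N y)" by simp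
  then have "ennreal (LINT z|N x. f z) \<le> ennreal (LINT z|N y. f z)"
    using assms int by (subst (asm) (1 2) nn_integral_eq_integral) auto
  then show ?thesis
    by (subst (asm) ennreal_le_iff) (auto intro!: Bochner_Integration.integral_nonneg f)
qed

text \<open>Letting \<open>t \<rightarrow> 0\<close> in the cocycle identity, strong continuity yields \<open>m \<ge> 2 m\<close> for the
  right limit \<open>m\<close> of the mass at 0.\<close>

lemma mass_vanishes_at_0:
  assumes "0 < e"
  obtains t where "0 < t" "mass t < e"
proof -
  define m where "m = (INF t\<in>{0<..}. mass t)"
  have bdd: "bdd_below (mass ` {0<..})" by (rule bdd_belowI[of _ 0]) (auto simp: mass_nonneg)
  have m_le: "m \<le> mass t" if "0 < t" for t
    unfolding m_def using that by (intro cINF_lower bdd) auto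
  have double: "2 * m \<le> mass s" if s: "0 < s" "s \<le> 1" for s
  proof -
    obtain C where C: "1 \<le> C" "\<And>s x. 0 \<le> s \<Longrightarrow> s \<le> 1 \<Longrightarrow> levy_weight (T s x) \<le> C * levy_weight x"
      using weight_T_bound[of 1] by blast
    \<comment> \<open>The shift to \<open>n + 2\<close> keeps \<open>t n\<close> strictly below
      \<open>s\<close> for every \<open>n\<close>, so that \<open>s - t n\<close> is a positive
      time.\<close>
    define t where "t n = s * inverse (real (Suc (Suc n)))" for n
    have "0 < t n" "t n < s" for n
      using s mult_strict_left_mono[of "inverse (real (Suc (Suc n)))" 1 s] by (auto simp: t_def inverse_less_1_iff)
    then have t: "0 < t n" "t n < s" "t n \<le> 1" for n
      using s by (auto intro: less_imp_le less_le_trans)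
    have t_lim: "t \<longlonglongrightarrow> 0"
      unfolding t_def by (rule tendsto_mult_right_zero[OF LIMSEQ_Suc[OF LIMSEQ_inverse_real_of_nat]])
    \<comment> \<open>The time \<open>s - t n\<close> varies with \<open>n\<close>; integrating
      against the larger measure \<open>N 1\<close> gives an error bound that does not depend on
      it.\<close>
    define \<delta> where "\<delta> n = (LINT x|N 1. \<bar>levy_weight (T (t n) x) - levy_weight x\<bar>)" for n
    have bnd: "\<bar>levy_weight (T (t n) x) - levy_weight x\<bar> \<le> (C + 1) * levy_weight x" for n x
      using C(2)[of "t n" x] t[of n] levy_weight_nonneg[of x] levy_weight_nonneg[of "T (t n) x"] C(1)
      by (simp add: abs_le_iff algebra_simps)
    have meas: "(\<lambda>x. levy_weight (T (t n) x)) \<in> borel_measurable borel" for n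
      using t[of n] by (intro measurable_compose[OF measurable_T measurable_levy_weight]) simp
    have "\<delta> \<longlonglongrightarrow> (LINT x|N 1. 0)"
      unfolding \<delta>_def
    proof (rule integral_dominated_convergence[where w = "\<lambda>x. (C + 1) * levy_weight x"])
      show "AE x in N 1. (\<lambda>n. \<bar>levy_weight (T (t n) x) - levy_weight x\<bar>) \<longlonglongrightarrow> 0"
      proof (rule AE_I2)
        fix x
        have "continuous_on {0..} (\<lambda>t. T t x)" using T by (simp add: strongly_continuous_semigroup_def)
        then have "(\<lambda>n. T (t n) x) \<longlonglongrightarrow> T 0 x"
          by (rule continuous_on_tendsto_compose[OF _ t_lim]) (use t in \<open>auto simp: less_imp_le\<close>)
        then have "(\<lambda>n. \<bar>levy_weight (T (t n) x) - levy_weight x\<bar>) \<longlonglongrightarrow> \<bar>levy_weight (T 0 x) - levy_weight x\<bar>"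
          unfolding levy_weight_def by (intro tendsto_intros)
        then show "(\<lambda>n. \<bar>levy_weight (T (t n) x) - levy_weight x\<bar>) \<longlonglongrightarrow> 0" by (simp add: T_0)
      qed
    qed (use meas bnd in \<open>auto simp: measurable_cong_sets[OF sets_N refl] integrable_weight\<close>)
    then have \<delta>: "\<delta> \<longlonglongrightarrow> 0" by simp
    have "2 * m - \<delta> n \<le> mass s" for n
    proof -
      define r where "r = s - t n"
      have r: "0 < r" "r \<le> 1" using t[of n] s by (auto simp: r_def)
      have i: "integrable (N r) (\<lambda>x. levy_weight x - levy_weight (T (t n) x))"
        using t[of n] r by (intro Bochner_Integration.integrable_diff integrable_weight integrable_weight_T) auto
      have "mass r - (LINT x|N r. levy_weight (T (t n) x)) = (LINT x|N r. levy_weight x - levy_weight (T (t n) x))"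
        unfolding mass_def using t[of n] r
        by (intro Bochner_Integration.integral_diff[symmetric] integrable_weight integrable_weight_T) auto
      also have "\<dots> \<le> (LINT x|N r. \<bar>levy_weight (T (t n) x) - levy_weight x\<bar>)"
        using i by (intro integral_mono) (auto simp: abs_minus_commute)
      also have "\<dots> \<le> \<delta> n"
        unfolding \<delta>_def using r meas bnd by (intro integral_N_mono[where B = "C + 1"]) auto
      finally have "mass r - \<delta> n + mass (t n) \<le> mass (r + t n)"
        using mass_add[of r "t n"] r t[of n] by simp
      then show ?thesis using m_le[OF r(1)] m_le[OF t(1)[of n]] by (simp add: r_def)
    qed
    moreover have "(\<lambda>n. 2 * m - \<delta> n) \<longlonglongrightarrow> 2 * m - 0" by (intro tendsto_intros \<delta>)
    ultimately show ?thesis by (intro LIMSEQ_le_const2[where X = "\<lambda>n. 2 * m - \<delta> n"]) auto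
  qed
  have "2 * m \<le> m"
  proof (subst (2) m_def, rule cINF_greatest)
    fix t :: real assume "t \<in> {0<..}"
    then show "2 * m \<le> mass t"
      using double[of "min t 1"] mass_mono[of "min t 1" t] by auto
  qed auto
  then have "m < e" using assms by simp
  then show thesis
    using that unfolding m_def by (subst (asm) cINF_less_iff) (auto simp: bdd)
qed

lemma mass_tendsto_0:
  assumes "s \<longlonglongrightarrow> 0" "\<And>n. 0 < s n"
  shows "(\<lambda>n. mass (s n)) \<longlonglongrightarrow> 0"
proof (rule order_tendstoI)
  fix e :: real assume "0 < e"
  then obtain t where t: "0 < t" "mass t < e" using mass_vanishes_at_0 by blast
  have "\<forall>\<^sub>F n in sequentially. s n < t" using assms(1) t by (simp add: order_tendstoD)
  then show "\<forall>\<^sub>F n in sequentially. mass (s n) < e"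
    by eventually_elim (use t assms(2) mass_mono in \<open>metis less_imp_le le_less_trans\<close>)
qed (auto intro!: always_eventually less_le_trans[OF _ mass_nonneg])

text \<open>Increments of \<open>mass\<close> over intervals of equal length are, up to a constant, decreasing,
  so those over an interval inside \<open>[\<epsilon>, t]\<close> are controlled by an average over \<open>[0, \<epsilon>]\<close>.\<close>

lemma mass_lipschitz:
  assumes \<epsilon>: "0 < \<epsilon>" "\<epsilon> \<le> t"
  obtains K where "0 < K" "\<And>x y. \<epsilon> \<le> x \<Longrightarrow> x \<le> y \<Longrightarrow> y \<le> t \<Longrightarrow> mass y - mass x \<le> K * (y - x)"
proof -
  obtain C where C: "1 \<le> C" "\<And>s x. 0 \<le> s \<Longrightarrow> s \<le> t \<Longrightarrow> levy_weight (T s x) \<le> C * levy_weight x"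
    using weight_T_bound[of t] by blast
  \<comment> \<open>The increment over \<open>[x, x + h]\<close> is the integral of the weight of
    \<open>T x z\<close> under \<open>N h\<close>, and \<open>T x\<close> factors through
    \<open>T u\<close>. Moving the interval to the right therefore costs at most the factor
    \<open>C\<close>.\<close>
  have J: "mass (x + h) - mass x \<le> C * (mass (u + h) - mass u)" if "0 \<le> h" "0 \<le> u" "u \<le> x" "x \<le> t" for h u x
  proof -
    have "mass (x + h) - mass x = (LINT z|N h. levy_weight (T x z))"
      using mass_add[of h x] that by (simp add: add.commute)
    also have "\<dots> \<le> (LINT z|N h. C * levy_weight (T u z))"
    proof (intro integral_mono integrable_mult_right integrable_weight_T)
      fix z
      show "levy_weight (T x z) \<le> C * levy_weight (T u z)"
        using T_plus[of "x - u" u z] C(2)[of "x - u" "T u z"] that by simp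
    qed (use that in auto)
    also have "\<dots> = C * (mass (u + h) - mass u)"
      using mass_add[of h u] that by (simp add: add.commute)
    finally show ?thesis .
  qed
  \<comment> \<open>The first term serves increments of length at most \<epsilon>, the second longer
    ones, and 1 makes the constant positive.\<close>
  define K where "K = 2 * C * mass \<epsilon> / \<epsilon> + mass t / \<epsilon> + 1"
  have parts: "0 \<le> 2 * C * mass \<epsilon> / \<epsilon>" "0 \<le> mass t / \<epsilon>"
    using \<epsilon> C(1) mass_nonneg[of \<epsilon>] mass_nonneg[of t] by auto
  show thesis
  proof (rule that[of K])
    show "0 < K" using parts by (simp add: K_def)
    fix x y assume xy: "\<epsilon> \<le> x" "x \<le> y" "y \<le> t"
    define h where "h = y - x"
    consider "h = 0" | "0 < h" "h \<le> \<epsilon>" | "\<epsilon> < h" using xy by (fastforce simp: h_def)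
    then have "mass y - mass x \<le> (2 * C * mass \<epsilon> / \<epsilon>) * h \<or> mass y - mass x \<le> (mass t / \<epsilon>) * h"
    proof cases
      case 1
      then show ?thesis by (simp add: h_def)
    next
      case 2
      \<comment> \<open>This many adjacent intervals of length \<open>h\<close> fit into
        \<open>[0, \<epsilon>]\<close>. Rounding down loses at most a factor 2, because the quotient
        is at least 1.\<close>
      define k where "k = nat \<lfloor>\<epsilon> / h\<rfloor>"
      have "1 \<le> \<epsilon> / h" using 2 by simp
      then have "1 \<le> \<lfloor>\<epsilon> / h\<rfloor>" by (simp add: le_floor_iff)
      then have "real k = of_int \<lfloor>\<epsilon> / h\<rfloor>" "1 \<le> real_of_int \<lfloor>\<epsilon> / h\<rfloor>"
        by (simp_all add: k_def)
      then have k: "real k \<le> \<epsilon> / h" "\<epsilon> / h \<le> 2 * real k"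
        using floor_correct[of "\<epsilon> / h"] by linarith+
      then have kh: "real k * h \<le> \<epsilon>" using 2 by (simp add: field_simps)
      have "real k * (mass y - mass x) = (\<Sum>i<k. mass (x + h) - mass x)" by (simp add: h_def)
      also have "\<dots> \<le> (\<Sum>i<k. C * (mass (real (Suc i) * h) - mass (real i * h)))"
      proof (rule sum_mono)
        fix i assume "i \<in> {..<k}"
        then have "real i * h \<le> real k * h" using 2 by (intro mult_right_mono) auto
        then have "real i * h \<le> x" using kh xy by linarith
        then show "mass (x + h) - mass x \<le> C * (mass (real (Suc i) * h) - mass (real i * h))"
          using J[of h "real i * h" x] 2 xy by (simp add: algebra_simps)
      qed
      also have "\<dots> = C * (mass (real k * h) - mass 0)"
        unfolding sum_distrib_left[symmetric] using sum_lessThan_telescope[of "\<lambda>i. mass (real i * h)" k] by simp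
      also have "\<dots> \<le> C * mass \<epsilon>"
        using C(1) kh 2 mass_mono[of "real k * h" \<epsilon>] mass_nonneg[of 0] by (intro mult_left_mono) auto
      finally have *: "real k * (mass y - mass x) \<le> C * mass \<epsilon>" .
      have "\<epsilon> / h * (mass y - mass x) \<le> 2 * real k * (mass y - mass x)"
        using k mass_mono[of x y] xy \<epsilon> by (intro mult_right_mono) auto
      also have "\<dots> \<le> 2 * (C * mass \<epsilon>)" using * by simp
      finally show ?thesis using 2 \<epsilon> by (simp add: field_simps)
    next
      case 3
      have "mass y - mass x \<le> mass t" using mass_mono[of y t] mass_nonneg[of x] xy \<epsilon> by auto
      also have "\<dots> = (mass t / \<epsilon>) * \<epsilon>" using \<epsilon> by simp
      also have "\<dots> \<le> (mass t / \<epsilon>) * h" using 3 parts by (intro mult_left_mono) auto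
      finally show ?thesis by simp
    qed
    moreover have "(2 * C * mass \<epsilon> / \<epsilon>) * h \<le> K * h" "(mass t / \<epsilon>) * h \<le> K * h"
      using parts xy by (intro mult_right_mono; simp add: K_def h_def)+
    ultimately show "mass y - mass x \<le> K * (y - x)" by (auto simp: h_def)
  qed
qed

end

section \<open>Entrance measures\<close>

text \<open>Countability is what allows the exceptional null sets to be united. The whole space is
  included so that the total weight is among the tested quantities.\<close>

definition determining :: "(nat \<Rightarrow> 'a::topological_space set) \<Rightarrow> bool" where
  "determining S \<longleftrightarrow> S 0 = UNIV \<and> (\<forall>n. S n \<in> sets borel) \<and>
     (\<forall>P Q. finite_measure P \<longrightarrow> finite_measure Q \<longrightarrow> sets P = sets borel \<longrightarrow> sets Q = sets borel \<longrightarrow>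
       (\<forall>n. emeasure P (S n) = emeasure Q (S n)) \<longrightarrow> P = Q)"

text \<open>Preimages of rational half-lines under the Borel encoding do: right continuity recovers
  the distribution function from its rational values, and the left inverse returns to the original
  space.\<close>

lemma determining_exists: "\<exists>S :: nat \<Rightarrow> 'a::{complete_space, second_countable_topology} set. determining S"
proof -
  obtain \<phi> :: "'a \<Rightarrow> real" and \<psi> where [measurable]: "\<phi> \<in> borel_measurable borel" "\<psi> \<in> borel_measurable borel"
    and \<psi>\<phi>: "\<And>x. \<psi> (\<phi> x) = x"
    using polish_real_embedding by blast
  define q where "q = from_nat_into (\<rat> :: real set)"
  define S where "S n = (case n of 0 \<Rightarrow> UNIV | Suc k \<Rightarrow> \<phi> -` {..q k})" for n
  show ?thesis
    unfolding determining_def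
  proof (intro exI[of _ S] conjI allI impI)
    show "S 0 = UNIV" by (simp add: S_def)
    show "S n \<in> sets borel" for n
      using measurable_sets_borel[of \<phi> borel "{..q _}"] by (auto simp: S_def split: nat.split)
    fix P Q :: "'a measure"
    assume fin: "finite_measure P" "finite_measure Q" and sets[measurable_cong]: "sets P = sets borel" "sets Q = sets borel"
      and eq: "\<forall>n. emeasure P (S n) = emeasure Q (S n)"
    have sp: "space P = UNIV" "space Q = UNIV" using sets[THEN sets_eq_imp_space_eq] by simp_all
    have fb: "finite_borel_measure (distr K borel \<phi>)" if "finite_measure K" "sets K = sets borel" for K
    proof -
      have [measurable]: "\<phi> \<in> borel_measurable K" by (simp add: measurable_cong_sets[OF that(2) refl])
      show ?thesis
        by (intro finite_borel_measure.intro finite_measure.finite_measure_distr[OF that(1)] finite_borel_measure_axioms.intro) auto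
    qed
    have rat: "cdf (distr P borel \<phi>) x = cdf (distr Q borel \<phi>) x" if x: "x \<in> \<rat>" for x
    proof -
      obtain k where "q k = x" using from_nat_into_surj[OF countable_rat x] by (auto simp: q_def)
      moreover have "emeasure (distr P borel \<phi>) {..x} = emeasure P (\<phi> -` {..x})" "emeasure (distr Q borel \<phi>) {..x} = emeasure Q (\<phi> -` {..x})"
        by (subst emeasure_distr; simp add: sp)+
      ultimately show ?thesis
        using spec[OF eq, of "Suc k"] by (simp add: cdf_def S_def measure_def)
    qed
    have "cdf (distr P borel \<phi>) x = cdf (distr Q borel \<phi>) x" for x
    proof -
      have "\<exists>y\<in>\<rat>. x < y \<and> y < x + inverse (real (Suc n))" for n
        by (rule Rats_dense_in_real) simp
      then obtain y where y: "\<And>n. y n \<in> \<rat>" "\<And>n. x < y n" "\<And>n. y n < x + inverse (real (Suc n))" by metis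
      have "y \<longlonglongrightarrow> x"
      proof (rule tendsto_sandwich[of "\<lambda>_. x" _ _ "\<lambda>n. x + inverse (real (Suc n))"])
        have "(\<lambda>n. x + inverse (real (Suc n))) \<longlonglongrightarrow> x + 0" by (intro tendsto_intros LIMSEQ_inverse_real_of_nat)
        then show "(\<lambda>n. x + inverse (real (Suc n))) \<longlonglongrightarrow> x" by simp
      qed (use y in \<open>auto intro!: always_eventually less_imp_le\<close>)
      then have lim: "filterlim y (at_right x) sequentially"
        using y(2) by (auto simp: filterlim_at intro!: always_eventually)
      have "(\<lambda>n. cdf (distr K borel \<phi>) (y n)) \<longlonglongrightarrow> cdf (distr K borel \<phi>) x" if "finite_measure K" "sets K = sets borel" for K
        using finite_borel_measure.cdf_is_right_cont[OF fb[OF that], of x] lim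
        by (auto simp: continuous_within intro: filterlim_compose)
      from this[OF fin(1) sets(1)] this[OF fin(2) sets(2)] show ?thesis
        unfolding rat[OF y(1)] by (rule LIMSEQ_unique)
    qed
    then have "distr P borel \<phi> = distr Q borel \<phi>"
      using fb[OF fin(1) sets(1)] fb[OF fin(2) sets(2)] by (intro cdf_unique') auto
    then have "distr (distr P borel \<phi>) borel \<psi> = distr (distr Q borel \<phi>) borel \<psi>" by simp
    moreover have "distr (distr K borel \<phi>) borel \<psi> = K" if [measurable_cong]: "sets K = sets borel" for K
    proof -
      have "distr (distr K borel \<phi>) borel \<psi> = distr K borel (\<lambda>x. x)"
        by (subst distr_distr) (auto simp: comp_def \<psi>\<phi>)
      also have "\<dots> = K" by (rule distr_id2) (simp add: that)
      finally show ?thesis .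
    qed
    ultimately show "P = Q" using sets by simp
  qed
qed

section \<open>Finite weighted versions of Levy measures\<close>

lemma nn_integral_weight_density:
  assumes N[measurable_cong]: "sets N = sets borel" and [measurable]: "f \<in> borel_measurable borel" and "f 0 = 0" "0 < c"
  shows "(\<integral>\<^sup>+x. f x * ennreal (c / levy_weight x) \<partial>density N (\<lambda>x. ennreal (levy_weight x / c))) = (integral\<^sup>N N f)"
proof -
  have "ennreal (levy_weight x / c) * (f x * ennreal (c / levy_weight x)) = f x" for x
  proof (cases "x = 0")
    case False
    then have "0 < levy_weight x" using levy_weight_nonneg[of x] levy_weight_eq_0_iff[of x] by simp
    then have "ennreal (levy_weight x / c) * ennreal (c / levy_weight x) = 1"
      using \<open>0 < c\<close> by (simp flip: ennreal_mult)
    then show ?thesis by (metis mult.commute mult.left_commute mult.right_neutral)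
  qed (simp add: \<open>f 0 = 0\<close>)
  then show ?thesis by (subst nn_integral_density) auto
qed

lemma finite_measure_weight_density:
  assumes N: "levy_borel N"
  shows "finite_measure (density N (\<lambda>x. ennreal (levy_weight x)))"
proof (rule finite_measureI)
  note levy_borelD[OF N, measurable_cong]
  have "emeasure (density N (\<lambda>x. ennreal (levy_weight x))) (space N) = (\<integral>\<^sup>+x. ennreal (levy_weight x) \<partial>N)"
    by (subst emeasure_density) (auto intro!: nn_integral_cong)
  then show "emeasure (density N (\<lambda>x. ennreal (levy_weight x))) (space (density N (\<lambda>x. ennreal (levy_weight x)))) \<noteq> \<infinity>"
    using N by (auto simp: levy_borel_def less_top)
qed

text \<open>Weighting makes both measures finite, so the determining class applies. The weight
  vanishes only at the origin, a null set, and can be divided out.\<close>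

lemma levy_borel_eqI:
  assumes P: "levy_borel P" and Q: "levy_borel Q"
    and S: "determining (S :: nat \<Rightarrow> 'a::real_normed_vector set)"
    and eq: "\<And>n. (\<integral>\<^sup>+x. ennreal (levy_weight x) * indicator (S n) x \<partial>P) = (\<integral>\<^sup>+x. ennreal (levy_weight x) * indicator (S n) x \<partial>Q)"
  shows "P = Q"
proof -
  note sets = levy_borelD[OF P] levy_borelD[OF Q]
  note sets[measurable_cong]
  have dens: "density P (\<lambda>x. ennreal (levy_weight x)) = density Q (\<lambda>x. ennreal (levy_weight x))"
  proof -
    have "S n \<in> sets borel" for n using S by (simp add: determining_def)
    then have "emeasure (density P (\<lambda>x. ennreal (levy_weight x))) (S n) = emeasure (density Q (\<lambda>x. ennreal (levy_weight x))) (S n)" for n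
      using eq by (simp add: sets emeasure_density)
    then show ?thesis
      using S finite_measure_weight_density[OF P] finite_measure_weight_density[OF Q]
      unfolding determining_def by (simp add: sets)
  qed
  show ?thesis
  proof (rule measure_eqI)
    show "sets P = sets Q" by (simp add: sets)
    fix A assume "A \<in> sets P"
    then have [measurable]: "A \<in> sets borel" by (simp add: sets)
    have K: "emeasure K A = (\<integral>\<^sup>+x. indicator (A - {0}) x * ennreal (1 / levy_weight x) \<partial>density K (\<lambda>x. ennreal (levy_weight x)))"
      if K: "levy_borel K" for K
    proof -
      have [simp]: "sets K = sets borel" using levy_borelD[OF K] .
      have "emeasure K A = emeasure K (A - {0})"
        using K by (intro emeasure_Diff_null_set[symmetric]) (auto simp: levy_borel_def null_sets_def)
      also have "\<dots> = (\<integral>\<^sup>+x. indicator (A - {0}) x \<partial>K)" by simp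
      also have "\<dots> = (\<integral>\<^sup>+x. indicator (A - {0}) x * ennreal (1 / levy_weight x) \<partial>density K (\<lambda>x. ennreal (levy_weight x)))"
        using nn_integral_weight_density[of K "indicator (A - {0})" 1] by simp
      finally show ?thesis .
    qed
    show "emeasure P A = emeasure Q A" unfolding K[OF P] K[OF Q] dens ..
  qed
qed

text \<open>By Markov's inequality the sets where the weight is at least
  \<open>1 / real (Suc n)\<close> have finite measure; what remains is the origin, a null
  set.\<close>

lemma sigma_finite_levy_borel:
  fixes N :: "'a::real_normed_vector measure"
  assumes N: "levy_borel N"
  shows "sigma_finite_measure N"
proof
  note levy_borelD[OF N, measurable_cong]
  have sp: "space N = UNIV" using sets_eq_imp_space_eq[OF levy_borelD[OF N]] by simp
  define A where "A n = {x :: 'a. 1 / real (Suc n) \<le> levy_weight x}" for n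
  have A: "A n \<in> sets borel" for n unfolding A_def by measurable
  have "emeasure N (A n) \<noteq> \<infinity>" for n
  proof -
    have "emeasure N (A n) = (\<integral>\<^sup>+x. indicator (A n) x \<partial>N)" using A by (simp add: levy_borelD[OF N])
    also have "\<dots> \<le> (\<integral>\<^sup>+x. ennreal (real (Suc n)) * ennreal (levy_weight x) \<partial>N)"
    proof (rule nn_integral_mono)
      fix x
      show "indicator (A n) x \<le> ennreal (real (Suc n)) * ennreal (levy_weight x)"
      proof (cases "x \<in> A n")
        case True
        then have "1 \<le> real (Suc n) * levy_weight x" by (simp add: A_def field_simps)
        then have "1 \<le> ennreal (real (Suc n) * levy_weight x)" by (metis ennreal_1 ennreal_leI)
        then show ?thesis using True by (simp add: ennreal_mult levy_weight_nonneg)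
      qed simp
    qed
    also have "\<dots> = ennreal (real (Suc n)) * (\<integral>\<^sup>+x. ennreal (levy_weight x) \<partial>N)"
      by (rule nn_integral_cmult) measurable
    also have "\<dots> < \<infinity>" using N by (simp add: levy_borel_def ennreal_mult_less_top)
    finally show ?thesis by simp
  qed
  moreover have "\<Union>(insert {0} (range A)) = space N"
  proof -
    have "\<exists>n. x \<in> A n" if "x \<noteq> 0" for x
    proof -
      have "0 < levy_weight x" using that levy_weight_nonneg[of x] levy_weight_eq_0_iff[of x] by simp
      then obtain n where "inverse (real (Suc n)) < levy_weight x" using reals_Archimedean by blast
      then show ?thesis by (auto simp: A_def inverse_eq_divide intro!: exI[of _ n])
    qed
    then show ?thesis by (auto simp: sp)
  qed
  ultimately show "\<exists>B. countable B \<and> B \<subseteq> sets N \<and> \<Union>B = space N \<and> (\<forall>a\<in>B. emeasure N a \<noteq> \<infinity>)"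
    using A N by (intro exI[of _ "insert {0} (range A)"]) (auto simp: levy_borelD[OF N] levy_borel_def)
qed

lemma nn_integral_lborel_shift:
  fixes f :: "real \<Rightarrow> ennreal"
  assumes "f \<in> borel_measurable borel"
  shows "(integral\<^sup>N lborel f) = (\<integral>\<^sup>+u. f (s + u) \<partial>lborel)"
  using nn_integral_real_affine[OF assms, of 1 s] by simp

context levy_flow
begin

lemma nn_integral_N_le:
  assumes "0 \<le> t" and f: "\<And>x. f x \<le> ennreal B * ennreal (levy_weight x)"
  shows "(integral\<^sup>N (N t) f) \<le> ennreal B * ennreal (mass t)"
proof -
  have "(integral\<^sup>N (N t) f) \<le> (\<integral>\<^sup>+x. ennreal B * ennreal (levy_weight x) \<partial>N t)"
    by (intro nn_integral_mono f)
  also have "\<dots> = ennreal B * ennreal (mass t)"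
    using assms by (subst nn_integral_cmult) (auto simp: measurable_cong_sets[OF sets_N refl] nn_integral_weight)
  finally show ?thesis .
qed

lemma nn_integral_N_finite:
  assumes "0 \<le> t" and f: "\<And>x. f x \<le> ennreal B * ennreal (levy_weight x)"
  shows "(integral\<^sup>N (N t) f) \<noteq> \<infinity>"
  using nn_integral_N_le[OF assms] by (auto simp: ennreal_mult_eq_top_iff top_unique)

text \<open>Domination by the weight keeps the integrals under \<open>N t\<close> finite, so they
  may be cancelled in additive identities.\<close>

definition test :: "(nat \<Rightarrow> 'a set) \<Rightarrow> nat \<Rightarrow> 'a \<Rightarrow> ennreal" where
  "test S n x = ennreal (levy_weight x) * indicator (S n) x"

lemma test_0: "test S n 0 = 0"
  by (simp add: test_def)

lemma measurable_test:
  assumes "determining S"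
  shows "test S n \<in> borel_measurable borel"
proof -
  have [measurable]: "S n \<in> sets borel" using assms by (simp add: determining_def)
  show ?thesis unfolding test_def by measurable
qed

lemma nn_integral_test_finite: "0 \<le> t \<Longrightarrow> (integral\<^sup>N (N t) (test S n)) \<noteq> \<infinity>"
  by (rule nn_integral_N_finite[of _ _ 1]) (auto simp: test_def indicator_def)

text \<open>The weighted measures divided by the Lipschitz constant \<open>K\<close> form an
  increasing family whose total mass is 1-Lipschitz, so they disintegrate into subprobabilities. The
  Levy kernel is \<open>\<nu> u\<close> with density \<open>W\<close>, which undoes weight and
  scaling.\<close>

lemma local_kernel:
  assumes \<epsilon>: "0 < \<epsilon>" "\<epsilon> \<le> t"
  obtains \<nu> and W :: "'a \<Rightarrow> ennreal" where "\<nu> \<in> borel \<rightarrow>\<^sub>M subprob_algebra borel" "W \<in> borel_measurable borel" "W 0 = 0"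
    "\<And>u. (\<integral>\<^sup>+x. ennreal (levy_weight x) * W x \<partial>\<nu> u) < \<infinity>"
    "\<And>x y f. \<epsilon> \<le> x \<Longrightarrow> x \<le> y \<Longrightarrow> y \<le> t \<Longrightarrow> f \<in> borel_measurable borel \<Longrightarrow> f 0 = 0 \<Longrightarrow>
      (integral\<^sup>N (N y) f) = (integral\<^sup>N (N x) f) + (\<integral>\<^sup>+u\<in>{x<..y}. (\<integral>\<^sup>+z. f z * W z \<partial>\<nu> u) \<partial>lborel)"
proof -
  obtain K where K: "0 < K" "\<And>x y. \<epsilon> \<le> x \<Longrightarrow> x \<le> y \<Longrightarrow> y \<le> t \<Longrightarrow> mass y - mass x \<le> K * (y - x)"
    using mass_lipschitz[OF \<epsilon>] by blast
  \<comment> \<open>Clamping time to \<open>[\<epsilon>, t]\<close> extends the family to all real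
    times while preserving monotonicity and the Lipschitz bound.\<close>
  define cl where "cl s = max \<epsilon> (min t s)" for s
  have cl: "0 \<le> cl s" "\<epsilon> \<le> cl s" "cl s \<le> t" for s using \<epsilon> by (auto simp: cl_def)
  have cl_mono: "cl x \<le> cl y" "cl y - cl x \<le> y - x" if "x \<le> y" for x y using that by (auto simp: cl_def)
  define \<rho> where "\<rho> s = density (N (cl s)) (\<lambda>x. ennreal (levy_weight x / K))" for s
  have sets_cl: "sets (N (cl s)) = sets borel" for s by (rule sets_N[OF cl(1)])
  note [measurable_cong] = sets_cl
  have sets_\<rho>: "sets (\<rho> s) = sets borel" for s by (simp add: \<rho>_def sets_cl)
  have \<rho>_eq: "emeasure (\<rho> s) A = (\<integral>\<^sup>+x. ennreal (levy_weight x / K) * indicator A x \<partial>N (cl s))" if "A \<in> sets borel" for s A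
    unfolding \<rho>_def using that by (subst emeasure_density) auto
  have total: "emeasure (\<rho> s) UNIV = ennreal (mass (cl s) / K)" for s
  proof -
    have "emeasure (\<rho> s) UNIV = (\<integral>\<^sup>+x. ennreal (levy_weight x / K) \<partial>N (cl s))" by (simp add: \<rho>_eq)
    also have "\<dots> = ennreal (LINT x|N (cl s). levy_weight x / K)"
      using K(1) cl(1) by (intro nn_integral_eq_integral) (auto simp: levy_weight_nonneg integrable_weight)
    finally show ?thesis by (simp add: mass_def)
  qed
  have fin: "finite_measure (\<rho> s)" for s
    using total[of s] sets_eq_imp_space_eq[OF sets_\<rho>] by (intro finite_measureI) simp
  obtain \<nu> where \<nu>[measurable]: "\<nu> \<in> borel \<rightarrow>\<^sub>M subprob_algebra borel"
    and dis: "\<And>x y. x \<le> y \<Longrightarrow> \<rho> y = add_measure (\<rho> x) (density lborel (indicator {x<..y}) \<bind> \<nu>)"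
  proof (rule disintegration[OF fin sets_\<rho>])
    show "emeasure (\<rho> x) A \<le> emeasure (\<rho> y) A" if xy: "x \<le> y" and A: "A \<in> sets borel" for x y A
    proof -
      have "N (cl y) = add_measure (push (T (cl x)) (N (cl y - cl x))) (N (cl x))"
        using additive[of "cl y - cl x" "cl x"] cl cl_mono[OF xy] by simp
      then show ?thesis
        using A unfolding \<rho>_eq[OF A]
        by (simp add: nn_integral_add_measure sets_cl measurable_cong_sets[OF sets_push refl])
    qed
    show "measure (\<rho> y) UNIV - measure (\<rho> x) UNIV \<le> y - x" if xy: "x \<le> y" for x y
    proof -
      have "mass (cl y) - mass (cl x) \<le> K * (cl y - cl x)" using cl cl_mono[OF xy] by (intro K) auto
      also have "\<dots> \<le> K * (y - x)" using cl_mono[OF xy] K(1) by (intro mult_left_mono) auto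
      finally show ?thesis
        using K(1) total[of x] total[of y] by (simp add: measure_def mass_nonneg field_simps)
    qed
  qed auto
  \<comment> \<open>Division by zero gives \<open>W 0 = 0\<close>, so this density also suppresses
    any mass that \<open>\<nu> u\<close> might have at the origin.\<close>
  define W where "W x = ennreal (K / levy_weight x)" for x :: 'a
  have [measurable]: "W \<in> borel_measurable borel" unfolding W_def by measurable
  show thesis
  proof (rule that[OF \<nu>])
    show "W \<in> borel_measurable borel" by measurable
    show "W 0 = 0" by (simp add: W_def)
    fix u
    interpret subprob_space "\<nu> u" using \<nu> by (rule subprob_space_kernel) simp
    have "(\<integral>\<^sup>+x. ennreal (levy_weight x) * W x \<partial>\<nu> u) \<le> (\<integral>\<^sup>+x. ennreal K \<partial>\<nu> u)"
      using K(1) by (intro nn_integral_mono) (auto simp: W_def levy_weight_nonneg simp flip: ennreal_mult)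
    also have "\<dots> < \<infinity>" by (auto simp: ennreal_mult_eq_top_iff less_top[symmetric])
    finally show "(\<integral>\<^sup>+x. ennreal (levy_weight x) * W x \<partial>\<nu> u) < \<infinity>" .
  next
    fix x y and f :: "'a \<Rightarrow> ennreal"
    assume xy: "\<epsilon> \<le> x" "x \<le> y" "y \<le> t" and [measurable]: "f \<in> borel_measurable borel" and f0: "f 0 = 0"
    have N: "(integral\<^sup>N (N s) f) = (\<integral>\<^sup>+z. f z * W z \<partial>\<rho> s)" if "\<epsilon> \<le> s" "s \<le> t" for s
    proof -
      have "cl s = s" using that by (simp add: cl_def)
      then show ?thesis
        using nn_integral_weight_density[of "N (cl s)" f K, OF sets_cl _ f0 K(1)] by (simp add: \<rho>_def W_def)
    qed
    let ?\<kappa> = "density lborel (indicator {x<..y}) \<bind> \<nu>"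
    have s: "sets ?\<kappa> = sets borel"
      by (rule sets_bind) (auto simp: sets_kernel[OF \<nu>])
    have "(integral\<^sup>N (N y) f) = (\<integral>\<^sup>+z. f z * W z \<partial>\<rho> y)" using xy by (intro N) auto
    also have "\<dots> = (\<integral>\<^sup>+z. f z * W z \<partial>\<rho> x) + (\<integral>\<^sup>+z. f z * W z \<partial>?\<kappa>)"
      unfolding dis[OF xy(2)]
      by (rule nn_integral_add_measure) (simp_all add: s sets_\<rho> measurable_cong_sets[OF sets_\<rho> refl])
    also have "(\<integral>\<^sup>+z. f z * W z \<partial>?\<kappa>) = (\<integral>\<^sup>+u. (\<integral>\<^sup>+z. f z * W z \<partial>\<nu> u) \<partial>density lborel (indicator {x<..y}))"
      by (rule nn_integral_bind[where B = borel]) measurable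
    also have "\<dots> = (\<integral>\<^sup>+u\<in>{x<..y}. (\<integral>\<^sup>+z. f z * W z \<partial>\<nu> u) \<partial>lborel)"
      by (subst nn_integral_density) (auto simp: mult.commute)
    also have "(\<integral>\<^sup>+z. f z * W z \<partial>\<rho> x) = (integral\<^sup>N (N x) f)" using xy by (intro N[symmetric]) auto
    finally show "(integral\<^sup>N (N y) f) = (integral\<^sup>N (N x) f) + (\<integral>\<^sup>+u\<in>{x<..y}. (\<integral>\<^sup>+z. f z * W z \<partial>\<nu> u) \<partial>lborel)" .
  qed
qed


text \<open>The measure \<open>\<nu>\<close> plays the role of the Levy density at time
  \<open>s\<close>: its orbit under the semigroup produces the whole growth of \<open>N\<close> up
  to \<open>t\<close>. Testing on functions that vanish at 0 replaces the restriction to the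
  punctured space.\<close>

definition entrance :: "real \<Rightarrow> real \<Rightarrow> 'a measure \<Rightarrow> bool" where
  "entrance s t \<nu> \<longleftrightarrow> levy_borel \<nu> \<and> 0 < s \<and> s < t \<and>
     (\<forall>y f. s \<le> y \<longrightarrow> y \<le> t \<longrightarrow> f \<in> borel_measurable borel \<longrightarrow> f 0 = 0 \<longrightarrow>
       (integral\<^sup>N (N y) f) = (integral\<^sup>N (N s) f) + (\<integral>\<^sup>+u\<in>{s<..y}. (\<integral>\<^sup>+x. f (T (max 0 (u - s)) x) \<partial>\<nu>) \<partial>lborel))"

lemma measurable_T_max [measurable]: "T (max 0 v) \<in> borel_measurable borel"
  by (rule measurable_T) simp

lemma measurable_T_compose [measurable (raw)]:
  "g \<in> borel_measurable M \<Longrightarrow> h \<in> borel_measurable M \<Longrightarrow> (\<lambda>z. T (max 0 (g z)) (h z)) \<in> borel_measurable M"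
  using measurable_compose[OF _ measurable_T_pair, of "\<lambda>z. (g z, h z)" M] by (simp add: borel_prod[symmetric])

text \<open>For almost every \<open>s\<close> the kernel satisfies \<open>\<nu> (s + v) = T v \<nu> s\<close> for almost every \<open>v\<close>,
  tested on a countable determining class; such an \<open>s\<close> is a good starting point.\<close>

lemma entrance_exists:
  assumes \<epsilon>: "0 < \<epsilon>" "\<epsilon> \<le> t"
  obtains s \<nu> where "s < \<epsilon>" "entrance s t \<nu>"
proof -
  \<comment> \<open>Halving leaves the interval between \<open>\<epsilon>'\<close> and \<epsilon>
    for the choice of \<open>s\<close>, inside the range of the kernel.\<close>
  define \<epsilon>' where "\<epsilon>' = \<epsilon> / 2"
  have \<epsilon>': "0 < \<epsilon>'" "\<epsilon>' \<le> t" using \<epsilon> by (auto simp: \<epsilon>'_def)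
  obtain \<nu> and W :: "'a \<Rightarrow> ennreal" where \<nu>[measurable]: "\<nu> \<in> borel \<rightarrow>\<^sub>M subprob_algebra borel"
    and W[measurable]: "W \<in> borel_measurable borel" and W0: "W 0 = 0"
    and W_fin: "\<And>u. (\<integral>\<^sup>+x. ennreal (levy_weight x) * W x \<partial>\<nu> u) < \<infinity>"
    and ker: "\<And>x y f. \<epsilon>' \<le> x \<Longrightarrow> x \<le> y \<Longrightarrow> y \<le> t \<Longrightarrow> f \<in> borel_measurable borel \<Longrightarrow> f 0 = 0 \<Longrightarrow>
      (integral\<^sup>N (N y) f) = (integral\<^sup>N (N x) f) + (\<integral>\<^sup>+u\<in>{x<..y}. (\<integral>\<^sup>+z. f z * W z \<partial>\<nu> u) \<partial>lborel)"
    using local_kernel[OF \<epsilon>'] by blast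
  obtain S :: "nat \<Rightarrow> 'a set" where S: "determining S" using determining_exists by blast
  define f where "f = test S"
  have f[measurable]: "f n \<in> borel_measurable borel" and f0: "f n 0 = 0" for n
    unfolding f_def by (rule measurable_test[OF S], rule test_0)
  define A where "A u h = (\<integral>\<^sup>+z. h z * W z \<partial>\<nu> u)" for u and h :: "'a \<Rightarrow> ennreal"
  have A_meas: "(\<lambda>u. A u h) \<in> borel_measurable borel" if [measurable]: "h \<in> borel_measurable borel" for h
    unfolding A_def by (rule measurable_compose[OF \<nu> nn_integral_measurable_subprob_algebra]) measurable
  have A_T_meas: "(\<lambda>(s, v). A s (\<lambda>x. f n (T (max 0 v) x))) \<in> borel_measurable (borel \<Otimes>\<^sub>M borel)" for n
  proof -
    have "(\<lambda>p. \<integral>\<^sup>+z. f n (T (max 0 (snd p)) z) * W z \<partial>\<nu> (fst p)) \<in> borel_measurable (borel \<Otimes>\<^sub>M borel)"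
      by (rule nn_integral_measurable_subprob_algebra2[where N = borel]) measurable
    then show ?thesis by (simp add: A_def case_prod_unfold)
  qed
  \<comment> \<open>With \<open>v\<close> fixed, the increment of \<open>N\<close> over the shifted
    interval is the image under \<open>T v\<close> of the original one, because the term
    \<open>N v\<close> of the additive relation is common to both ends. Equality of all such
    increments gives equality of the densities almost everywhere.\<close>
  have transport: "AE u in lborel. \<epsilon>' < u \<longrightarrow> u + v \<le> t \<longrightarrow> A (u + v) (f n) = A u (\<lambda>x. f n (T (max 0 v) x))"
    if v: "0 \<le> v" for v n
  proof -
    define fT where "fT x = f n (T (max 0 v) x)" for x
    have fT[measurable]: "fT \<in> borel_measurable borel" "fT 0 = 0" unfolding fT_def by (auto simp: T_zero f0)
    have "AE u in lborel. u \<in> {\<epsilon>'<..t - v} \<longrightarrow> A (u + v) (f n) = A u fT"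
    proof (rule AE_eqI_Ioc_within)
      show "(\<lambda>u. A (u + v) (f n)) \<in> borel_measurable borel"
        using measurable_compose[OF _ A_meas[OF f], of "\<lambda>u. u + v" borel n] by simp
      show "(\<lambda>u. A u fT) \<in> borel_measurable borel" by (rule A_meas[OF fT(1)])
      fix x y assume xy': "\<epsilon>' \<le> x" "x \<le> y" "y \<le> t - v"
      then have xy: "\<epsilon>' \<le> x" "x \<le> y" "y + v \<le> t" "0 \<le> x" using \<epsilon>' by auto
      have "(\<integral>\<^sup>+u\<in>{x+v<..y+v}. A u (f n) \<partial>lborel) = (\<integral>\<^sup>+u. A (v + u) (f n) * indicator {x+v<..y+v} (v + u) \<partial>lborel)"
        by (rule nn_integral_lborel_shift) (use A_meas[OF f] in simp)
      also have "\<dots> = (\<integral>\<^sup>+u\<in>{x<..y}. A (u + v) (f n) \<partial>lborel)"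
        by (intro nn_integral_cong) (auto simp: add.commute split: split_indicator)
      finally have shift: "(\<integral>\<^sup>+u\<in>{x+v<..y+v}. A u (f n) \<partial>lborel) = (\<integral>\<^sup>+u\<in>{x<..y}. A (u + v) (f n) \<partial>lborel)" .
      have N1: "(integral\<^sup>N (N (w + v)) (f n)) = (integral\<^sup>N (N w) fT) + (integral\<^sup>N (N v) (f n))" if "0 \<le> w" for w
        using nn_integral_N_add[OF that v f f0] v by (simp add: fT_def[abs_def] max_def)
      have N2: "(integral\<^sup>N (N (y + v)) (f n)) = (integral\<^sup>N (N (x + v)) (f n)) + (\<integral>\<^sup>+u\<in>{x<..y}. A (u + v) (f n) \<partial>lborel)"
        unfolding shift[symmetric] unfolding A_def by (rule ker) (use xy v f0 in auto)
      have N3: "(integral\<^sup>N (N y) fT) = (integral\<^sup>N (N x) fT) + (\<integral>\<^sup>+u\<in>{x<..y}. A u fT \<partial>lborel)"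
        unfolding A_def by (rule ker) (use xy v fT in auto)
      have "(integral\<^sup>N (N (x + v)) (f n)) + (\<integral>\<^sup>+u\<in>{x<..y}. A (u + v) (f n) \<partial>lborel)
          = (integral\<^sup>N (N (x + v)) (f n)) + (\<integral>\<^sup>+u\<in>{x<..y}. A u fT \<partial>lborel)"
        using N2 N3 N1[of y] N1[of x] xy by (simp add: ac_simps)
      moreover have "(integral\<^sup>N (N (x + v)) (f n)) \<noteq> \<infinity>" "(integral\<^sup>N (N (y + v)) (f n)) \<noteq> \<infinity>"
        using xy v nn_integral_test_finite[of "x + v" S n] nn_integral_test_finite[of "y + v" S n] by (auto simp: f_def)
      ultimately show "(\<integral>\<^sup>+u\<in>{x<..y}. A (u + v) (f n) \<partial>lborel) = (\<integral>\<^sup>+u\<in>{x<..y}. A u fT \<partial>lborel) \<and>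
          (\<integral>\<^sup>+u\<in>{x<..y}. A (u + v) (f n) \<partial>lborel) \<noteq> \<infinity>"
        using N2 by (auto simp: ennreal_add_left_cancel)
    qed
    then show ?thesis unfolding fT_def by eventually_elim auto
  qed
  \<comment> \<open>The premises confine the claim to the range of the kernel and make it vacuous
    elsewhere, so that it is a condition on all real pairs.\<close>
  define good where "good s v \<longleftrightarrow> (0 \<le> v \<longrightarrow> \<epsilon>' < s \<longrightarrow> s + v \<le> t \<longrightarrow>
      (\<forall>n. A (s + v) (f n) = A s (\<lambda>x. f n (T (max 0 v) x))))" for s v
  have "AE v in lborel. AE s in lborel. good s v"
  proof (rule AE_I2)
    fix v
    show "AE s in lborel. good s v"
    proof (cases "0 \<le> v")
      case True
      have "AE u in lborel. \<forall>n. \<epsilon>' < u \<longrightarrow> u + v \<le> t \<longrightarrow> A (u + v) (f n) = A u (\<lambda>x. f n (T (max 0 v) x))"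
        unfolding AE_all_countable using transport[OF True] by blast
      then show ?thesis by eventually_elim (simp add: good_def)
    qed (simp add: good_def)
  qed
  \<comment> \<open>Joint measurability, which rests on the joint continuity of the semigroup,
    allows the quantifiers to be exchanged.\<close>
  then have "AE s in lborel. AE v in lborel. good s v"
  proof (subst lborel_pair.AE_commute)
    have [measurable]: "(\<lambda>p. A (fst p) (\<lambda>x. f n (T (max 0 (snd p)) x))) \<in> borel_measurable (borel \<Otimes>\<^sub>M borel)" for n
      using A_T_meas[of n] by (simp add: case_prod_unfold)
    have [measurable]: "(\<lambda>p. A (fst p + snd p) (f n)) \<in> borel_measurable (borel \<Otimes>\<^sub>M borel)" for n
      by (rule measurable_compose[OF _ A_meas[OF f]]) measurable
    show "{x \<in> space (lborel \<Otimes>\<^sub>M lborel). good (fst x) (snd x)} \<in> sets (lborel \<Otimes>\<^sub>M lborel)"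
      unfolding good_def by measurable
  qed
  then obtain s where s: "\<epsilon>' < s" "s < \<epsilon>" and good: "AE v in lborel. good s v"
    by (rule AE_lborel_in_interval[where a = \<epsilon>' and b = \<epsilon>]) (use \<epsilon> in \<open>auto simp: \<epsilon>'_def\<close>)
  have s': "0 < s" "s < t" using s \<epsilon> \<epsilon>' by auto
  define \<nu>s where "\<nu>s = density (\<nu> s) W"
  have sets_\<nu>: "sets (\<nu> s) = sets borel" using sets_kernel[OF \<nu>, of s] by simp
  note [measurable_cong] = sets_\<nu>
  have \<nu>s_int: "(integral\<^sup>N (\<nu>s) h) = A s h" if [measurable]: "h \<in> borel_measurable borel" for h
    unfolding \<nu>s_def A_def by (subst nn_integral_density) (auto simp: mult.commute)
  have levy_\<nu>s: "levy_borel \<nu>s"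
    unfolding levy_borel_def
  proof (intro conjI)
    show sets_\<nu>s: "sets \<nu>s = sets borel" by (simp add: \<nu>s_def sets_\<nu>)
    have "emeasure \<nu>s {0} = (\<integral>\<^sup>+x. indicator {0} x \<partial>\<nu>s)" by (simp add: sets_\<nu>s)
    also have "\<dots> = A s (indicator {0})" by (rule \<nu>s_int) simp
    also have "\<dots> = (\<integral>\<^sup>+x. 0 \<partial>\<nu> s)" unfolding A_def by (intro nn_integral_cong) (auto simp: W0 split: split_indicator)
    finally show "emeasure \<nu>s {0} = 0" by simp
    show "(\<integral>\<^sup>+x. ennreal (levy_weight x) \<partial>\<nu>s) < \<infinity>"
      using W_fin[of s] by (subst \<nu>s_int) (auto simp: A_def)
  qed
  interpret \<nu>s: sigma_finite_measure \<nu>s by (rule sigma_finite_levy_borel[OF levy_\<nu>s])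
  note sets_\<nu>s[measurable_cong] = levy_borelD[OF levy_\<nu>s]
  have "entrance s t \<nu>s"
    unfolding entrance_def
  proof (intro conjI allI impI levy_\<nu>s s')
    fix y assume y: "s \<le> y" "y \<le> t"
    \<comment> \<open>As the image of a product measure, the accumulated growth is itself a measure
      and can be compared with \<open>N y\<close> on the determining class.\<close>
    define Q where "Q = push (\<lambda>(u, x). T (max 0 (u - s)) x) (density lborel (indicator {s<..y}) \<Otimes>\<^sub>M \<nu>s)"
    have sets_pair: "sets (density lborel (indicator {s<..y}) \<Otimes>\<^sub>M \<nu>s) = sets borel"
      unfolding borel_prod[symmetric] by (rule sets_pair_measure_cong) (simp_all add: sets_\<nu>s)
    have Q: "(integral\<^sup>N Q h) = (\<integral>\<^sup>+u\<in>{s<..y}. (\<integral>\<^sup>+x. h (T (max 0 (u - s)) x) \<partial>\<nu>s) \<partial>lborel)"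
      if [measurable]: "h \<in> borel_measurable borel" and "h 0 = 0" for h
    proof -
      have "(integral\<^sup>N Q h) = (\<integral>\<^sup>+p. h (case p of (u, x) \<Rightarrow> T (max 0 (u - s)) x) \<partial>(density lborel (indicator {s<..y}) \<Otimes>\<^sub>M \<nu>s))"
        unfolding Q_def
        by (rule nn_integral_push[OF sets_pair _ that]) (simp add: borel_prod[symmetric] case_prod_unfold)
      also have "\<dots> = (\<integral>\<^sup>+u. \<integral>\<^sup>+x. h (T (max 0 (u - s)) x) \<partial>\<nu>s \<partial>density lborel (indicator {s<..y}))"
        by (subst \<nu>s.nn_integral_fst[symmetric]) (auto simp: case_prod_unfold)
      also have "\<dots> = (\<integral>\<^sup>+u\<in>{s<..y}. (\<integral>\<^sup>+x. h (T (max 0 (u - s)) x) \<partial>\<nu>s) \<partial>lborel)"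
        by (subst nn_integral_density) (auto simp: mult.commute)
      finally show ?thesis .
    qed
    have sets_Q: "sets Q = sets borel" by (simp add: Q_def)
    have sets_Ns: "sets (N s) = sets borel" using s' by (intro sets_N) simp
    have add: "(integral\<^sup>N (add_measure (N s) Q) h) = (integral\<^sup>N (N s) h) + (integral\<^sup>N Q h)"
      if [measurable]: "h \<in> borel_measurable borel" for h
      by (rule nn_integral_add_measure) (simp_all add: sets_Q sets_Ns measurable_cong_sets[OF sets_Ns refl])
    have fn: "(integral\<^sup>N (N y) (f n)) = (integral\<^sup>N (add_measure (N s) Q) (f n))" for n
    proof -
      have "(integral\<^sup>N (N y) (f n)) = (integral\<^sup>N (N s) (f n)) + (\<integral>\<^sup>+u\<in>{s<..y}. A u (f n) \<partial>lborel)"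
        unfolding A_def by (rule ker) (use s y f0 in auto)
      also have "(\<integral>\<^sup>+u\<in>{s<..y}. A u (f n) \<partial>lborel) = (\<integral>\<^sup>+v. A (s + v) (f n) * indicator {s<..y} (s + v) \<partial>lborel)"
        by (rule nn_integral_lborel_shift) (use A_meas[OF f] in simp)
      also have "\<dots> = (\<integral>\<^sup>+v. A s (\<lambda>x. f n (T (max 0 v) x)) * indicator {s<..y} (s + v) \<partial>lborel)"
      proof (rule nn_integral_cong_AE)
        show "AE v in lborel. A (s + v) (f n) * indicator {s<..y} (s + v) =
            A s (\<lambda>x. f n (T (max 0 v) x)) * indicator {s<..y} (s + v)"
          using good
        proof eventually_elim
          case (elim v)
          then show ?case
            using s y by (cases "s + v \<in> {s<..y}") (simp_all add: good_def)
        qed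
      qed
      also have "\<dots> = (\<integral>\<^sup>+u\<in>{s<..y}. A s (\<lambda>x. f n (T (max 0 (u - s)) x)) \<partial>lborel)"
      proof -
        have "(\<lambda>v. A s (\<lambda>x. f n (T (max 0 v) x))) \<in> borel_measurable borel"
          using measurable_compose[OF measurable_Pair1'[of s borel borel] A_T_meas[of n]] by simp
        from measurable_compose[OF _ this, of "\<lambda>u. u - s" borel]
        show ?thesis by (subst (2) nn_integral_lborel_shift[of _ s]) auto
      qed
      also have "\<dots> = (integral\<^sup>N Q (f n))"
        using f0 by (subst Q) (auto intro!: nn_integral_cong simp: \<nu>s_int)
      finally show ?thesis by (simp add: add)
    qed
    have "N y = add_measure (N s) Q"
    proof (rule levy_borel_eqI[OF levy _ S])
      show "0 \<le> y" using s' y by simp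
      have "emeasure (add_measure (N s) Q) {0} = 0"
        using levy[of s] s' by (simp add: emeasure_add_measure sets_Q sets_Ns levy_borel_def) (simp add: Q_def emeasure_push_0)
      \<comment> \<open>The test function with index 0 is the weight itself, since
        \<open>S 0 = UNIV\<close>; finiteness is inherited from \<open>N y\<close>.\<close>
      moreover have "(\<integral>\<^sup>+x. ennreal (levy_weight x) \<partial>add_measure (N s) Q) = (\<integral>\<^sup>+x. ennreal (levy_weight x) \<partial>N y)"
        using fn[of 0] S by (simp add: f_def test_def[abs_def] determining_def)
      ultimately show "levy_borel (add_measure (N s) Q)"
        using nn_integral_weight[of y] \<open>0 \<le> y\<close> by (simp add: levy_borel_def sets_Ns)
      show "(\<integral>\<^sup>+x. ennreal (levy_weight x) * indicator (S n) x \<partial>N y) = (\<integral>\<^sup>+x. ennreal (levy_weight x) * indicator (S n) x \<partial>add_measure (N s) Q)" for n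
        using fn[of n] by (simp add: f_def test_def[abs_def])
    qed
    fix h :: "'a \<Rightarrow> ennreal" assume h: "h \<in> borel_measurable borel" "h 0 = 0"
    show "(integral\<^sup>N (N y) h) = (integral\<^sup>N (N s) h) + (\<integral>\<^sup>+u\<in>{s<..y}. (\<integral>\<^sup>+x. h (T (max 0 (u - s)) x) \<partial>\<nu>s) \<partial>lborel)"
      unfolding \<open>N y = add_measure (N s) Q\<close> add[OF h(1)] Q[OF h] ..
  qed
  then show thesis using that s(2) by blast
qed

end

section \<open>The kernel\<close>

lemma measure_eqI_off_0:
  fixes P Q :: "'a::{zero, t1_space} measure"
  assumes sets: "sets P = sets borel" "sets Q = sets borel" and null: "emeasure P {0} = 0" "emeasure Q {0} = 0"
    and eq: "\<And>f. f \<in> borel_measurable borel \<Longrightarrow> f 0 = 0 \<Longrightarrow> (integral\<^sup>N P f) = (integral\<^sup>N Q f)"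
  shows "P = Q"
proof (rule measure_eqI)
  show "sets P = sets Q" by (simp add: sets)
  fix A assume "A \<in> sets P"
  then have A: "A \<in> sets borel" by (simp add: sets)
  have "emeasure P A = emeasure P (A - {0})"
    using A null by (intro emeasure_Diff_null_set[symmetric]) (auto simp: sets null_sets_def)
  also have "\<dots> = emeasure Q (A - {0})"
    using eq[of "indicator (A - {0})"] A by (simp add: sets)
  also have "\<dots> = emeasure Q A"
    using A null by (intro emeasure_Diff_null_set) (auto simp: sets null_sets_def)
  finally show "emeasure P A = emeasure Q A" .
qed

context levy_flow
begin

lemma levy_borel_push_T:
  assumes "levy_borel \<nu>" "0 \<le> v"
  shows "levy_borel (push (T v) \<nu>)"
proof -
  obtain C where "1 \<le> C" "\<And>s x. 0 \<le> s \<Longrightarrow> s \<le> v \<Longrightarrow> norm (T s x) \<le> C * norm x"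
    using semigroup_locally_bounded[OF T] by blast
  then show ?thesis
    using assms by (intro levy_borel_push[of _ _ C] bounded_linear.linear[OF T_linear]) auto
qed

lemma push_push_T:
  assumes \<nu>: "sets \<nu> = sets borel" and "0 \<le> v" "0 \<le> w"
  shows "push (T w) (push (T v) \<nu>) = push (T (v + w)) \<nu>"
proof (rule measure_eqI_off_0)
  fix f :: "'a \<Rightarrow> ennreal" assume f: "f \<in> borel_measurable borel" "f 0 = 0"
  have "(integral\<^sup>N (push (T w) (push (T v) \<nu>)) f) = (\<integral>\<^sup>+x. f (T w x) \<partial>push (T v) \<nu>)"
    by (intro nn_integral_push measurable_T assms f) simp
  also have "\<dots> = (\<integral>\<^sup>+x. f (T w (T v x)) \<partial>\<nu>)"
    using assms f by (intro nn_integral_push measurable_T measurable_compose[OF measurable_T f(1)]) (simp_all add: T_zero)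
  also have "\<dots> = (\<integral>\<^sup>+x. f (T (v + w) x) \<partial>\<nu>)"
    using assms by (simp add: add.commute[of v w] T_plus)
  also have "\<dots> = (integral\<^sup>N (push (T (v + w)) \<nu>) f)"
    using assms by (intro nn_integral_push[symmetric] measurable_T f) simp_all
  finally show "(integral\<^sup>N (push (T w) (push (T v) \<nu>)) f) = (integral\<^sup>N (push (T (v + w)) \<nu>) f)" .
qed (simp_all add: emeasure_push_0)

lemma measurable_entrance_integral:
  assumes \<nu>: "levy_borel \<nu>" and [measurable]: "f \<in> borel_measurable borel"
  shows "(\<lambda>u. \<integral>\<^sup>+x. f (T (max 0 (u - s)) x) \<partial>\<nu>) \<in> borel_measurable borel"
proof -
  note levy_borelD[OF \<nu>, measurable_cong]
  interpret sigma_finite_measure \<nu> by (rule sigma_finite_levy_borel[OF \<nu>])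
  show ?thesis by (rule borel_measurable_nn_integral) (simp add: case_prod_unfold)
qed

lemma entrance_basic:
  assumes "entrance s t \<nu>"
  shows "levy_borel \<nu>" "0 < s" "s < t"
  by (rule assms[unfolded entrance_def, THEN conjunct1] assms[unfolded entrance_def, THEN conjunct2, THEN conjunct1]
      assms[unfolded entrance_def, THEN conjunct2, THEN conjunct2, THEN conjunct1])+

lemma entranceD:
  assumes "entrance s t \<nu>" "s \<le> y" "y \<le> t" "f \<in> borel_measurable borel" "f 0 = 0"
  shows "(integral\<^sup>N (N y) f) = (integral\<^sup>N (N s) f) + (\<integral>\<^sup>+u\<in>{s<..y}. (\<integral>\<^sup>+x. f (T (max 0 (u - s)) x) \<partial>\<nu>) \<partial>lborel)"
  using assms(1)[unfolded entrance_def, THEN conjunct2, THEN conjunct2, THEN conjunct2, rule_format, OF assms(2-5)] .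

lemma entrance_increment:
  assumes ent: "entrance s t \<nu>" and xy: "s \<le> x" "x \<le> y" "y \<le> t" and f: "f \<in> borel_measurable borel" "f 0 = 0"
  shows "(integral\<^sup>N (N y) f) = (integral\<^sup>N (N x) f) + (\<integral>\<^sup>+u\<in>{x<..y}. (\<integral>\<^sup>+z. f (T (max 0 (u - s)) z) \<partial>\<nu>) \<partial>lborel)"
proof -
  define a where "a u = (\<integral>\<^sup>+z. f (T (max 0 (u - s)) z) \<partial>\<nu>)" for u
  have [measurable]: "a \<in> borel_measurable borel"
    unfolding a_def by (intro measurable_entrance_integral entrance_basic[OF ent] f)
  have start: "(integral\<^sup>N (N w) f) = (integral\<^sup>N (N s) f) + (\<integral>\<^sup>+u\<in>{s<..w}. a u \<partial>lborel)" if "s \<le> w" "w \<le> t" for w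
    unfolding a_def by (rule entranceD[OF ent that f])
  have "(\<integral>\<^sup>+u\<in>{s<..y}. a u \<partial>lborel) = (\<integral>\<^sup>+u. (a u * indicator {s<..x} u + a u * indicator {x<..y} u) \<partial>lborel)"
    using xy by (intro nn_integral_cong) (auto split: split_indicator)
  also have "\<dots> = (\<integral>\<^sup>+u\<in>{s<..x}. a u \<partial>lborel) + (\<integral>\<^sup>+u\<in>{x<..y}. a u \<partial>lborel)"
    by (rule nn_integral_add) simp_all
  finally show ?thesis
    using start[of x] start[of y] xy unfolding a_def[symmetric] by (simp add: ac_simps)
qed

text \<open>Both measures describe the growth of \<open>N\<close> on a common interval to the right
  of \<open>s'\<close>, so their tested orbits agree at almost every time there. One such time
  before \<open>u\<close> is enough: the semigroup carries the equality on to \<open>u\<close>,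
  which may lie beyond \<open>t\<close>.\<close>

lemma entrance_unique:
  assumes 1: "entrance s t \<nu>" and 2: "entrance s' t' \<nu>'" and s: "s \<le> s'" "s' < t" "s' < u"
  shows "push (T (u - s)) \<nu> = push (T (u - s')) \<nu>'"
proof -
  have levy_\<nu>: "levy_borel \<nu>" "levy_borel \<nu>'" and s'_pos: "0 < s'" "s' < t'" by (rule entrance_basic[OF 1] entrance_basic[OF 2])+
  obtain S :: "nat \<Rightarrow> 'a set" where S: "determining S" using determining_exists by blast
  define \<tau> where "\<tau> = min t t'"
  define a where "a n v = (\<integral>\<^sup>+z. test S n (T (max 0 (v - s)) z) \<partial>\<nu>)" for n v
  define a' where "a' n v = (\<integral>\<^sup>+z. test S n (T (max 0 (v - s')) z) \<partial>\<nu>')" for n v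
  have "AE v in lborel. v \<in> {s'<..\<tau>} \<longrightarrow> a n v = a' n v" for n
  proof (rule AE_eqI_Ioc_within)
    show "a n \<in> borel_measurable borel" "a' n \<in> borel_measurable borel"
      unfolding a_def a'_def by (intro measurable_entrance_integral levy_\<nu> measurable_test[OF S])+
    fix x y assume "s' \<le> x" "x \<le> y" "y \<le> \<tau>"
    then have xy: "s \<le> x" "s' \<le> x" "x \<le> y" "y \<le> t" "y \<le> t'" "0 \<le> x" "0 \<le> y"
      using s s'_pos by (auto simp: \<tau>_def)
    have A: "(integral\<^sup>N (N y) (test S n)) = (integral\<^sup>N (N x) (test S n)) + (\<integral>\<^sup>+v\<in>{x<..y}. a n v \<partial>lborel)"
      unfolding a_def by (rule entrance_increment[OF 1 xy(1,3,4) measurable_test[OF S] test_0])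
    have B: "(integral\<^sup>N (N y) (test S n)) = (integral\<^sup>N (N x) (test S n)) + (\<integral>\<^sup>+v\<in>{x<..y}. a' n v \<partial>lborel)"
      unfolding a'_def by (rule entrance_increment[OF 2 xy(2,3,5) measurable_test[OF S] test_0])
    show "(\<integral>\<^sup>+v\<in>{x<..y}. a n v \<partial>lborel) = (\<integral>\<^sup>+v\<in>{x<..y}. a' n v \<partial>lborel) \<and> (\<integral>\<^sup>+v\<in>{x<..y}. a n v \<partial>lborel) \<noteq> \<infinity>"
      using A B nn_integral_test_finite[OF xy(6), of S n] nn_integral_test_finite[OF xy(7), of S n]
      by (auto simp: ennreal_add_left_cancel)
  qed
  then have AE: "AE v in lborel. \<forall>n. v \<in> {s'<..\<tau>} \<longrightarrow> a n v = a' n v"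
    unfolding AE_all_countable by blast
  define w where "w = min \<tau> u"
  have w: "s' < w" using s s'_pos by (auto simp: w_def \<tau>_def)
  obtain v where v: "s' < v" "v < w" and "\<forall>n. v \<in> {s'<..\<tau>} \<longrightarrow> a n v = a' n v"
    by (rule AE_lborel_in_interval[OF AE w])
  then have eq: "a n v = a' n v" for n by (auto simp: w_def)
  have sv: "max 0 (v - s) = v - s" "max 0 (v - s') = v - s'" "0 \<le> v - s" "0 \<le> v - s'" "0 \<le> u - v"
    using v s by (auto simp: w_def)
  have "push (T (v - s)) \<nu> = push (T (v - s')) \<nu>'"
  proof (rule levy_borel_eqI[OF _ _ S])
    fix n
    have "(integral\<^sup>N (push (T (v - s)) \<nu>) (test S n)) = a n v"
      unfolding a_def sv by (intro nn_integral_push measurable_T measurable_test[OF S] test_0 sv levy_borelD levy_\<nu>)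
    moreover have "(integral\<^sup>N (push (T (v - s')) \<nu>') (test S n)) = a' n v"
      unfolding a'_def sv by (intro nn_integral_push measurable_T measurable_test[OF S] test_0 sv levy_borelD levy_\<nu>)
    ultimately show "(\<integral>\<^sup>+x. ennreal (levy_weight x) * indicator (S n) x \<partial>push (T (v - s)) \<nu>)
        = (\<integral>\<^sup>+x. ennreal (levy_weight x) * indicator (S n) x \<partial>push (T (v - s')) \<nu>')"
      by (simp add: eq test_def[abs_def])
  qed (auto intro!: levy_borel_push_T levy_\<nu> sv)
  then have "push (T (u - v)) (push (T (v - s)) \<nu>) = push (T (u - v)) (push (T (v - s')) \<nu>')" by simp
  then show ?thesis
    using sv by (simp add: push_push_T levy_borelD[OF levy_\<nu>(1)] levy_borelD[OF levy_\<nu>(2)])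
qed

text \<open>The integral identity covers test functions dominated by the weight, for which both
  sides are finite. The indicator confines measurability to positive times, as \<open>L\<close> is
  arbitrary elsewhere.\<close>

definition levy_density :: "(real \<Rightarrow> 'a measure) \<Rightarrow> bool" where
  "levy_density L \<longleftrightarrow> (\<forall>u>0. levy_borel (L u)) \<and>
     (\<forall>f. f \<in> borel_measurable borel \<longrightarrow> f 0 = 0 \<longrightarrow> (\<lambda>u. indicator {0<..} u * (integral\<^sup>N (L u) f)) \<in> borel_measurable borel) \<and>
     (\<forall>t f B. 0 \<le> t \<longrightarrow> f \<in> borel_measurable borel \<longrightarrow> (\<forall>x. f x \<le> ennreal B * ennreal (levy_weight x)) \<longrightarrow>
       (integral\<^sup>N (N t) f) = (\<integral>\<^sup>+u\<in>{0<..t}. (integral\<^sup>N (L u) f) \<partial>lborel))"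

lemma levy_density_levy: "levy_density L \<Longrightarrow> 0 < u \<Longrightarrow> levy_borel (L u)"
  by (simp only: levy_density_def)

lemma levy_density_measurable:
  assumes "levy_density L" "f \<in> borel_measurable borel" "f 0 = 0"
  shows "(\<lambda>u. indicator {0<..} u * (integral\<^sup>N (L u) f)) \<in> borel_measurable borel"
  by (rule assms(1)[unfolded levy_density_def, THEN conjunct2, THEN conjunct1, rule_format, OF assms(2,3)])

lemma levy_density_integral:
  assumes "levy_density L" "0 \<le> t" "f \<in> borel_measurable borel" "\<And>x. f x \<le> ennreal B * ennreal (levy_weight x)"
  shows "(integral\<^sup>N (N t) f) = (\<integral>\<^sup>+u\<in>{0<..t}. (integral\<^sup>N (L u) f) \<partial>lborel)"
  by (rule assms(1)[unfolded levy_density_def, THEN conjunct2, THEN conjunct2, rule_format, OF assms(2-4)])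

text \<open>Entrance measures are taken at times \<open>s n\<close> tending to 0 with horizons
  tending to infinity. For a test function dominated by the weight, the part of \<open>N t\<close>
  accumulated before \<open>s n\<close> is at most a multiple of \<open>mass (s n)\<close> and
  disappears in the limit.\<close>

lemma levy_density_exists:
  obtains L where "levy_density L" "\<And>r t. 0 < r \<Longrightarrow> 0 < t \<Longrightarrow> L (r + t) = push (T t) (L r)"
proof -
  have "\<exists>s \<nu>. s < inverse (real (Suc n)) \<and> entrance s (real (Suc n)) \<nu>" for n
  proof -
    have "0 < inverse (real (Suc n))" "inverse (real (Suc n)) \<le> real (Suc n)" by (auto simp: field_simps)
    then show ?thesis using entrance_exists[of "inverse (real (Suc n))" "real (Suc n)"] by blast
  qed
  then obtain s \<nu> where s_less: "\<And>n. s n < inverse (real (Suc n))" and ent: "\<And>n. entrance (s n) (real (Suc n)) (\<nu> n)"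
    by metis
  have s_pos: "0 < s n" and levy_\<nu>: "levy_borel (\<nu> n)" for n by (rule entrance_basic[OF ent])+
  \<comment> \<open>Each starting time lies below 1 and each horizon is at least 1, so the time
    intervals of any two entrance measures overlap.\<close>
  have s_1: "s n < real (Suc m)" for n m
    using s_less[of n] by (rule less_le_trans) (simp add: field_simps)
  have s_lim: "s \<longlonglongrightarrow> 0"
    by (rule tendsto_sandwich[OF _ _ tendsto_const LIMSEQ_inverse_real_of_nat])
      (use s_pos s_less in \<open>auto intro!: always_eventually less_imp_le simp del: of_nat_Suc\<close>)
  define L where "L u = (let n = (SOME n. s n < u) in push (T (u - s n)) (\<nu> n))" for u
  have L_eq: "L u = push (T (u - s n)) (\<nu> n)" if "s n < u" for n u
  proof -
    define m where "m = (SOME n. s n < u)"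
    have m: "s m < u" unfolding m_def using that by (rule someI)
    have "push (T (u - s m)) (\<nu> m) = push (T (u - s n)) (\<nu> n)"
    proof (cases "s m \<le> s n")
      case True
      then show ?thesis by (intro entrance_unique[OF ent ent] s_1 that)
    next
      case False
      then show ?thesis by (intro entrance_unique[OF ent ent, symmetric] s_1 m) simp
    qed
    then show ?thesis by (simp add: L_def m_def Let_def)
  qed
  have below: "\<forall>\<^sub>F n in sequentially. s n < u" if "0 < u" for u using s_lim that by (simp add: order_tendstoD)
  have ex: "\<exists>n. s n < u" if "0 < u" for u using below[OF that] by (auto simp: eventually_sequentially)
  \<comment> \<open>If \<open>f\<close> vanishes at 0, then for each \<open>u > 0\<close> this
    sequence is eventually equal to the integral under \<open>L u\<close>. Measurability in
    \<open>u\<close> passes to the limit, whatever index the choice in \<open>L\<close>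
    selects.\<close>
  define h where "h f n u = indicator {s n<..} u * (\<integral>\<^sup>+x. f (T (max 0 (u - s n)) x) \<partial>\<nu> n)" for f :: "'a \<Rightarrow> ennreal" and n u
  have h_meas: "h f n \<in> borel_measurable borel" if "f \<in> borel_measurable borel" for f n
    unfolding h_def using measurable_entrance_integral[OF levy_\<nu> that] by simp
  have h_eq: "h f n u = indicator {s n<..} u * (integral\<^sup>N (L u) f)" if f: "f \<in> borel_measurable borel" "f 0 = 0" for f n u
  proof (cases "s n < u")
    case True
    then have "(integral\<^sup>N (L u) f) = (\<integral>\<^sup>+x. f (T (u - s n) x) \<partial>\<nu> n)"
      unfolding L_eq[OF True] by (intro nn_integral_push levy_borelD levy_\<nu> measurable_T f) simp
    then show ?thesis using True by (simp add: h_def)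
  qed (simp add: h_def)
  have h_liminf: "liminf (\<lambda>n. h f n u) = indicator {0<..} u * (integral\<^sup>N (L u) f)"
    if f: "f \<in> borel_measurable borel" "f 0 = 0" for f u
  proof -
    have "(\<lambda>n. h f n u) \<longlonglongrightarrow> indicator {0<..} u * (integral\<^sup>N (L u) f)"
    proof (rule tendsto_eventually)
      show "\<forall>\<^sub>F n in sequentially. h f n u = indicator {0<..} u * (integral\<^sup>N (L u) f)"
      proof (cases "0 < u")
        case True
        then show ?thesis using below[OF True] by (auto simp: h_eq[OF f] elim!: eventually_mono)
      next
        case False
        then have "\<not> s n < u" for n using s_pos[of n] by simp
        then show ?thesis using False by (simp add: h_def)
      qed
    qed
    then show ?thesis by (simp add: lim_imp_Liminf)
  qed
  show thesis
  proof (rule that[of L])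
    show "L (r + t) = push (T t) (L r)" if rt: "0 < r" "0 < t" for r t
    proof -
      obtain n where n: "s n < r" using ex[OF rt(1)] by blast
      then have "s n < r + t" using rt by simp
      have "push (T t) (push (T (r - s n)) (\<nu> n)) = push (T ((r - s n) + t)) (\<nu> n)"
        using n rt by (intro push_push_T levy_borelD levy_\<nu>) auto
      then show ?thesis unfolding L_eq[OF n] L_eq[OF \<open>s n < r + t\<close>] by (simp add: algebra_simps)
    qed
    show "levy_density L"
      unfolding levy_density_def
    proof (intro conjI allI impI)
      fix u :: real assume u: "0 < u"
      show "levy_borel (L u)"
      proof -
        obtain n where "s n < u" using ex[OF u] by blast
        then show ?thesis unfolding L_eq[OF \<open>s n < u\<close>] by (intro levy_borel_push_T levy_\<nu>) simp
      qed
      next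
      fix f :: "'a \<Rightarrow> ennreal" assume f: "f \<in> borel_measurable borel" "f 0 = 0"
      show "(\<lambda>u. indicator {0<..} u * (integral\<^sup>N (L u) f)) \<in> borel_measurable borel"
        unfolding h_liminf[OF f, symmetric] using h_meas[OF f(1)] by (intro borel_measurable_liminf)
      next
      fix t B :: real and f :: "'a \<Rightarrow> ennreal"
      assume t: "0 \<le> t" and f: "f \<in> borel_measurable borel" and "\<forall>x. f x \<le> ennreal B * ennreal (levy_weight x)"
      then have bnd: "f x \<le> ennreal B * ennreal (levy_weight x)" for x by simp
      have f0: "f 0 = 0" using bnd[of 0] by simp
      define I where "I n = (\<integral>\<^sup>+u\<in>{0<..t}. h f n u \<partial>lborel)" for n
      have Nt: "(integral\<^sup>N (N t) f) = (integral\<^sup>N (N (s n)) f) + I n" if "s n \<le> t" "t \<le> real (Suc n)" for n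
      proof -
        have "I n = (\<integral>\<^sup>+u\<in>{s n<..t}. (\<integral>\<^sup>+x. f (T (max 0 (u - s n)) x) \<partial>\<nu> n) \<partial>lborel)"
          unfolding I_def h_def using s_pos[of n] by (intro nn_integral_cong) (auto split: split_indicator)
        then show ?thesis using entrance_increment[OF ent[of n] order_refl that f f0] by simp
      qed
      have Lu: "(\<integral>\<^sup>+u\<in>{0<..t}. (integral\<^sup>N (L u) f) \<partial>lborel) = (\<integral>\<^sup>+u\<in>{0<..t}. liminf (\<lambda>n. h f n u) \<partial>lborel)"
        unfolding h_liminf[OF f f0] by (intro nn_integral_cong) (auto split: split_indicator)
      show "(integral\<^sup>N (N t) f) = (\<integral>\<^sup>+u\<in>{0<..t}. (integral\<^sup>N (L u) f) \<partial>lborel)"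
      proof (cases "t = 0")
        case True
        \<comment> \<open>The right-hand side is an integral over an empty interval, so
          \<open>N 0\<close> must carry no weight; monotonicity bounds its mass by
          \<open>mass (s n)\<close>.\<close>
        have "mass 0 \<le> 0"
        proof (rule LIMSEQ_le_const[OF mass_tendsto_0[OF s_lim s_pos]])
          show "\<exists>n0. \<forall>n\<ge>n0. mass 0 \<le> mass (s n)" using mass_mono[OF order_refl] s_pos less_imp_le by blast
        qed
        then have m0: "mass 0 = 0" using mass_nonneg[of 0] by simp
        have "(integral\<^sup>N (N 0) f) \<le> ennreal B * ennreal (mass 0)" by (rule nn_integral_N_le[OF order_refl bnd])
        then show ?thesis using True by (simp add: m0)
      next
        case False
        then have "0 < t" using t by simp
        have ev: "\<forall>\<^sub>F n in sequentially. s n \<le> t \<and> t \<le> real (Suc n)"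
        proof -
          have "\<forall>\<^sub>F n in sequentially. t \<le> real (Suc n)"
            using eventually_ge_at_top[of "nat \<lceil>t\<rceil>"] by eventually_elim linarith
          then show ?thesis using below[OF \<open>0 < t\<close>] by eventually_elim auto
        qed
        show ?thesis
        \<comment> \<open>In the upper bound the remainder before \<open>s n\<close> vanishes in the
          limit; the lower bound is Fatou's lemma for the functions \<open>h f n\<close>.\<close>
        proof (rule antisym)
          have "(integral\<^sup>N (N t) f) \<le> ennreal B * ennreal (mass (s n)) + (\<integral>\<^sup>+u\<in>{0<..t}. (integral\<^sup>N (L u) f) \<partial>lborel)"
            if n: "s n \<le> t \<and> t \<le> real (Suc n)" for n
          proof -
            have "(integral\<^sup>N (N (s n)) f) \<le> ennreal B * ennreal (mass (s n))"
              by (rule nn_integral_N_le[OF less_imp_le[OF s_pos] bnd])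
            moreover have "I n \<le> (\<integral>\<^sup>+u\<in>{0<..t}. (integral\<^sup>N (L u) f) \<partial>lborel)"
              unfolding I_def by (intro nn_integral_mono) (auto simp: h_eq[OF f f0] split: split_indicator)
            ultimately show ?thesis
              unfolding Nt[OF conjunct1[OF n] conjunct2[OF n]] by (rule add_mono)
          qed
          then have "\<forall>\<^sub>F n in sequentially. (integral\<^sup>N (N t) f) \<le> ennreal B * ennreal (mass (s n)) + (\<integral>\<^sup>+u\<in>{0<..t}. (integral\<^sup>N (L u) f) \<partial>lborel)"
            using ev by (auto elim: eventually_mono)
          moreover have "(\<lambda>n. ennreal B * ennreal (mass (s n)) + (\<integral>\<^sup>+u\<in>{0<..t}. (integral\<^sup>N (L u) f) \<partial>lborel))
              \<longlonglongrightarrow> ennreal B * ennreal 0 + (\<integral>\<^sup>+u\<in>{0<..t}. (integral\<^sup>N (L u) f) \<partial>lborel)"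
            by (intro tendsto_add tendsto_const ennreal_tendsto_cmult tendsto_ennrealI mass_tendsto_0 s_lim s_pos) simp
          ultimately show "(integral\<^sup>N (N t) f) \<le> (\<integral>\<^sup>+u\<in>{0<..t}. (integral\<^sup>N (L u) f) \<partial>lborel)"
            using tendsto_lowerbound by fastforce
          have "(\<integral>\<^sup>+u\<in>{0<..t}. liminf (\<lambda>n. h f n u) \<partial>lborel) = (\<integral>\<^sup>+u. liminf (\<lambda>n. h f n u * indicator {0<..t} u) \<partial>lborel)"
            by (intro nn_integral_cong) (auto simp: Liminf_const split: split_indicator)
          also have "\<dots> \<le> liminf I"
            unfolding I_def using h_meas[OF f] by (intro nn_integral_liminf) simp
          also have "\<dots> \<le> liminf (\<lambda>n. \<integral>\<^sup>+x. f x \<partial>N t)"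
            using ev by (intro Liminf_mono) (auto elim!: eventually_mono simp: Nt)
          finally show "(\<integral>\<^sup>+u\<in>{0<..t}. (integral\<^sup>N (L u) f) \<partial>lborel) \<le> (integral\<^sup>N (N t) f)"
            unfolding Lu by (simp add: Liminf_const)
        qed
      qed
    qed
  qed
qed


section \<open>Signed and complex integrands\<close>

lemma integral_flow_real:
  fixes L :: "real \<Rightarrow> 'a measure" and k :: "'a \<Rightarrow> real"
  assumes dens: "levy_density L"
    and t: "0 \<le> t" and k[measurable]: "k \<in> borel_measurable borel" and bnd: "\<And>x. \<bar>k x\<bar> \<le> B * levy_weight x"
  shows "integrable lborel (\<lambda>u. indicator {0<..t} u * (LINT x|L u. k x))"
    and "(LINT x|N t. k x) = (LINT u|lborel. indicator {0<..t} u * (LINT x|L u. k x))"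
proof -
  note L = levy_density_levy[OF dens]
  define p where "p f u = (\<integral>\<^sup>+x. ennreal (f x) \<partial>L u)" for f :: "'a \<Rightarrow> real" and u
  \<comment> \<open>Since \<open>ennreal\<close> truncates at 0, \<open>p f u\<close> integrates the
    positive part of \<open>f\<close>. Applying this to \<open>k\<close> and to \<open>- k\<close>
    splits a signed integrand.\<close>
  have part: "integrable lborel (\<lambda>u. indicator {0<..t} u * enn2real (p f u))"
    "(LINT u|lborel. indicator {0<..t} u * enn2real (p f u)) = enn2real (\<integral>\<^sup>+x. ennreal (f x) \<partial>N t)"
    if f[measurable]: "f \<in> borel_measurable borel" and fb: "\<And>x. f x \<le> B * levy_weight x" for f
  proof -
    have fb': "ennreal (f x) \<le> ennreal \<bar>B\<bar> * ennreal (levy_weight x)" for x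
      using fb[of x] mult_right_mono[OF abs_ge_self[of B] levy_weight_nonneg[of x]]
      by (auto simp: levy_weight_nonneg ennreal_leI simp flip: ennreal_mult)
    have f0: "ennreal (f 0) = 0" using fb[of 0] by (simp add: ennreal_neg)
    have "(\<lambda>u. indicator {0<..} u * p f u) \<in> borel_measurable borel"
      unfolding p_def using f0 by (intro levy_density_measurable[OF dens]) simp_all
    \<comment> \<open>Measurability is available only after multiplication by the indicator of the
      positive times, which changes nothing on \<open>{0<..t}\<close>.\<close>
    then have "(\<lambda>u. indicator {0<..t} u * enn2real (indicator {0<..} u * p f u)) \<in> borel_measurable borel" by measurable
    also have "(\<lambda>u. indicator {0<..t} u * enn2real (indicator {0<..} u * p f u)) = (\<lambda>u. indicator {0<..t} u * enn2real (p f u))"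
      by (auto split: split_indicator)
    finally have m: "(\<lambda>u. indicator {0<..t} u * enn2real (p f u)) \<in> borel_measurable borel" .
    have fin: "p f u < \<infinity>" if u: "0 < u" for u
    proof -
      note levy_borelD[OF L[OF u], measurable_cong]
      have "p f u \<le> (\<integral>\<^sup>+x. ennreal \<bar>B\<bar> * ennreal (levy_weight x) \<partial>L u)" unfolding p_def by (intro nn_integral_mono fb')
      also have "\<dots> = ennreal \<bar>B\<bar> * (\<integral>\<^sup>+x. ennreal (levy_weight x) \<partial>L u)" by (rule nn_integral_cmult) measurable
      also have "\<dots> < \<infinity>" using L[OF u] by (simp add: levy_borel_def ennreal_mult_less_top)
      finally show ?thesis .
    qed
    have eq: "(\<integral>\<^sup>+u. ennreal (indicator {0<..t} u * enn2real (p f u)) \<partial>lborel) = (\<integral>\<^sup>+x. ennreal (f x) \<partial>N t)"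
    proof -
      have "(\<integral>\<^sup>+x. ennreal (f x) \<partial>N t) = (\<integral>\<^sup>+u\<in>{0<..t}. p f u \<partial>lborel)"
        unfolding p_def by (rule levy_density_integral[OF dens t _ fb']) measurable
      also have "\<dots> = (\<integral>\<^sup>+u. ennreal (indicator {0<..t} u * enn2real (p f u)) \<partial>lborel)"
        using fin by (intro nn_integral_cong) (auto split: split_indicator)
      finally show ?thesis by simp
    qed
    have "(\<integral>\<^sup>+x. ennreal (f x) \<partial>N t) < \<infinity>" using nn_integral_N_finite[OF t fb'] by (simp add: less_top)
    then show "integrable lborel (\<lambda>u. indicator {0<..t} u * enn2real (p f u))"
      using m eq by (intro integrableI_nonneg) auto
    show "(LINT u|lborel. indicator {0<..t} u * enn2real (p f u)) = enn2real (\<integral>\<^sup>+x. ennreal (f x) \<partial>N t)"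
      using m by (subst integral_eq_nn_integral) (auto simp: eq)
  qed
  have pm: "k x \<le> B * levy_weight x" "- k x \<le> B * levy_weight x" for x using bnd[of x] by linarith+
  have inner: "indicator {0<..t} u * (LINT x|L u. k x) =
      indicator {0<..t} u * enn2real (p k u) - indicator {0<..t} u * enn2real (p (\<lambda>x. - k x) u)" for u
  proof (cases "u \<in> {0<..t}")
    case True
    then have "integrable (L u) k"
      using bnd by (intro levy_borel_integrable[OF L, of u k B]) auto
    then show ?thesis using True by (simp add: real_lebesgue_integral_def p_def)
  qed simp
  show "integrable lborel (\<lambda>u. indicator {0<..t} u * (LINT x|L u. k x))"
    unfolding inner using pm by (intro Bochner_Integration.integrable_diff part) auto
  have "integrable (N t) k" using t bnd by (intro integrable_N) auto
  then have "(LINT x|N t. k x) = enn2real (\<integral>\<^sup>+x. ennreal (k x) \<partial>N t) - enn2real (\<integral>\<^sup>+x. ennreal (- k x) \<partial>N t)"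
    by (rule real_lebesgue_integral_def)
  also have "\<dots> = (LINT u|lborel. indicator {0<..t} u * enn2real (p k u)) - (LINT u|lborel. indicator {0<..t} u * enn2real (p (\<lambda>x. - k x) u))"
    using pm by (simp add: part)
  also have "\<dots> = (LINT u|lborel. indicator {0<..t} u * (LINT x|L u. k x))"
    unfolding inner using pm by (intro Bochner_Integration.integral_diff[symmetric] part) auto
  finally show "(LINT x|N t. k x) = (LINT u|lborel. indicator {0<..t} u * (LINT x|L u. k x))" .
qed

lemma integral_flow_complex:
  fixes L :: "real \<Rightarrow> 'a measure" and k :: "'a \<Rightarrow> complex"
  assumes dens: "levy_density L"
    and t: "0 \<le> t" and k[measurable]: "k \<in> borel_measurable borel" and bnd: "\<And>x. cmod (k x) \<le> B * levy_weight x"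
  shows "(CLINT x|N t. k x) = (CLINT u:{0<..t}|lborel. (CLINT x|L u. k x))"
proof -
  have bnds: "\<bar>Re (k x)\<bar> \<le> B * levy_weight x" "\<bar>Im (k x)\<bar> \<le> B * levy_weight x" for x
    using bnd[of x] abs_Re_le_cmod[of "k x"] abs_Im_le_cmod[of "k x"] by linarith+
  have [measurable]: "(\<lambda>x. Re (k x)) \<in> borel_measurable borel" "(\<lambda>x. Im (k x)) \<in> borel_measurable borel" by measurable
  define re where "re u = indicator {0<..t} u * (LINT x|L u. Re (k x))" for u
  define im where "im u = indicator {0<..t} u * (LINT x|L u. Im (k x))" for u
  have re: "integrable lborel re" "(LINT x|N t. Re (k x)) = integral\<^sup>L lborel re"
    unfolding re_def by (rule integral_flow_real[OF dens t _ bnds(1)], measurable)+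
  have im: "integrable lborel im" "(LINT x|N t. Im (k x)) = integral\<^sup>L lborel im"
    unfolding im_def by (rule integral_flow_real[OF dens t _ bnds(2)], measurable)+
  have intk: "integrable P k" if "levy_borel P" for P
    by (rule levy_borel_integrable[OF that k bnd])
  have "indicator {0<..t} u *\<^sub>R (CLINT x|L u. k x) = complex_of_real (re u) + \<i> * complex_of_real (im u)" for u
    using intk[OF levy_density_levy[OF dens, of u]] by (auto simp: re_def im_def complex_eq_iff split: split_indicator)
  then have "(CLINT u:{0<..t}|lborel. (CLINT x|L u. k x)) = complex_of_real (integral\<^sup>L lborel re) + \<i> * complex_of_real (integral\<^sup>L lborel im)"
    unfolding set_lebesgue_integral_def using re(1) im(1) by simp
  also have "\<dots> = complex_of_real (LINT x|N t. Re (k x)) + \<i> * complex_of_real (LINT x|N t. Im (k x))"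
    using re(2) im(2) by simp
  also have "\<dots> = (CLINT x|N t. k x)"
    using intk[OF levy[OF t]] by (simp add: complex_eq_iff)
  finally show ?thesis by simp
qed

end

lemma emeasure_push:
  assumes P: "sets P = sets borel" and A: "A \<in> borel_measurable borel" and B: "B \<in> sets borel" "0 \<notin> B"
  shows "emeasure (push A P) B = emeasure P (A -` B)"
proof -
  have "emeasure (push A P) B = (\<integral>\<^sup>+x. indicator B x \<partial>push A P)" using B by simp
  also have "\<dots> = (\<integral>\<^sup>+x. indicator B (A x) \<partial>P)"
    using B by (intro nn_integral_push P A) simp_all
  also have "\<dots> = (\<integral>\<^sup>+x. indicator (A -` B) x \<partial>P)" by (intro nn_integral_cong) (auto split: split_indicator)
  also have "\<dots> = emeasure P (A -` B)"
    using measurable_sets_borel[OF A B(1)] by (simp add: P)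
  finally show ?thesis .
qed

theorem theorem2p2:
  fixes T :: "real \<Rightarrow> 'a::{real_inner, complete_space, second_countable_topology} \<Rightarrow> 'a"
    and \<mu> :: "real \<Rightarrow> 'a measure"
    and b :: "real \<Rightarrow> 'a"
    and R :: "real \<Rightarrow> 'a \<Rightarrow> 'a"
    and M :: "real \<Rightarrow> 'a measure"
  assumes "strongly_continuous_semigroup T"
    and "sc_semigroup T \<mu>"
    and "\<And>t. t \<ge> 0 \<Longrightarrow> symmetric_op (R t) \<and> positive_op (R t) \<and> nuclear_op (R t)"
    and "\<And>t. t \<ge> 0 \<Longrightarrow> levy_measure (M t)"
    and "\<And>t a. t \<ge> 0 \<Longrightarrow> char_functional (\<mu> t) a =
           exp (\<i> * of_real (b t \<bullet> a) - of_real (R t a \<bullet> a) / 2 + (CLINT x|M t. levy_K x a))"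
  shows "\<exists>L :: real \<Rightarrow> 'a measure.
           sigma_finite_kernel (restrict_space borel {0<..}) borel_punctured L \<and>
           (\<forall>r>0. \<forall>t>0. L (r + t) = restrict_space (distr (L r) borel (T t)) (- {0})) \<and>
           (\<forall>t\<ge>0. (\<integral>\<^sup>+s\<in>{0<..t}. (\<integral>\<^sup>+x. ennreal (min 1 ((norm x)\<^sup>2)) \<partial>L s) \<partial>lborel) < \<infinity>) \<and>
           (\<forall>t\<ge>0. \<forall>a. (CLINT x|M t. levy_K x a) =
              (CLINT s:{0<..t}|lborel. (CLINT x|L s. levy_K x a)))"
proof -
  have R_linear: "linear (R t)" if "0 \<le> t" for t
    using assms(3)[OF that] by (simp add: nuclear_op_def bounded_linear.linear)
  have sets_M: "sets (M t) = sets borel_punctured" if "0 \<le> t" for t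
    using assms(4)[OF that] by (simp add: levy_measure_def)
  interpret levy_flow T "\<lambda>t. punctured_ext (M t)"
  proof
    show "punctured_ext (M (r + t)) = add_measure (push (T t) (punctured_ext (M r))) (punctured_ext (M t))"
      if "0 \<le> r" "0 \<le> t" for r t
      by (rule sc_semigroup_levy_additive[OF assms(1,2) R_linear assms(4,5) that])
  qed (use assms(1,4) levy_borel_punctured_ext in auto)
  obtain L where dens: "levy_density L" and L_push: "\<And>r t. 0 < r \<Longrightarrow> 0 < t \<Longrightarrow> L (r + t) = push (T t) (L r)"
  proof (rule levy_density_exists, goal_cases)
    case (1 L)
    show ?case by (rule 1(1)[OF 1(2,3)])
  qed
  note L = levy_density_levy[OF dens]
  \<comment> \<open>Restriction returns to the punctured space. The weight and \<open>levy_K\<close>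
    vanish at 0, so their integrals do not change.\<close>
  define L0 where "L0 u = restrict_space (L u) (- {0})" for u
  have sets_L: "sets (L u) = sets borel" if "0 < u" for u by (rule levy_borelD[OF L[OF that]])
  have sets_L0: "sets (L0 u) = sets borel_punctured" if "0 < u" for u
    unfolding L0_def borel_punctured_def by (rule sets_restrict_space_cong[OF sets_L[OF that]])
  have L0_emeasure: "emeasure (L0 u) B = emeasure (L u) B" if "0 < u" "B \<subseteq> - {0}" for u B
    unfolding L0_def by (rule emeasure_restrict_space) (use that sets_L[OF that(1)] in auto)
  have punctured: "B \<in> sets borel \<and> B \<subseteq> - {0}" if "B \<in> sets borel_punctured" for B :: "'a set"
    using that by (auto simp: borel_punctured_def sets_restrict_space)
  have L0_nn: "(integral\<^sup>N (L0 u) f) = (integral\<^sup>N (L u) f)" if "0 < u" "f 0 = 0" for u and f :: "'a \<Rightarrow> ennreal"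
  proof -
    have "(integral\<^sup>N (L0 u) f) = (\<integral>\<^sup>+x. f x * indicator (- {0}) x \<partial>L u)"
      unfolding L0_def by (rule nn_integral_restrict_space) (simp add: sets_L[OF that(1)])
    also have "\<dots> = (integral\<^sup>N (L u) f)"
      using that(2) by (intro nn_integral_cong) (auto split: split_indicator)
    finally show ?thesis .
  qed
  have L0_K: "(CLINT x|L0 u. levy_K x a) = (CLINT x|L u. levy_K x a)" if "0 < u" for u a
  proof -
    have "(CLINT x|L0 u. levy_K x a) = (CLINT x|L u. indicator (- {0}) x *\<^sub>R levy_K x a)"
      unfolding L0_def by (rule integral_restrict_space) (simp add: sets_L[OF that])
    also have "\<dots> = (CLINT x|L u. levy_K x a)"
      by (intro Bochner_Integration.integral_cong) (auto simp: levy_K_def split: split_indicator)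
    finally show ?thesis .
  qed
  show ?thesis
  proof (intro exI[of _ L0] conjI allI impI)
    show "sigma_finite_kernel (restrict_space borel {0<..}) borel_punctured L0"
      unfolding sigma_finite_kernel_def
    proof (intro conjI ballI)
      fix u :: real assume "u \<in> space (restrict_space borel {0<..})"
      then have u: "0 < u" by (simp add: space_restrict_space)
      show "sets (L0 u) = sets borel_punctured" by (rule sets_L0[OF u])
      show "sigma_finite_measure (L0 u)"
        unfolding L0_def by (rule sigma_finite_measure_restrict_space[OF sigma_finite_levy_borel[OF L[OF u]]]) (simp add: sets_L[OF u])
    next
      fix B :: "'a set" assume "B \<in> sets borel_punctured"
      then have B: "B \<in> sets borel" "B \<subseteq> - {0}" using punctured by auto
      have "(\<lambda>u. indicator {0<..} u * (\<integral>\<^sup>+x. indicator B x \<partial>L u)) \<in> borel_measurable (restrict_space borel {0<..})"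
        using B by (intro measurable_restrict_space1 levy_density_measurable[OF dens]) (auto simp: indicator_def)
      then show "(\<lambda>u. emeasure (L0 u) B) \<in> borel_measurable (restrict_space borel {0<..})"
        by (rule measurable_cong[THEN iffD1, rotated]) (simp add: space_restrict_space L0_emeasure[OF _ B(2)] B(1) sets_L)
    qed
  next
    fix r t :: real assume r: "0 < r" and t: "0 < t"
    have Tt: "T t \<in> borel_measurable borel" using t by (intro measurable_T) simp
    show "L0 (r + t) = restrict_space (distr (L0 r) borel (T t)) (- {0})"
    proof (rule measure_eqI)
      show "sets (L0 (r + t)) = sets (restrict_space (distr (L0 r) borel (T t)) (- {0}))"
        using r t by (simp add: sets_L0 borel_punctured_def sets_restrict_space)
      fix B assume "B \<in> sets (L0 (r + t))"
      then have B: "B \<in> sets borel" "B \<subseteq> - {0}" using punctured[of B] r t by (auto simp: sets_L0)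
      \<comment> \<open>\<open>T t\<close> fixes 0, so the preimage of a set avoiding 0 avoids it as
        well and can be measured by \<open>L0 r\<close>.\<close>
      have pre: "T t -` B \<in> sets borel" "T t -` B \<subseteq> - {0}"
        using measurable_sets_borel[OF Tt B(1)] B(2) t by (auto simp: T_zero)
      have Tt': "T t \<in> borel_measurable (L0 r)" by (rule measurable_punctured[OF sets_L0[OF r] Tt])
      have sp: "space (L0 r) = - {0}"
        using sets_eq_imp_space_eq[OF sets_L0[OF r]] by (simp add: borel_punctured_def space_restrict_space)
      have "emeasure (restrict_space (distr (L0 r) borel (T t)) (- {0})) B = emeasure (distr (L0 r) borel (T t)) B"
        using B by (intro emeasure_restrict_space) auto
      also have "\<dots> = emeasure (L0 r) (T t -` B \<inter> space (L0 r))" by (rule emeasure_distr[OF Tt' B(1)])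
      also have "T t -` B \<inter> space (L0 r) = T t -` B" using pre(2) sp by auto
      also have "emeasure (L0 r) (T t -` B) = emeasure (L r) (T t -` B)" by (rule L0_emeasure[OF r pre(2)])
      also have "\<dots> = emeasure (push (T t) (L r)) B"
        using B by (intro emeasure_push[symmetric] sets_L r Tt) auto
      also have "\<dots> = emeasure (L0 (r + t)) B"
        using r t by (simp add: L0_emeasure[OF _ B(2)] L_push)
      finally show "emeasure (L0 (r + t)) B = emeasure (restrict_space (distr (L0 r) borel (T t)) (- {0})) B" by simp
    qed
  next
    fix t :: real assume t: "0 \<le> t"
    have "(\<integral>\<^sup>+s\<in>{0<..t}. (\<integral>\<^sup>+x. ennreal (min 1 ((norm x)\<^sup>2)) \<partial>L0 s) \<partial>lborel)
        = (\<integral>\<^sup>+s\<in>{0<..t}. (\<integral>\<^sup>+x. ennreal (levy_weight x) \<partial>L s) \<partial>lborel)"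
      by (intro nn_integral_cong) (auto simp: L0_nn levy_weight_def split: split_indicator)
    also have "\<dots> = (\<integral>\<^sup>+x. ennreal (levy_weight x) \<partial>punctured_ext (M t))"
      by (rule levy_density_integral[OF dens t, of _ 1, symmetric]) simp_all
    also have "\<dots> < \<infinity>" using levy[OF t] by (simp add: levy_borel_def)
    finally show "(\<integral>\<^sup>+s\<in>{0<..t}. (\<integral>\<^sup>+x. ennreal (min 1 ((norm x)\<^sup>2)) \<partial>L0 s) \<partial>lborel) < \<infinity>" .
  next
    fix t :: real and a :: 'a assume t: "0 \<le> t"
    have "(CLINT x|M t. levy_K x a) = (CLINT x|punctured_ext (M t). levy_K x a)"
      by (rule integral_punctured_ext[OF sets_M[OF t], symmetric]) measurable
    also have "\<dots> = (CLINT s:{0<..t}|lborel. (CLINT x|L s. levy_K x a))"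
      by (rule integral_flow_complex[OF dens t _ norm_levy_K_le]) simp_all
    also have "\<dots> = (CLINT s:{0<..t}|lborel. (CLINT x|L0 s. levy_K x a))"
      unfolding set_lebesgue_integral_def
      by (intro Bochner_Integration.integral_cong) (auto simp: L0_K split: split_indicator)
    finally show "(CLINT x|M t. levy_K x a) = (CLINT s:{0<..t}|lborel. (CLINT x|L0 s. levy_K x a))" .
  qed
qed

end
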